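(* Let $n\ge 1$, let $M$ be an $n\times n$ GUE random matrix, and let $R^{(1)}$ be its one-point function (density of eigenvalues). (i) If $n=2k+1$ is odd, then $$\sup_{x\in\mathbb{R}} R^{(1)}(x)=R^{(1)}(0)=\frac{1}{\sqrt{2\pi}}\,\frac{(2k+1)!}{2^{2k}\,[k!]^2}=\frac{1}{\pi}\sqrt{n}\,\exp\Bigl\{\frac{1}{4n}+O(n^{-3})\Bigr\},$$ where the $O(n^{-3})$ refers to $n\to\infty$ through odd integers. (ii) If $n$ is even, then $$\sup_{x\in\mathbb{R}} R^{(1)}(x)=R^{(1)}(\pm x_n)=\frac{n}{\sqrt{2\pi}}\,p_{n-1}(x_n)^2\,e^{-\frac12 x_n^2},$$ where $x_n$ is the smallest positive zero of the rescaled Hermite polynomial $p_n$. Moreover, $R^{(1)}(x)<R^{(1)}(\pm x_n)$ for every real $x\ne\pm x_n$.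
   Context: GUE: the real vector space of $n\times n$ complex Hermitian matrices carries the inner product $\langle A,B\rangle=\operatorname{Re}\operatorname{tr}(A^\dagger B)$, with $\dagger$ the Hermitian conjugate. Let $\{E_j\}$ be an orthonormal basis over $\mathbb{R}$ of this space and let $Z_j\sim N(0,1)$ be independent standard real Gaussians. The law of $\sum_j Z_jE_j$ is called GUE. One-point function: $R^{(1)}:\mathbb{R}\to[0,\infty)$ is the (continuous) function determined by $\int_{\mathbb{R}}q(x)R^{(1)}(x)\,dx=\mathbb{E}\operatorname{tr}\{q(M)\}$ for all polynomials $q$; in particular $\int_{\mathbb{R}} R^{(1)}(x)\,dx=n$. Rescaled Hermite polynomials: $p_k(x)=\frac{(-1)^k}{\sqrt{k!}}\,e^{\frac12x^2}\frac{d^k}{dx^k}e^{-\frac12x^2}=\frac{x^k}{\sqrt{k!}}+\text{lower order}$; these are orthonormal with respect to the measure $(2\pi)^{-1/2}e^{-x^2/2}\,dx$ on $\mathbb{R}$. *)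

theory Defs
  imports
    "HOL-Probability.Probability"
    "HOL-Library.Landau_Symbols"
    "HOL-Computational_Algebra.Polynomial"
    "Jordan_Normal_Form.Schur_Decomposition"
begin

definition mat_tr :: "complex mat \<Rightarrow> complex" where
  "mat_tr A = (\<Sum>i<dim_row A. A $$ (i, i))"

definition hermitian_mats :: "nat \<Rightarrow> complex mat set" where
  "hermitian_mats n = {A \<in> carrier_mat n n. mat_adjoint A = A}"

definition mat_inner :: "complex mat \<Rightarrow> complex mat \<Rightarrow> real" where
  "mat_inner A B = Re (mat_tr (mat_adjoint A * B))"

(* Sums of matrices are written entrywise because the type of matrices, which carries all
   dimensions at once, has no zero and is not a commutative monoid. *)
definition real_lincomb :: "nat \<Rightarrow> nat \<Rightarrow> (nat \<Rightarrow> complex mat) \<Rightarrow> (nat \<Rightarrow> real) \<Rightarrow> complex mat" where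
  "real_lincomb n d E z =
     Matrix.mat n n (\<lambda>rs. \<Sum>j<d. complex_of_real (z j) * E j $$ rs)"

(* Linear independence is implied by orthonormality. *)
definition hermitian_orthonormal_basis :: "nat \<Rightarrow> nat \<Rightarrow> (nat \<Rightarrow> complex mat) \<Rightarrow> bool" where
  "hermitian_orthonormal_basis n d E \<longleftrightarrow>
     (\<forall>j<d. E j \<in> hermitian_mats n) \<and>
     (\<forall>i<d. \<forall>j<d. mat_inner (E i) (E j) = (if i = j then 1 else 0)) \<and>
     (\<forall>A\<in>hermitian_mats n. \<exists>c. A = real_lincomb n d E c)"

(* Borel sigma-algebra: the restriction to the Hermitian matrices of the one on the n * n entries. *)
definition hermitian_borel :: "nat \<Rightarrow> complex mat measure" where
  "hermitian_borel n =
     vimage_algebra (hermitian_mats n)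
       (\<lambda>A. \<lambda>rs\<in>{..<n} \<times> {..<n}. A $$ rs)
       (\<Pi>\<^sub>M rs\<in>{..<n} \<times> {..<n}. (borel :: complex measure))"

(* Independence of the Gaussian coordinates is expressed by the product measure. *)
definition gaussian_lincomb_law :: "nat \<Rightarrow> nat \<Rightarrow> (nat \<Rightarrow> complex mat) \<Rightarrow> complex mat measure" where
  "gaussian_lincomb_law n d E =
     distr (\<Pi>\<^sub>M j\<in>{..<d}. density lborel (\<lambda>x. ennreal (std_normal_density x)))
       (hermitian_borel n) (real_lincomb n d E)"

definition gue_random_matrix :: "nat \<Rightarrow> 'a measure \<Rightarrow> ('a \<Rightarrow> complex mat) \<Rightarrow> bool" where
  "gue_random_matrix n P M \<longleftrightarrow>
     prob_space P \<and> M \<in> measurable P (hermitian_borel n) \<and>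
     (\<exists>d E. hermitian_orthonormal_basis n d E \<and>
            distr P (hermitian_borel n) M = gaussian_lincomb_law n d E)"

definition poly_of_mat :: "real poly \<Rightarrow> complex mat \<Rightarrow> complex mat" where
  "poly_of_mat q A =
     Matrix.mat (dim_row A) (dim_row A)
       (\<lambda>rs. \<Sum>i\<le>degree q. complex_of_real (coeff q i) * (A ^\<^sub>m i) $$ rs)"

definition is_one_point_function :: "'a measure \<Rightarrow> ('a \<Rightarrow> complex mat) \<Rightarrow> (real \<Rightarrow> real) \<Rightarrow> bool" where
  "is_one_point_function P M R \<longleftrightarrow>
     continuous_on UNIV R \<and> (\<forall>x. 0 \<le> R x) \<and>
     (\<forall>q :: real poly.
        integrable lborel (\<lambda>x. poly q x * R x) \<and>
        integrable P (\<lambda>\<omega>. mat_tr (poly_of_mat q (M \<omega>))) \<and>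
        complex_of_real (LINT x|lborel. poly q x * R x)
          = (LINT \<omega>|P. mat_tr (poly_of_mat q (M \<omega>))))"

definition one_point_function :: "'a measure \<Rightarrow> ('a \<Rightarrow> complex mat) \<Rightarrow> real \<Rightarrow> real" where
  "one_point_function P M = (THE R. is_one_point_function P M R)"

definition hermite_p :: "nat \<Rightarrow> real \<Rightarrow> real" where
  "hermite_p k x =
     (-1) ^ k / sqrt (fact k) * exp (x\<^sup>2 / 2) * (deriv ^^ k) (\<lambda>y. exp (- (y\<^sup>2 / 2))) x"

definition is_smallest_positive_zero :: "(real \<Rightarrow> real) \<Rightarrow> real \<Rightarrow> bool" where
  "is_smallest_positive_zero f x \<longleftrightarrow>
     0 < x \<and> f x = 0 \<and> (\<forall>y. 0 < y \<and> f y = 0 \<longrightarrow> x \<le> y)"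

end

theory Submission
  imports Defs "HOL-Real_Asymp.Real_Asymp"
begin

text \<open>
Write \<open>n = m + 1\<close>, let \<open>He\<^sub>k\<close> be the monic Hermite polynomials of the weight
\<open>\<phi>(x) = (2 \<pi>)\<^sup>-\<^sup>1\<^sup>/\<^sup>2 e\<^sup>-\<^sup>x\<^sup>2\<^sup>/\<^sup>2\<close>, and let \<open>W = He\<^sub>n' He\<^sub>m - He\<^sub>n He\<^sub>m'\<close>. The density of
eigenvalues is \<open>R = \<phi> W / m!\<close>, the diagonal of the Christoffel-Darboux kernel. The proof has three
independent parts: the shape of \<open>R\<close>, the size of \<open>R 0\<close>, and the identification of \<open>R\<close> with the
one-point function.

\<^bold>\<open>Shape.\<close> Hermite's equation gives \<open>R' = - \<phi> He\<^sub>n He\<^sub>m / m!\<close>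
(\<open>gue_density_has_derivative\<close>), so the local maxima are zeros of \<open>He\<^sub>n\<close>. They are compared by a
Sonin function \<open>V = \<phi> (W + He\<^sub>n\<^sup>2 / (2 n)) / m!\<close>: it dominates \<open>R\<close>, agrees with it at the
zeros of \<open>He\<^sub>n\<close>, and \<open>V' = - x \<phi> He\<^sub>n\<^sup>2 / (2 n m!)\<close>, so it decreases on the right
half-line. Hence \<open>R\<close> is smaller to the right of any nonnegative zero of \<open>He\<^sub>n\<close> than at that zero. For
odd \<open>n\<close> the zero is \<open>0\<close>. For even \<open>n\<close> it is the smallest positive zero \<open>x\<^sub>n\<close>, and on \<open>[0, x\<^sub>n]\<close> the
function increases, since \<open>He\<^sub>m / He\<^sub>n\<close> starts at \<open>0\<close> and has derivative \<open>- W / He\<^sub>n\<^sup>2 < 0\<close>.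

\<^bold>\<open>Size.\<close> The logarithmic error of the asymptotic formula for \<open>R 0\<close> has the increment
\<open>(u - ln (1 + u)) / 2\<close> with \<open>u = 1 / (n (n + 2))\<close> from \<open>n\<close> to \<open>n + 2\<close>; these increments lie between
\<open>0\<close> and those of \<open>- 1 / (24 n\<^sup>3)\<close>, and Wallis' product says that the error tends to \<open>0\<close>.

\<^bold>\<open>Identification.\<close> The joint eigenvalue density is avoided. Completeness of an orthonormal basis of the
Hermitian matrices turns Gaussian integration by parts into \<open>E M\<^sub>a\<^sub>b F(M) = E \<partial>\<^sub>b\<^sub>a F(M)\<close> for
polynomials \<open>F\<close> in the entries (\<open>mat_poly_stein\<close>); this also shows that the choice of the basis does
not matter. Let \<open>p\<^sub>i = tr M\<^sup>i\<close>, and let \<open>h\<^sub>k\<close> and \<open>e\<^sub>j\<close> be the coefficients of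
\<open>1 / det (1 - t M)\<close> and \<open>det (1 - t M)\<close>, which Newton's identities express by the \<open>p\<^sub>i\<close>. The loop
equations for traces of arbitrary products do not close, but those for the means of \<open>e\<^sub>j h\<^sub>k\<close> do:
they form a linear recursion (\<open>hook_recursion_means\<close>), whose solution is explicit
(\<open>hook_recursion_hook_mean\<close>). Since \<open>p\<^sub>i = \<Sum>\<^sub>j (n - j) e\<^sub>j h\<^sub>i\<^sub>-\<^sub>j\<close>, all means \<open>E tr M\<^sup>i\<close> are
known, and they agree term by term with the moments of \<open>R\<close> (\<open>gue_density_moment\<close>). These moments grow
slowly enough to determine a continuous density (\<open>density_determined_by_moments\<close>).
\<close>

section \<open>Monic Hermite polynomials and their Wronskian\<close>

primrec monic_hermite :: "nat \<Rightarrow> real poly" where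
  "monic_hermite 0 = 1"
| "monic_hermite (Suc n) = pCons 0 (monic_hermite n) - pderiv (monic_hermite n)"

lemma pderiv_monic_hermite_Suc:
  "pderiv (monic_hermite (Suc n)) = Polynomial.smult (real (Suc n)) (monic_hermite n)"
proof (induction n)
  case 0
  show ?case by (simp add: pderiv_pCons pderiv_1)
next
  case (Suc n)
  have "pderiv (monic_hermite (Suc (Suc n)))
      = monic_hermite (Suc n) + pCons 0 (pderiv (monic_hermite (Suc n)))
        - pderiv (pderiv (monic_hermite (Suc n)))"
    by (simp only: monic_hermite.simps(2)[of "Suc n"] pderiv_diff pderiv_pCons)
  also have "\<dots> = monic_hermite (Suc n)
      + Polynomial.smult (real (Suc n)) (pCons 0 (monic_hermite n) - pderiv (monic_hermite n))"
    by (simp only: Suc pderiv_smult) (simp add: algebra_simps smult_diff_right)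
  also have "\<dots> = Polynomial.smult (real (Suc (Suc n))) (monic_hermite (Suc n))"
  proof -
    have "real (Suc (Suc n)) = 1 + real (Suc n)" by simp
    then show ?thesis by (simp only: smult_add_left smult_1_left monic_hermite.simps(2))
  qed
  finally show ?case .
qed

lemma monic_hermite_recurrence:
  "poly (monic_hermite (Suc (Suc n))) x
     = x * poly (monic_hermite (Suc n)) x - real (Suc n) * poly (monic_hermite n) x"
  using pderiv_monic_hermite_Suc[of n] by (subst monic_hermite.simps(2)) simp

lemma monic_hermite_has_derivative:
  "((\<lambda>x. poly (monic_hermite (Suc n)) x)
     has_real_derivative real (Suc n) * poly (monic_hermite n) x) (at x)"
  using poly_DERIV[of "monic_hermite (Suc n)" x] pderiv_monic_hermite_Suc[of n] by simp

lemma monic_hermite_nonzero: "monic_hermite n \<noteq> 0"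
proof (induction n)
  case (Suc n)
  show ?case
  proof
    assume "monic_hermite (Suc n) = 0"
    then have "Polynomial.smult (real (Suc n)) (monic_hermite n) = 0"
      using pderiv_monic_hermite_Suc[of n] by (metis pderiv_0)
    with Suc show False by simp
  qed
qed simp

lemma monic_hermite_parity:
  "poly (monic_hermite n) (- x) = (-1) ^ n * poly (monic_hermite n) x"
proof (induction n rule: less_induct)
  case (less n)
  consider "n = 0" | "n = 1" | m where "n = Suc (Suc m)"
    by (metis One_nat_def not0_implies_Suc)
  then show ?case
  proof cases
    case 3
    then show ?thesis
      using less[of "Suc m"] less[of m] by (simp only: monic_hermite_recurrence) (simp add: algebra_simps)
  qed (simp_all add: pderiv_1)
qed

lemma monic_hermite_Rodrigues:
  "(deriv ^^ n) (\<lambda>y. exp (- (y\<^sup>2 / 2))) x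
     = (-1) ^ n * poly (monic_hermite n) x * exp (- ((x::real)\<^sup>2 / 2))"
proof (induction n arbitrary: x)
  case (Suc n)
  have "(deriv ^^ Suc n) (\<lambda>y. exp (- (y\<^sup>2 / 2))) x
      = deriv (\<lambda>x. (-1) ^ n * poly (monic_hermite n) x * exp (- (x\<^sup>2 / 2))) x"
    by (simp add: Suc[THEN ext])
  also have "\<dots> = (-1) ^ Suc n * poly (monic_hermite (Suc n)) x * exp (- (x\<^sup>2 / 2))"
    by (rule DERIV_imp_deriv)
       (auto intro!: derivative_eq_intros poly_DERIV simp: algebra_simps)
  finally show ?case .
qed simp

lemma hermite_p_eq: "hermite_p n x = poly (monic_hermite n) x / sqrt (fact n)"
proof -
  have "exp (x\<^sup>2 / 2) * exp (- (x\<^sup>2 / 2)) = (1::real)"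
    by (simp flip: exp_add)
  then show ?thesis
    unfolding hermite_p_def monic_hermite_Rodrigues
    by (simp add: power_mult_distrib[symmetric] field_simps flip: mult.assoc)
qed

text \<open>
Since \<open>He\<^sub>n\<^sub>+\<^sub>1' = (n + 1) He\<^sub>n\<close>, this is the Wronskian \<open>He\<^sub>n\<^sub>+\<^sub>1' He\<^sub>n - He\<^sub>n\<^sub>+\<^sub>1 He\<^sub>n'\<close>. By
the confluent Christoffel-Darboux formula it is \<open>n!\<close> times the sum of the squares of the first
\<open>n + 1\<close> orthonormal Hermite polynomials; \<open>hermite_wronskian_Suc\<close> is the step of that
summation, and it is the reason why the density is positive.
\<close>
definition hermite_wronskian :: "nat \<Rightarrow> real \<Rightarrow> real" where
  "hermite_wronskian n x =
     real (Suc n) * (poly (monic_hermite n) x)\<^sup>2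
     - poly (monic_hermite (Suc n)) x * poly (pderiv (monic_hermite n)) x"

lemma hermite_wronskian_Suc:
  "hermite_wronskian (Suc n) x
     = real (Suc n) * hermite_wronskian n x + (poly (monic_hermite (Suc n)) x)\<^sup>2"
proof -
  define a b d where "a = poly (monic_hermite n) x" and "b = poly (monic_hermite (Suc n)) x"
    and "d = poly (pderiv (monic_hermite n)) x"
  have b: "b = x * a - d" by (simp add: a_def b_def d_def)
  have 2: "poly (monic_hermite (Suc (Suc n))) x = x * b - real (Suc n) * a"
    by (simp only: monic_hermite_recurrence a_def b_def)
  have 3: "poly (pderiv (monic_hermite (Suc n))) x = real (Suc n) * a"
    by (simp only: pderiv_monic_hermite_Suc a_def poly_smult)
  show ?thesis
    unfolding hermite_wronskian_def 2 3 a_def[symmetric] b_def[symmetric] d_def[symmetric] b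
    by (simp add: algebra_simps power2_eq_square)
qed

lemma hermite_wronskian_pos: "hermite_wronskian n x > 0"
proof (induction n)
  case 0
  show ?case by (simp add: hermite_wronskian_def pderiv_1)
next
  case (Suc n)
  then show ?case unfolding hermite_wronskian_Suc
    by (intro add_pos_nonneg mult_pos_pos) auto
qed

lemma hermite_wronskian_eq_derivatives:
  "hermite_wronskian n x
     = poly (pderiv (monic_hermite (Suc n))) x * poly (monic_hermite n) x
       - poly (monic_hermite (Suc n)) x * poly (pderiv (monic_hermite n)) x"
  unfolding hermite_wronskian_def pderiv_monic_hermite_Suc by (simp add: power2_eq_square)

text \<open>
In \<open>He\<^sub>n\<^sub>+\<^sub>1'' He\<^sub>n - He\<^sub>n\<^sub>+\<^sub>1 He\<^sub>n''\<close> Hermite's equation \<open>y'' = x y' - k y\<close>, with \<open>k\<close> equal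
to \<open>n + 1\<close> and \<open>n\<close>, replaces the second derivatives.
\<close>
lemma hermite_wronskian_has_derivative:
  "(hermite_wronskian n has_real_derivative
      x * hermite_wronskian n x - poly (monic_hermite n) x * poly (monic_hermite (Suc n)) x) (at x)"
proof -
  define a b d where "a = poly (monic_hermite n) x" and "b = poly (monic_hermite (Suc n)) x"
    and "d = poly (pderiv (monic_hermite n)) x"
  have b: "b = x * a - d" by (simp add: a_def b_def d_def)
  have dd: "poly (pderiv (pderiv (monic_hermite n))) x = x * d - real n * a"
  proof -
    have "pderiv (monic_hermite (Suc n)) = monic_hermite n + pCons 0 (pderiv (monic_hermite n))
        - pderiv (pderiv (monic_hermite n))"
      by (simp add: pderiv_diff pderiv_pCons)
    then have "Polynomial.smult (real (Suc n)) (monic_hermite n) = monic_hermite n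
        + pCons 0 (pderiv (monic_hermite n)) - pderiv (pderiv (monic_hermite n))"
      by (simp only: pderiv_monic_hermite_Suc)
    then have "real (Suc n) * a = a + x * d - poly (pderiv (pderiv (monic_hermite n))) x"
      by (metis (no_types, lifting) a_def add_0 d_def poly_add poly_diff poly_pCons poly_smult)
    then show ?thesis by (simp add: algebra_simps)
  qed
  have "(hermite_wronskian n has_real_derivative
     real (Suc n) * (2 * a * d) - (real (Suc n) * a * d + b * (x * d - real n * a))) (at x)"
    unfolding hermite_wronskian_def[abs_def] a_def b_def d_def dd[symmetric, unfolded a_def d_def]
    by (rule derivative_eq_intros monic_hermite_has_derivative poly_DERIV refl | simp)+
  moreover have "real (Suc n) * (2 * a * d) - (real (Suc n) * a * d + b * (x * d - real n * a))
     = x * hermite_wronskian n x - a * b"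
    unfolding hermite_wronskian_def a_def[symmetric] b_def[symmetric] d_def[symmetric]
    unfolding b by (simp add: algebra_simps power2_eq_square)
  ultimately show ?thesis by (simp add: a_def b_def)
qed

lemma hermite_wronskian_minus [simp]: "hermite_wronskian n (- x) = hermite_wronskian n x"
proof (induction n)
  case 0
  show ?case by (simp add: hermite_wronskian_def pderiv_1)
next
  case (Suc n)
  show ?case unfolding hermite_wronskian_Suc Suc
    by (subst monic_hermite_parity) (simp add: power_mult_distrib flip: power_mult)
qed

section \<open>The density of eigenvalues and its Sonin majorant\<close>

declare monic_hermite.simps(2) [simp del]

text \<open>
The density of eigenvalues for matrices of size \<open>m + 1\<close>; this shift keeps the index of the
Wronskian free of subtractions.
\<close>
definition gue_density :: "nat \<Rightarrow> real \<Rightarrow> real" where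
  "gue_density m x = std_normal_density x * hermite_wronskian m x / fact m"

lemma std_normal_density_has_derivative:
  "(std_normal_density has_real_derivative - x * std_normal_density x) (at x)"
  unfolding std_normal_density_def[abs_def]
  by (auto intro!: derivative_eq_intros simp: field_simps)

lemma gue_density_minus [simp]: "gue_density m (- x) = gue_density m x"
  by (simp add: gue_density_def std_normal_density_def)

lemma gue_density_pos: "gue_density m x > 0"
  unfolding gue_density_def by (intro divide_pos_pos mult_pos_pos hermite_wronskian_pos normal_density_pos) auto

text \<open>
The factor \<open>x\<close> from the derivative of the Gaussian cancels the one from the derivative of the
Wronskian.
\<close>
lemma gue_density_has_derivative:
  "(gue_density m has_real_derivative
     - std_normal_density x * (poly (monic_hermite m) x * poly (monic_hermite (Suc m)) x) / fact m) (at x)"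
  unfolding gue_density_def[abs_def]
  by (rule derivative_eq_intros std_normal_density_has_derivative
        hermite_wronskian_has_derivative refl | simp add: field_simps)+

lemma continuous_gue_density: "continuous_on A (gue_density m)"
  by (meson DERIV_isCont continuous_at_imp_continuous_on gue_density_has_derivative)

text \<open>
With \<open>\<psi>(x) = He\<^sub>n(x) e\<^sup>-\<^sup>x\<^sup>2\<^sup>/\<^sup>4\<close> and \<open>n = m + 1\<close>, which solves
\<open>\<psi>'' + (n + 1/2 - x\<^sup>2/4) \<psi> = 0\<close>, this is a multiple of \<open>\<psi>'\<^sup>2 + (n + 1/2 - x\<^sup>2/4) \<psi>\<^sup>2\<close>.
The derivative of that expression is \<open>- x \<psi>\<^sup>2 / 2\<close>, so the function decreases for \<open>x \<ge> 0\<close>, while it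
exceeds the density only by a multiple of \<open>\<psi>\<^sup>2\<close>.
\<close>
definition sonin_majorant :: "nat \<Rightarrow> real \<Rightarrow> real" where
  "sonin_majorant m x = std_normal_density x *
     (hermite_wronskian m x + (poly (monic_hermite (Suc m)) x)\<^sup>2 / (2 * real (Suc m))) / fact m"

lemma gue_density_le_sonin_majorant: "gue_density m x \<le> sonin_majorant m x"
  unfolding gue_density_def sonin_majorant_def
  by (intro divide_right_mono mult_left_mono) auto

lemma sonin_majorant_eq_at_zero:
  "poly (monic_hermite (Suc m)) x = 0 \<Longrightarrow> sonin_majorant m x = gue_density m x"
  unfolding gue_density_def sonin_majorant_def by simp

lemma sonin_majorant_has_derivative:
  "(sonin_majorant m has_real_derivative
     - (x * std_normal_density x * (poly (monic_hermite (Suc m)) x)\<^sup>2 / (2 * real (Suc m) * fact m))) (at x)"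
proof -
  define a b s where "a = poly (monic_hermite m) x" and "b = poly (monic_hermite (Suc m)) x"
    and "s = std_normal_density x"
  have "((\<lambda>x. std_normal_density x *
      (hermite_wronskian m x + (poly (monic_hermite (Suc m)) x)\<^sup>2 / (2 * real (Suc m))) / fact m)
     has_real_derivative
       ((- x * s) * (hermite_wronskian m x + b\<^sup>2 / (2 * real (Suc m)))
        + (x * hermite_wronskian m x - a * b + 2 * b * (real (Suc m) * a) / (2 * real (Suc m))) * s)
       / fact m) (at x)"
    unfolding a_def b_def s_def
    by (rule derivative_eq_intros std_normal_density_has_derivative monic_hermite_has_derivative
        hermite_wronskian_has_derivative refl | simp)+
  moreover have "((- x * s) * (hermite_wronskian m x + b\<^sup>2 / (2 * real (Suc m)))
        + (x * hermite_wronskian m x - a * b + 2 * b * (real (Suc m) * a) / (2 * real (Suc m))) * s)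
       / fact m = - (x * s * b\<^sup>2 / (2 * real (Suc m) * fact m))"
  proof -
    have "((- x * s) * (w + b\<^sup>2 / (2 * N)) + (x * w - a * b + 2 * b * (N * a) / (2 * N)) * s) / f
        = - (x * s * b\<^sup>2 / (2 * N * f))" if "N \<noteq> 0" "f \<noteq> 0" for N f w :: real
      using that by (simp add: field_simps)
    from this[of "real (Suc m)" "fact m" "hermite_wronskian m x"] show ?thesis by simp
  qed
  ultimately show ?thesis unfolding sonin_majorant_def[abs_def] a_def b_def s_def by (simp only:)
qed

lemma sonin_majorant_strict_antimono:
  assumes "0 \<le> x" "x < y"
  shows "sonin_majorant m y < sonin_majorant m x"
proof -
  have anti: "sonin_majorant m v \<le> sonin_majorant m u" if "0 \<le> u" "u \<le> v" for u v
    by (rule DERIV_nonpos_imp_nonincreasing[OF that(2)])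
       (use that in \<open>auto intro!: exI conjI sonin_majorant_has_derivative simp: zero_le_mult_iff\<close>)
  \<comment> \<open>The polynomial has finitely many zeros, so the derivative is strictly negative somewhere in between.\<close>
  have "finite {t. poly (monic_hermite (Suc m)) t = 0}"
    by (rule poly_roots_finite) (rule monic_hermite_nonzero)
  moreover have "infinite {x<..<y}" using assms by (simp add: infinite_Ioo)
  ultimately have "\<not> {x<..<y} \<subseteq> {t. poly (monic_hermite (Suc m)) t = 0}"
    using finite_subset by blast
  then obtain t where t: "x < t" "t < y" "poly (monic_hermite (Suc m)) t \<noteq> 0"
    by (metis (mono_tags, lifting) greaterThanLessThan_iff mem_Collect_eq subsetI)
  have "- (t * std_normal_density t * (poly (monic_hermite (Suc m)) t)\<^sup>2 / (2 * real (Suc m) * fact m)) < 0"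
    using t assms normal_density_pos[of 1 0 t] by auto
  from DERIV_neg_dec_right[OF sonin_majorant_has_derivative this]
  obtain d where d: "d > 0" "\<And>h. 0 < h \<Longrightarrow> h < d \<Longrightarrow> sonin_majorant m (t + h) < sonin_majorant m t"
    by auto
  define h where "h = min (d / 2) (y - t)"
  have h: "0 < h" "h < d" "t + h \<le> y" using d t by (auto simp: h_def)
  have "sonin_majorant m y \<le> sonin_majorant m (t + h)" using h t assms by (intro anti) auto
  also have "\<dots> < sonin_majorant m t" using d(2) h by auto
  also have "\<dots> \<le> sonin_majorant m x" using t assms by (intro anti) auto
  finally show ?thesis .
qed

section \<open>Gaussian integrals of polynomials\<close>

lemma std_normal_integrable_poly:
  "integrable lborel (\<lambda>x. std_normal_density x * poly p x)"
proof -
  have "integrable lborel (\<lambda>x. \<Sum>i\<le>degree p. coeff p i * (std_normal_density x * x ^ i))"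
    by (intro Bochner_Integration.integrable_sum integrable_mult_right integrable_std_normal_moment)
  then show ?thesis by (simp add: poly_altdef sum_distrib_left mult_ac)
qed

definition gauss_moment :: "nat \<Rightarrow> real" where
  "gauss_moment k = (LINT x|lborel. std_normal_density x * x ^ k)"

lemma gauss_moment_0 [simp]: "gauss_moment 0 = 1"
  unfolding gauss_moment_def using integral_std_normal_moment_even[of 0] by simp

lemma gauss_moment_1 [simp]: "gauss_moment (Suc 0) = 0"
  unfolding gauss_moment_def using integral_std_normal_moment_odd[of 0] by simp

text \<open>
Even moments are \<open>(2 i)! / (2\<^sup>i i!)\<close> and odd moments vanish; the recursion is the only property of
the moments that the later algebra uses.
\<close>
lemma gauss_moment_Suc_Suc: "gauss_moment (Suc (Suc k)) = real (Suc k) * gauss_moment k"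
proof (cases "even k")
  case True
  then obtain i where k: "k = 2 * i" by blast
  have "gauss_moment (2 * i) = fact (2 * i) / (2 ^ i * fact i)" for i
    unfolding gauss_moment_def by (rule integral_std_normal_moment_even)
  note even = this
  have "gauss_moment (Suc (Suc k)) = fact (2 * Suc i) / (2 ^ Suc i * fact (Suc i))"
    using even[of "Suc i"] by (simp add: k)
  also have "fact (2 * Suc i) = (2 * real (Suc i)) * (real (Suc k) * fact (2 * i))"
    by (simp add: k algebra_simps)
  also have "(2 ^ Suc i * fact (Suc i) :: real) = (2 * real (Suc i)) * (2 ^ i * fact i)"
    by (simp add: algebra_simps)
  also have "(2 * real (Suc i)) * (real (Suc k) * fact (2 * i)) / ((2 * real (Suc i)) * (2 ^ i * fact i))
      = real (Suc k) * gauss_moment k"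
    unfolding k even by (subst mult_divide_mult_cancel_left) simp_all
  finally show ?thesis .
next
  case False
  then obtain i where k: "k = 2 * i + 1" using oddE by blast
  have "gauss_moment (2 * i + 1) = 0" for i
    unfolding gauss_moment_def by (rule integral_std_normal_moment_odd)
  from this[of i] this[of "Suc i"] show ?thesis
    unfolding k by simp
qed

definition gauss_integral :: "real poly \<Rightarrow> real" where
  "gauss_integral p = (LINT x|lborel. std_normal_density x * poly p x)"

lemma gauss_integral_add: "gauss_integral (p + q) = gauss_integral p + gauss_integral q"
  unfolding gauss_integral_def
  by (simp add: distrib_left std_normal_integrable_poly Bochner_Integration.integral_add)

lemma gauss_integral_diff: "gauss_integral (p - q) = gauss_integral p - gauss_integral q"
  unfolding gauss_integral_def
  by (simp add: right_diff_distrib std_normal_integrable_poly Bochner_Integration.integral_diff)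

lemma gauss_integral_smult: "gauss_integral (Polynomial.smult c p) = c * gauss_integral p"
  unfolding gauss_integral_def by (simp add: mult.left_commute)

lemma gauss_integral_0 [simp]: "gauss_integral 0 = 0"
  by (simp add: gauss_integral_def)

lemma gauss_integral_sum: "gauss_integral (\<Sum>i\<in>A. f i) = (\<Sum>i\<in>A. gauss_integral (f i))"
  by (induction A rule: infinite_finite_induct) (simp_all add: gauss_integral_add)

lemma gauss_integral_monom: "gauss_integral (Polynomial.monom c k) = c * gauss_moment k"
  unfolding gauss_integral_def gauss_moment_def by (simp add: poly_monom mult.left_commute)

text \<open>
Both sides are linear in the polynomial, and on monomials the identity is the recursion of the moments.
\<close>
lemma gauss_integral_by_parts: "gauss_integral (pCons 0 p) = gauss_integral (pderiv p)"
proof -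
  have mono: "gauss_integral (pCons 0 (Polynomial.monom c k)) = gauss_integral (pderiv (Polynomial.monom c k))"
    for c k
  proof (cases k)
    case 0
    then show ?thesis
      by (simp add: gauss_integral_monom pderiv_monom flip: monom_Suc)
  next
    case (Suc i)
    then show ?thesis
      by (simp add: gauss_integral_monom pderiv_monom gauss_moment_Suc_Suc flip: monom_Suc)
  qed
  have "gauss_integral (pCons 0 (\<Sum>i\<in>A. Polynomial.monom (coeff p i) i))
      = gauss_integral (pderiv (\<Sum>i\<in>A. Polynomial.monom (coeff p i) i))" if "finite A" for A
    using that
  proof (induction A rule: finite_induct)
    case (insert i A)
    have "pCons 0 (a + b) = pCons 0 a + pCons 0 b" for a b :: "real poly" by simp
    with insert show ?case by (simp only: sum.insert[OF insert(1,2)] pderiv_add gauss_integral_add mono)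
  qed simp
  from this[of "{..degree p}"] show ?thesis by (simp only: finite_atMost poly_as_sum_of_monoms)
qed

lemma gauss_integral_hermite: "gauss_integral (monic_hermite (Suc n)) = 0"
  by (simp add: monic_hermite.simps(2) gauss_integral_diff gauss_integral_by_parts)

section \<open>Location of the maximum\<close>

text \<open>
Zero is a root of the odd polynomial \<open>He\<^sub>m\<^sub>+\<^sub>1\<close>, so that the majorant touches the density there,
and it decreases from there on.
\<close>
lemma gue_density_le_at_0:
  assumes "even m"
  shows "gue_density m x \<le> gue_density m 0"
proof -
  have zero: "poly (monic_hermite (Suc m)) 0 = 0"
    using monic_hermite_parity[of "Suc m" 0] assms by simp
  have "gue_density m x = gue_density m \<bar>x\<bar>" by (simp add: abs_if)
  also have "\<dots> \<le> sonin_majorant m \<bar>x\<bar>" by (rule gue_density_le_sonin_majorant)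
  also have "\<dots> \<le> sonin_majorant m 0"
    using sonin_majorant_strict_antimono[of 0 "\<bar>x\<bar>" m] by (cases "x = 0") auto
  also have "\<dots> = gue_density m 0" by (rule sonin_majorant_eq_at_zero) (rule zero)
  finally show ?thesis .
qed

lemma hermite_0_even_index:
  assumes "odd m"
  shows "poly (monic_hermite m) 0 = 0" "poly (monic_hermite (Suc m)) 0 \<noteq> 0"
proof -
  show 0: "poly (monic_hermite m) 0 = 0"
    using monic_hermite_parity[of m 0] assms by simp
  show "poly (monic_hermite (Suc m)) 0 \<noteq> 0"
    using hermite_wronskian_pos[of m 0] 0 unfolding hermite_wronskian_def by auto
qed

text \<open>
The quotient \<open>He\<^sub>m / He\<^sub>m\<^sub>+\<^sub>1\<close> vanishes at \<open>0\<close> and decreases as long as the denominator has no zero,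
because its derivative is minus the Wronskian over \<open>He\<^sub>m\<^sub>+\<^sub>1\<^sup>2\<close>. This replaces the interlacing of
zeros.
\<close>
lemma hermite_quotient_neg:
  assumes "odd m" "0 < x" and nz: "\<And>t. 0 \<le> t \<Longrightarrow> t \<le> x \<Longrightarrow> poly (monic_hermite (Suc m)) t \<noteq> 0"
  shows "poly (monic_hermite m) x * poly (monic_hermite (Suc m)) x < 0"
proof -
  define g where "g t = poly (monic_hermite m) t / poly (monic_hermite (Suc m)) t" for t
  have "g x < g 0"
  proof (rule DERIV_neg_imp_decreasing[OF \<open>0 < x\<close>])
    fix t assume t: "0 \<le> t" "t \<le> x"
    have "(g has_real_derivative
        (poly (pderiv (monic_hermite m)) t * poly (monic_hermite (Suc m)) t
          - poly (monic_hermite m) t * poly (pderiv (monic_hermite (Suc m))) t)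
        / (poly (monic_hermite (Suc m)) t * poly (monic_hermite (Suc m)) t)) (at t)"
      unfolding g_def[abs_def] by (rule DERIV_divide poly_DERIV nz[OF t])+
    moreover have "(poly (pderiv (monic_hermite m)) t * poly (monic_hermite (Suc m)) t
          - poly (monic_hermite m) t * poly (pderiv (monic_hermite (Suc m))) t)
        / (poly (monic_hermite (Suc m)) t * poly (monic_hermite (Suc m)) t)
        = - hermite_wronskian m t / (poly (monic_hermite (Suc m)) t)\<^sup>2"
      unfolding hermite_wronskian_eq_derivatives by (simp add: power2_eq_square mult_ac)
    moreover have "- hermite_wronskian m t / (poly (monic_hermite (Suc m)) t)\<^sup>2 < 0"
      using hermite_wronskian_pos[of m t] nz[OF t] by (intro divide_neg_pos) simp_all
    ultimately show "\<exists>y. (g has_real_derivative y) (at t) \<and> y < 0" by metis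
  qed
  moreover have "g 0 = 0" by (simp add: g_def hermite_0_even_index[OF \<open>odd m\<close>])
  ultimately have "g x < 0" by simp
  moreover have "poly (monic_hermite (Suc m)) x \<noteq> 0" using nz[of x] \<open>0 < x\<close> by simp
  ultimately show ?thesis unfolding g_def by (simp add: divide_less_0_iff mult_less_0_iff)
qed

text \<open>
Without a positive zero the even polynomial \<open>He\<^sub>m\<^sub>+\<^sub>1\<close> would have constant sign, although it is
orthogonal to the constants.
\<close>
lemma hermite_has_positive_zero:
  assumes "odd m"
  shows "\<exists>t>0. poly (monic_hermite (Suc m)) t = 0"
proof (rule ccontr)
  let ?h = "poly (monic_hermite (Suc m))"
  assume "\<not> ?thesis"
  then have pos: "?h t \<noteq> 0" if "t > 0" for t using that by blast
  have nz: "?h t \<noteq> 0" for t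
  proof -
    consider "t > 0" | "t = 0" | "- t > 0" by linarith
    then show ?thesis
    proof cases
      case 3
      from pos[OF this] show ?thesis
        using monic_hermite_parity[of "Suc m" t] by auto
    qed (use pos hermite_0_even_index[OF assms] in simp_all)
  qed
  have sign: "?h 0 * ?h t > 0" for t
  proof (rule ccontr)
    assume "\<not> ?h 0 * ?h t > 0"
    then have neg: "?h 0 * ?h t < 0" using nz by (metis linorder_neqE mult_eq_0_iff)
    then have "t \<noteq> 0" by (metis not_square_less_zero)
    then consider "0 < t" | "t < 0" by linarith
    then show False
      by cases (use poly_IVT[of 0 t "monic_hermite (Suc m)"] poly_IVT[of t 0 "monic_hermite (Suc m)"]
                  neg nz in \<open>auto simp: mult.commute\<close>)
  qed
  define f where "f t = std_normal_density t * poly (Polynomial.smult (?h 0) (monic_hermite (Suc m))) t" for t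
  have f_pos: "f t > 0" for t
    unfolding f_def using sign by (intro mult_pos_pos normal_density_pos) simp_all
  have "integral\<^sup>L lborel f = gauss_integral (Polynomial.smult (?h 0) (monic_hermite (Suc m)))"
    by (simp only: gauss_integral_def f_def[abs_def])
  also have "\<dots> = 0" by (simp only: gauss_integral_smult gauss_integral_hermite mult_zero_right)
  finally have "AE t in lborel. f t = 0"
    using std_normal_integrable_poly[of "Polynomial.smult (?h 0) (monic_hermite (Suc m))"] f_pos
    by (subst (asm) integral_nonneg_eq_0_iff_AE) (auto simp: less_imp_le f_def[abs_def])
  then have "AE t in lborel :: real measure. False"
    using f_pos by (auto simp: less_le)
  then have "emeasure lborel (UNIV :: real set) = 0"
    by (subst (asm) AE_iff_measurable[of UNIV]) auto
  then show False by simp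
qed

lemma hermite_smallest_positive_zero:
  assumes "odd m"
  shows "\<exists>z. is_smallest_positive_zero (poly (monic_hermite (Suc m))) z"
proof -
  let ?Z = "{t. 0 < t \<and> poly (monic_hermite (Suc m)) t = 0}"
  have fin: "finite ?Z"
    by (rule finite_subset[OF _ poly_roots_finite[OF monic_hermite_nonzero[of "Suc m"]]]) auto
  moreover have "?Z \<noteq> {}" using hermite_has_positive_zero[OF assms] by blast
  ultimately have "Min ?Z \<in> ?Z" by (rule Min_in)
  then have "is_smallest_positive_zero (poly (monic_hermite (Suc m))) (Min ?Z)"
    unfolding is_smallest_positive_zero_def using Min_le[OF fin] by blast
  then show ?thesis ..
qed

text \<open>
Below \<open>z\<close> the density increases by the sign of \<open>He\<^sub>m He\<^sub>m\<^sub>+\<^sub>1\<close>; above \<open>z\<close> it stays below the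
majorant, which is already smaller than its value at the zero \<open>z\<close>.
\<close>
lemma gue_density_less_at_smallest_zero:
  assumes "odd m" and z: "is_smallest_positive_zero (poly (monic_hermite (Suc m))) z"
    and x: "x \<noteq> z" "x \<noteq> - z"
  shows "gue_density m x < gue_density m z"
proof -
  let ?h = "poly (monic_hermite (Suc m))"
  from z have z0: "0 < z" "?h z = 0" and z_min: "\<And>t. 0 < t \<Longrightarrow> ?h t = 0 \<Longrightarrow> z \<le> t"
    unfolding is_smallest_positive_zero_def by blast+
  have "gue_density m \<bar>x\<bar> < gue_density m z"
  proof (cases "\<bar>x\<bar> < z")
    case True
    show ?thesis
    proof (rule DERIV_pos_imp_increasing_open[OF True])
      fix t assume t: "\<bar>x\<bar> < t" "t < z"
      have "poly (monic_hermite m) t * ?h t < 0"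
      proof (rule hermite_quotient_neg[OF \<open>odd m\<close>])
        show "0 < t" using t by linarith
        fix s assume s: "0 \<le> s" "s \<le> t"
        show "?h s \<noteq> 0"
          using z_min[of s] s t hermite_0_even_index(2)[OF \<open>odd m\<close>] by (cases "s = 0") auto
      qed
      then have "- std_normal_density t * (poly (monic_hermite m) t * ?h t) / fact m > 0"
        using normal_density_pos[of 1 0 t]
        by (intro divide_pos_pos mult_neg_neg) simp_all
      then show "\<exists>y. (gue_density m has_real_derivative y) (at t) \<and> 0 < y"
        using gue_density_has_derivative by blast
    qed (rule continuous_gue_density)
  next
    case False
    with x have "z < \<bar>x\<bar>" by (auto simp: abs_if split: if_splits)
    have "gue_density m \<bar>x\<bar> \<le> sonin_majorant m \<bar>x\<bar>" by (rule gue_density_le_sonin_majorant)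
    also have "\<dots> < sonin_majorant m z"
      using z0 \<open>z < \<bar>x\<bar>\<close> by (intro sonin_majorant_strict_antimono) auto
    also have "\<dots> = gue_density m z" using z0 by (intro sonin_majorant_eq_at_zero)
    finally show ?thesis .
  qed
  then show ?thesis by (simp add: abs_if split: if_splits)
qed

section \<open>Size of the central value\<close>

definition central_density :: "nat \<Rightarrow> real" where
  "central_density k = 1 / sqrt (2 * pi) * (fact (2 * k + 1) / (2 ^ (2 * k) * (fact k)\<^sup>2))"

lemma central_density_pos: "central_density k > 0"
  unfolding central_density_def by (intro mult_pos_pos divide_pos_pos) auto

lemma central_density_Suc:
  "central_density (Suc k) = central_density k * (real (2 * k + 3) / real (2 * k + 2))"
proof -
  have "fact (2 * Suc k + 1) = (real (2 * k + 3) * real (2 * k + 2) * fact (2 * k + 1) :: real)"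
    by (simp add: algebra_simps)
  moreover have "2 ^ (2 * Suc k) * (fact (Suc k))\<^sup>2 = (real (2 * k + 2))\<^sup>2 * (2 ^ (2 * k) * (fact k)\<^sup>2 :: real)"
    by (simp add: power2_eq_square algebra_simps)
  moreover have "c * (a * b * F / (b\<^sup>2 * D)) = c * (F / D) * (a / b)" if "b \<noteq> 0" for a b c D F :: real
    using that by (simp add: power2_eq_square mult_ac)
  ultimately show ?thesis unfolding central_density_def by (simp only: of_nat_eq_0_iff)
qed

text \<open>
The \<open>n\<close>-th Wallis product is \<open>(2 n + 1) / (2 \<pi> c\<^sub>n\<^sup>2)\<close>, where \<open>c\<^sub>n\<close> is the central density.
\<close>
lemma central_density_asymp:
  "(\<lambda>k. pi * central_density k / sqrt (real (2 * k + 1))) \<longlonglongrightarrow> 1"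
proof -
  let ?w = "\<lambda>n. \<Prod>k=1..n. (4 * real k ^ 2) / (4 * real k ^ 2 - 1)"
  have w: "?w n = real (2 * n + 1) / (2 * pi * (central_density n)\<^sup>2)" for n
  proof (induction n)
    case 0
    show ?case by (simp add: central_density_def power_divide)
  next
    case (Suc n)
    have "?w (Suc n) = ?w n * ((4 * real (Suc n) ^ 2) / (4 * real (Suc n) ^ 2 - 1))"
      by simp
    also have "4 * real (Suc n) ^ 2 = (real (2 * n + 2))\<^sup>2"
      by (simp add: power2_eq_square algebra_simps)
    also have "(real (2 * n + 2))\<^sup>2 - 1 = real (2 * n + 1) * real (2 * n + 3)"
      by (simp add: power2_eq_square algebra_simps)
    also have "?w n * ((real (2 * n + 2))\<^sup>2 / (real (2 * n + 1) * real (2 * n + 3)))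
        = real (2 * n + 3) / (2 * pi * (central_density n * (real (2 * n + 3) / real (2 * n + 2)))\<^sup>2)"
      unfolding Suc using central_density_pos[of n]
      by (simp add: divide_simps power2_eq_square)
    finally show ?case by (simp only: central_density_Suc) (simp add: algebra_simps)
  qed
  have "(\<lambda>n. sqrt ((pi / 2) / ?w n)) \<longlonglongrightarrow> sqrt ((pi / 2) / (pi / 2))"
    by (intro tendsto_intros wallis) auto
  moreover have "sqrt ((pi / 2) / ?w n) = pi * central_density n / sqrt (real (2 * n + 1))" for n
  proof (rule real_sqrt_unique)
    show "(pi * central_density n / sqrt (real (2 * n + 1)))\<^sup>2 = pi / 2 / ?w n"
      unfolding w using central_density_pos[of n]
      by (simp add: power_divide power_mult_distrib divide_simps power2_eq_square)
  qed (use central_density_pos[of n] in auto)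
  ultimately show ?thesis by simp
qed

text \<open>
The exponent that remains after \<open>1 / (4 n)\<close> for \<open>n = 2 k + 1\<close>.
\<close>
definition stirling_error :: "nat \<Rightarrow> real" where
  "stirling_error k = ln (pi * central_density k / sqrt (real (2 * k + 1))) - 1 / (4 * real (2 * k + 1))"

lemma central_density_eq_exp:
  "central_density k = 1 / pi * sqrt (real (2 * k + 1)) * exp (1 / (4 * real (2 * k + 1)) + stirling_error k)"
proof -
  have "pi * central_density k / sqrt (real (2 * k + 1)) > 0"
    using central_density_pos[of k] by simp
  then have "exp (1 / (4 * real (2 * k + 1)) + stirling_error k)
      = pi * central_density k / sqrt (real (2 * k + 1))"
    unfolding stirling_error_def by simp
  then show ?thesis by simp
qed

text \<open>
Here \<open>1 + u = (n + 1)\<^sup>2 / (n (n + 2))\<close> collects the logarithms, and \<open>1 / (4 n) - 1 / (4 (n + 2)) = u / 2\<close>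
supplies the linear term.
\<close>
lemma stirling_error_Suc:
  fixes k defines "n \<equiv> real (2 * k + 1)" defines "u \<equiv> 1 / (n * (n + 2))"
  shows "stirling_error (Suc k) - stirling_error k = (u - ln (1 + u)) / 2"
proof -
  have n: "n > 0" by (simp add: n_def)
  have c: "central_density k > 0" by (rule central_density_pos)
  have n2: "real (2 * Suc k + 1) = n + 2" "real (2 * k + 3) = n + 2" "real (2 * k + 2) = n + 1" "real (2 * k + 1) = n" by (simp_all add: n_def)
  have 1: "ln (pi * central_density k / sqrt n) = ln pi + ln (central_density k) - ln n / 2"
    using n c by (simp add: ln_div ln_mult ln_sqrt)
  have 2: "ln (pi * central_density (Suc k) / sqrt (n + 2))
      = ln pi + ln (central_density k) + ln (n + 2) - ln (n + 1) - ln (n + 2) / 2"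
    unfolding central_density_Suc n2 using n c by (simp add: ln_div ln_mult ln_sqrt)
  have "1 + u = (n + 1)\<^sup>2 / (n * (n + 2))"
  proof -
    have "n * (n + 2) \<noteq> 0" using n by simp
    then have "1 + u = (n * (n + 2) + 1) / (n * (n + 2))"
      unfolding u_def by (simp only: add_divide_distrib divide_self) simp
    then show ?thesis by (simp add: power2_eq_square algebra_simps)
  qed
  then have 3: "ln (1 + u) = 2 * ln (n + 1) - ln n - ln (n + 2)"
    using n by (simp add: ln_div ln_mult ln_realpow)
  have 4: "1 / (4 * n) - 1 / (4 * (n + 2)) = u / 2"
  proof -
    have "1 / (4 * n) - 1 / (4 * m) = 1 / (n * m) / 2" if "m = n + 2" "m > 0" for m
      using n that by (simp add: divide_simps)
    from this[of "n + 2"] show ?thesis using n by (simp add: u_def)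
  qed
  show ?thesis
    unfolding stirling_error_def n2 1 2 using 3 4 by (simp add: field_simps)
qed

lemma ln_add_one_quadratic_lower: "u - u\<^sup>2 / 2 \<le> ln (1 + u)" if "0 \<le> u" for u :: real
proof -
  let ?f = "\<lambda>u::real. ln (1 + u) - u + u\<^sup>2 / 2"
  have "?f 0 \<le> ?f u"
  proof (rule DERIV_nonneg_imp_nondecreasing[OF that])
    fix x :: real assume x: "0 \<le> x"
    have "(?f has_real_derivative (1 / (1 + x) - 1 + x)) (at x)"
      using x by (auto intro!: derivative_eq_intros)
    moreover have "1 / (1 + x) - 1 + x = x\<^sup>2 / (1 + x)"
      using x by (simp add: field_simps power2_eq_square)
    ultimately show "\<exists>y. (?f has_real_derivative y) (at x) \<and> 0 \<le> y"
      using x by (metis (no_types, lifting) add_nonneg_nonneg divide_nonneg_nonneg zero_le_one zero_le_power2)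
  qed
  then show ?thesis by simp
qed

lemma stirling_error_tendsto_0: "stirling_error \<longlonglongrightarrow> 0"
proof -
  have "(\<lambda>k. ln (pi * central_density k / sqrt (real (2 * k + 1))) - 1 / (4 * real (2 * k + 1)))
      \<longlonglongrightarrow> ln 1 - 0"
  proof (intro tendsto_diff tendsto_ln central_density_asymp)
    show "(\<lambda>k. 1 / (4 * real (2 * k + 1))) \<longlonglongrightarrow> 0"
      by real_asymp
  qed simp
  then show ?thesis by (simp add: stirling_error_def[abs_def])
qed

text \<open>
An increasing sequence with limit \<open>0\<close> is nonpositive, and a decreasing one is nonnegative. The
constant \<open>24\<close> is sharp for this argument: the increments are at most \<open>u\<^sup>2 / 4\<close>, which behaves like
\<open>1 / (4 n\<^sup>4)\<close>, while \<open>1 / (c n\<^sup>3) - 1 / (c (n + 2)\<^sup>3)\<close> behaves like \<open>6 / (c n\<^sup>4)\<close>.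
\<close>
lemma stirling_error_bounds:
  "- (1 / (24 * real (2 * k + 1) ^ 3)) \<le> stirling_error k" "stirling_error k \<le> 0"
proof -
  have step: "0 \<le> stirling_error (Suc k) - stirling_error k \<and>
     stirling_error (Suc k) - stirling_error k
       \<le> 1 / (24 * real (2 * k + 1) ^ 3) - 1 / (24 * real (2 * Suc k + 1) ^ 3)" for k
  proof -
    define n where "n = real (2 * k + 1)"
    define u where "u = 1 / (n * (n + 2))"
    have n: "n > 0" by (simp add: n_def)
    then have u: "u \<ge> 0" by (simp add: u_def)
    have eq: "stirling_error (Suc k) - stirling_error k = (u - ln (1 + u)) / 2"
      unfolding u_def n_def by (rule stirling_error_Suc)
    have "u\<^sup>2 / 4 \<le> 1 / (24 * n ^ 3) - 1 / (24 * (n + 2) ^ 3)"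
    proof -
      have "1 / (24 * n ^ 3) - 1 / (24 * (n + 2) ^ 3) - u\<^sup>2 / 4 = 1 / (3 * (n ^ 3 * (n + 2) ^ 3))"
        unfolding u_def using n by (simp add: divide_simps) (simp add: algebra_simps power2_eq_square power3_eq_cube)
      also have "\<dots> \<ge> 0" using n by simp
      finally show ?thesis by simp
    qed
    moreover have n2: "real (2 * Suc k + 1) = n + 2" by (simp add: n_def)
    moreover have "0 \<le> (u - ln (1 + u)) / 2" "(u - ln (1 + u)) / 2 \<le> u\<^sup>2 / 4"
      using ln_add_one_quadratic_lower[OF u] ln_add_one_self_le_self[OF u] by auto
    ultimately show ?thesis
      unfolding eq n2 n_def[symmetric] by (meson order_trans)
  qed
  have "incseq stirling_error" by (rule incseq_SucI) (use step in \<open>simp add: le_diff_eq\<close>)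
  from incseq_le[OF this stirling_error_tendsto_0] show "stirling_error k \<le> 0" .
  let ?d = "\<lambda>k. stirling_error k + 1 / (24 * real (2 * k + 1) ^ 3)"
  have "decseq ?d" by (rule decseq_SucI) (use step in \<open>simp add: algebra_simps\<close>)
  moreover have "?d \<longlonglongrightarrow> 0 + 0"
  proof (intro tendsto_add stirling_error_tendsto_0)
    show "(\<lambda>k. 1 / (24 * real (2 * k + 1) ^ 3)) \<longlonglongrightarrow> 0"
      by real_asymp
  qed
  ultimately have "0 + 0 \<le> ?d k" by (rule decseq_ge)
  then show "- (1 / (24 * real (2 * k + 1) ^ 3)) \<le> stirling_error k" by simp
qed

lemma stirling_error_bigo:
  "(\<lambda>n. stirling_error (n div 2)) \<in> O[inf sequentially (principal {n. odd n})](\<lambda>n. 1 / real n ^ 3)"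
proof (rule bigoI)
  show "\<forall>\<^sub>F n in inf sequentially (principal {n. odd n}).
      norm (stirling_error (n div 2)) \<le> 1 / 24 * norm (1 / real n ^ 3)"
    unfolding eventually_inf_principal
  proof (intro always_eventually allI impI)
    fix n :: nat assume "n \<in> {n. odd n}"
    then have "n = 2 * (n div 2) + 1" by simp
    then have "real (2 * (n div 2) + 1) = real n" by metis
    with stirling_error_bounds[of "n div 2"]
    show "norm (stirling_error (n div 2)) \<le> 1 / 24 * norm (1 / real n ^ 3)"
      by (simp add: abs_if)
  qed
qed

section \<open>Newton's identities for a sequence of power sums\<close>

text \<open>
The coefficients of \<open>exp (s \<Sum>\<^sub>i\<^sub>\<ge>\<^sub>1 p\<^sub>i t\<^sup>i / i)\<close>. If the \<open>p\<^sub>i\<close> are the power sums of the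
eigenvalues of a matrix \<open>A\<close>, these are the coefficients of \<open>1 / det (1 - t A)\<close> for \<open>s = 1\<close> (complete
homogeneous polynomials) and of \<open>det (1 - t A)\<close> for \<open>s = -1\<close> (elementary polynomials with alternating
signs). Working with the recursion alone avoids determinants and eigenvalues.
\<close>
fun newton_seq :: "complex \<Rightarrow> (nat \<Rightarrow> complex) \<Rightarrow> nat \<Rightarrow> complex" where
  "newton_seq s p k =
     (if k = 0 then 1 else s * (\<Sum>i<k. p (Suc i) * newton_seq s p (k - 1 - i)) / of_nat k)"

declare newton_seq.simps [simp del]

lemma newton_seq_0 [simp]: "newton_seq s p 0 = 1"
  by (subst newton_seq.simps) simp

lemma newton_seq_Suc:
  "of_nat (Suc k) * newton_seq s p (Suc k) = s * (\<Sum>i<Suc k. p (Suc i) * newton_seq s p (k - i))"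
  by (subst newton_seq.simps) (simp del: of_nat_Suc)

lemma newton_seq_mult:
  "of_nat k * newton_seq s p k = s * (\<Sum>i<k. p (Suc i) * newton_seq s p (k - 1 - i))"
proof (cases k)
  case (Suc k')
  then show ?thesis using newton_seq_Suc[of k' s p] by simp
qed simp

text \<open>
Newton's identity in a form that includes the term \<open>q = 0\<close>; in the application \<open>p 0\<close> is the size of
the matrix, and this is how the size enters all later formulas.
\<close>
lemma newton_seq_convolution:
  assumes "s * s = 1"
  shows "(\<Sum>q<Suc m. p q * newton_seq s p (m - q)) = (p 0 + s * of_nat m) * newton_seq s p m"
proof -
  have "(\<Sum>q<Suc m. p q * newton_seq s p (m - q))
      = p 0 * newton_seq s p m + (\<Sum>q<m. p (Suc q) * newton_seq s p (m - 1 - q))"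
    by (simp add: sum.lessThan_Suc_shift del: sum.lessThan_Suc)
  also have "(\<Sum>q<m. p (Suc q) * newton_seq s p (m - 1 - q)) = s * (of_nat m * newton_seq s p m)"
    unfolding newton_seq_mult by (simp add: assms flip: mult.assoc)
  finally show ?thesis by (simp add: algebra_simps)
qed

lemma sum_triangle_antidiagonal:
  fixes m :: nat
  shows "(\<Sum>i<m. \<Sum>r<m - i. g (i + r)) = (\<Sum>q<m. of_nat (Suc q) * (g q :: complex))"
proof (induction m)
  case (Suc m)
  have "(\<Sum>i<Suc m. \<Sum>r<Suc m - i. g (i + r)) = (\<Sum>i<Suc m. (\<Sum>r<m - i. g (i + r)) + g m)"
    by (rule sum.cong) (auto simp: Suc_diff_le)
  also have "\<dots> = (\<Sum>i<m. \<Sum>r<m - i. g (i + r)) + of_nat (Suc m) * g m"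
    by (simp add: sum.distrib algebra_simps)
  finally show ?case by (simp add: Suc)
qed simp

lemma sum_triangle_reindex:
  "(\<Sum>i<Suc m. \<Sum>a<i. g a (i - 1 - a)) = (\<Sum>a<m. \<Sum>b<m - a. (g a b :: complex))"
proof (induction m)
  case (Suc m)
  have "(\<Sum>a<Suc m. \<Sum>b<Suc m - a. g a b) = (\<Sum>a<Suc m. (\<Sum>b<m - a. g a b) + g a (m - a))"
    by (rule sum.cong) (auto simp: Suc_diff_le)
  also have "\<dots> = (\<Sum>a<m. \<Sum>b<m - a. g a b) + (\<Sum>a<Suc m. g a (m - a))"
    by (simp add: sum.distrib algebra_simps)
  finally show ?case by (simp add: Suc[symmetric])
qed simp

lemma sum_triangle_swap:
  fixes m :: nat
  shows "(\<Sum>i<m. \<Sum>r<m - i. f i r) = (\<Sum>r<m. \<Sum>i<m - r. (f i r :: complex))"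
proof -
  have "(\<Sum>i<m. \<Sum>r<m - i. f i r) = (\<Sum>i<m. \<Sum>r | r \<in> {..<m} \<and> i + r < m. f i r)"
    by (intro sum.cong) auto
  also have "\<dots> = (\<Sum>r<m. \<Sum>i | i \<in> {..<m} \<and> i + r < m. f i r)"
    by (rule sum.swap_restrict) auto
  also have "\<dots> = (\<Sum>r<m. \<Sum>i<m - r. f i r)"
    by (intro sum.cong) auto
  finally show ?thesis .
qed

text \<open>
Any derivation that sends \<open>p\<^sub>i\<close> to \<open>i q\<^sub>i\<^sub>-\<^sub>1\<close> sends the \<open>k\<close>-th term to
\<open>s \<Sum>\<^sub>r q\<^sub>r newton_seq s p (k - 1 - r)\<close>: differentiating the recursion of \<open>newton_seq\<close> gives the left
side, where the inner sums are values inserted by induction.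
\<close>
lemma newton_seq_derivation:
  "(\<Sum>i<Suc m. of_nat (Suc i) * q i * newton_seq s p (m - i)
       + p (Suc i) * (s * (\<Sum>r<m - i. q r * newton_seq s p (m - i - 1 - r))))
     = of_nat (Suc m) * (\<Sum>r<Suc m. q r * newton_seq s p (m - r))"
proof -
  let ?N = "newton_seq s p"
  have "(\<Sum>i<Suc m. p (Suc i) * (s * (\<Sum>r<m - i. q r * ?N (m - i - 1 - r))))
      = (\<Sum>i<m. \<Sum>r<m - i. q r * (s * (p (Suc i) * ?N (m - r - 1 - i))))"
    by (simp add: sum_distrib_left mult_ac)
       (intro sum.cong refl, simp add: add.commute)
  also have "\<dots> = (\<Sum>r<m. q r * (of_nat (m - r) * ?N (m - r)))"
    by (subst sum_triangle_swap) (simp only: newton_seq_mult sum_distrib_left)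
  also have "\<dots> = (\<Sum>r<Suc m. of_nat (m - r) * q r * ?N (m - r))"
    by (simp add: mult_ac)
  finally have "(\<Sum>i<Suc m. p (Suc i) * (s * (\<Sum>r<m - i. q r * ?N (m - i - 1 - r)))) = \<dots>" .
  moreover have "(\<Sum>i<Suc m. of_nat (Suc i) * q i * ?N (m - i)) + (\<Sum>r<Suc m. of_nat (m - r) * q r * ?N (m - r))
      = of_nat (Suc m) * (\<Sum>r<Suc m. q r * ?N (m - r))"
    unfolding sum.distrib[symmetric] sum_distrib_left
    by (intro sum.cong refl) (auto simp: of_nat_diff algebra_simps)
  ultimately show ?thesis by (simp only: sum.distrib)
qed

text \<open>
Quadratic expressions in the traces, which spoil loop equations in general, collapse here to a multiple
of a single term. (For \<open>f(w) = 1 / det (w - A)\<close> this is the formula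
\<open>f'' = ((tr (w - A)\<^sup>-\<^sup>1)\<^sup>2 + tr (w - A)\<^sup>-\<^sup>2) f\<close>.) The products
\<open>p\<^sub>a p\<^sub>b\<close> are summed over \<open>b\<close> by the convolution identity; the weight \<open>a + 1\<close> with which single
traces \<open>p\<^sub>a\<close> occur makes the resulting factor independent of \<open>a\<close>, and the sum over \<open>a\<close> is again a
convolution.
\<close>
lemma newton_seq_quadratic:
  assumes "s * s = 1"
  shows "(\<Sum>i<Suc (Suc m). (\<Sum>a<i. p a * p (i - 1 - a)) * newton_seq s p (Suc m - i)
            + s * (\<Sum>r<Suc m - i. p (i + r) * newton_seq s p (m - (i + r))))
       = (p 0 + s * of_nat (Suc m)) * (p 0 + s * of_nat m) * newton_seq s p m"
proof -
  let ?N = "newton_seq s p"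
  have "(\<Sum>i<Suc (Suc m). (\<Sum>a<i. p a * p (i - 1 - a)) * ?N (Suc m - i))
      = (\<Sum>i<Suc (Suc m). \<Sum>a<i. p a * p (i - 1 - a) * ?N (m - a - (i - 1 - a)))"
    unfolding sum_distrib_right by (intro sum.cong refl) (auto intro!: arg_cong[of _ _ ?N])
  also have "\<dots> = (\<Sum>a<Suc m. \<Sum>b<Suc m - a. p a * p b * ?N (m - a - b))"
    by (rule sum_triangle_reindex)
  also have "\<dots> = (\<Sum>a<Suc m. p a * (\<Sum>b<Suc (m - a). p b * ?N (m - a - b)))"
    unfolding sum_distrib_left by (intro sum.cong) (auto simp: Suc_diff_le mult.assoc)
  also have "\<dots> = (\<Sum>a<Suc m. (p 0 + s * of_nat (m - a)) * (p a * ?N (m - a)))"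
    by (simp only: newton_seq_convolution[OF assms] mult.left_commute)
  finally have 1: "(\<Sum>i<Suc (Suc m). (\<Sum>a<i. p a * p (i - 1 - a)) * ?N (Suc m - i)) = \<dots>" .
  have "(\<Sum>i<Suc (Suc m). s * (\<Sum>r<Suc m - i. p (i + r) * ?N (m - (i + r))))
      = s * (\<Sum>i<Suc m. \<Sum>r<Suc m - i. p (i + r) * ?N (m - (i + r)))"
    by (subst sum.lessThan_Suc) (simp only: sum_distrib_left[symmetric] diff_self_eq_0 lessThan_0 sum.empty mult_zero_right add_0_right)
  also have "\<dots> = (\<Sum>q<Suc m. s * of_nat (Suc q) * (p q * ?N (m - q)))"
    unfolding sum_triangle_antidiagonal[of "\<lambda>q. p q * ?N (m - q)"] sum_distrib_left
    by (simp only: mult.assoc)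
  finally have 2: "(\<Sum>i<Suc (Suc m). s * (\<Sum>r<Suc m - i. p (i + r) * ?N (m - (i + r)))) = \<dots>" .
  have "(\<Sum>a<Suc m. (p 0 + s * of_nat (m - a)) * (p a * ?N (m - a)))
        + (\<Sum>q<Suc m. s * of_nat (Suc q) * (p q * ?N (m - q)))
      = (\<Sum>q<Suc m. (p 0 + s * of_nat (Suc m)) * (p q * ?N (m - q)))"
    unfolding sum.distrib[symmetric]
    by (intro sum.cong refl) (auto simp: of_nat_diff algebra_simps)
  also have "\<dots> = (p 0 + s * of_nat (Suc m)) * ((p 0 + s * of_nat m) * ?N m)"
    by (simp only: sum_distrib_left[symmetric] newton_seq_convolution[OF assms])
  finally show ?thesis unfolding sum.distrib 1 2 by (simp only: mult.assoc)
qed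

text \<open>
The mixed term of the loop equation: it arises when integration by parts of the powers in
\<open>h\<^sub>k\<close> hits \<open>e\<^sub>j\<close>, and equally with the roles exchanged. In generating functions it is a divided
difference, whose denominator is cleared in \<open>hook_sum_step\<close>.
\<close>
definition hook_sum :: "(nat \<Rightarrow> complex) \<Rightarrow> nat \<Rightarrow> nat \<Rightarrow> complex" where
  "hook_sum p j k =
     (\<Sum>i<k. \<Sum>r<j. p (i + r) * newton_seq (-1) p (j - 1 - r) * newton_seq 1 p (k - 1 - i))"

lemma hook_sum_0 [simp]: "hook_sum p 0 k = 0" "hook_sum p j 0 = 0"
  by (simp_all add: hook_sum_def)

text \<open>
Shifting both indices cancels all terms of the two double sums except those with \<open>r = 0\<close> in the first
and \<open>i = 0\<close> in the second, which are convolutions.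
\<close>
lemma hook_sum_step:
  "hook_sum p (Suc j) k - hook_sum p j (Suc k)
     = (if k = 0 then 0 else (p 0 + of_nat (k - 1)) * (newton_seq (-1) p j * newton_seq 1 p (k - 1)))
       - (if j = 0 then 0 else (p 0 - of_nat (j - 1)) * (newton_seq (-1) p (j - 1) * newton_seq 1 p k))"
proof -
  let ?e = "newton_seq (-1) p" and ?h = "newton_seq 1 p"
  let ?S = "\<Sum>i<k. \<Sum>r<j. p (Suc (i + r)) * ?e (j - 1 - r) * ?h (k - 1 - i)"
  have "hook_sum p (Suc j) k = (\<Sum>i<k. p i * ?e j * ?h (k - 1 - i)) + ?S"
    unfolding hook_sum_def
    by (simp add: sum.lessThan_Suc_shift sum.distrib del: sum.lessThan_Suc)
  also have "(\<Sum>i<k. p i * ?e j * ?h (k - 1 - i)) = ?e j * (\<Sum>i<k. p i * ?h (k - 1 - i))"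
    by (simp add: sum_distrib_left mult_ac)
  finally have 1: "hook_sum p (Suc j) k = ?e j * (\<Sum>i<k. p i * ?h (k - 1 - i)) + ?S" .
  have "hook_sum p j (Suc k) = (\<Sum>r<j. p r * ?e (j - 1 - r) * ?h k) + ?S"
    unfolding hook_sum_def
    by (simp add: sum.lessThan_Suc_shift del: sum.lessThan_Suc)
  also have "(\<Sum>r<j. p r * ?e (j - 1 - r) * ?h k) = (\<Sum>r<j. p r * ?e (j - 1 - r)) * ?h k"
    by (simp add: sum_distrib_right)
  finally have 2: "hook_sum p j (Suc k) = (\<Sum>r<j. p r * ?e (j - 1 - r)) * ?h k + ?S" .
  have 3: "(\<Sum>i<k. p i * ?h (k - 1 - i)) = (if k = 0 then 0 else (p 0 + of_nat (k - 1)) * ?h (k - 1))"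
    using newton_seq_convolution[of 1 p "k - 1"] by (cases k) simp_all
  have 4: "(\<Sum>r<j. p r * ?e (j - 1 - r)) = (if j = 0 then 0 else (p 0 - of_nat (j - 1)) * ?e (j - 1))"
    using newton_seq_convolution[of "-1" p "j - 1"] by (cases j) simp_all
  show ?thesis unfolding 1 2 3 4 by (simp add: mult_ac)
qed

text \<open>
The generating functions of the two sequences solve \<open>t N' = s (P - p\<^sub>0) N\<close> with opposite signs, hence
their product is constant.
\<close>
lemma newton_seq_inverse:
  "(\<Sum>i\<le>m. newton_seq (-1) p i * newton_seq 1 p (m - i)) = (if m = 0 then 1 else 0)"
proof (cases "m = 0")
  case False
  define P E H where "P = Abs_fps p" and "E = Abs_fps (newton_seq (-1) p)"
    and "H = Abs_fps (newton_seq 1 p)"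
  have conv: "P * Abs_fps (newton_seq s p) = Abs_fps (\<lambda>m. (p 0 + s * of_nat m) * newton_seq s p m)"
    if "s * s = 1" for s
  proof (rule fps_ext)
    fix m
    show "fps_nth (P * Abs_fps (newton_seq s p)) m
      = fps_nth (Abs_fps (\<lambda>m. (p 0 + s * of_nat m) * newton_seq s p m)) m"
      using newton_seq_convolution[OF that, of p m]
      by (simp add: P_def fps_mult_nth lessThan_Suc_atMost atLeast0AtMost)
  qed
  have "fps_nth ((P * E) * H) m = fps_nth (E * (P * H)) m" by (simp add: mult_ac)
  then have "(\<Sum>i\<le>m. (p 0 - of_nat i) * newton_seq (-1) p i * newton_seq 1 p (m - i))
      = (\<Sum>i\<le>m. newton_seq (-1) p i * ((p 0 + of_nat (m - i)) * newton_seq 1 p (m - i)))"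
    unfolding E_def H_def using conv[of 1] conv[of "-1"]
    by (simp add: fps_mult_nth atLeast0AtMost)
  then have "0 = (\<Sum>i\<le>m. newton_seq (-1) p i * ((p 0 + of_nat (m - i)) * newton_seq 1 p (m - i))
      - (p 0 - of_nat i) * newton_seq (-1) p i * newton_seq 1 p (m - i))"
    by (simp add: sum_subtractf)
  also have "\<dots> = (\<Sum>i\<le>m. of_nat m * (newton_seq (-1) p i * newton_seq 1 p (m - i)))"
    by (intro sum.cong refl) (auto simp: of_nat_diff algebra_simps)
  finally show ?thesis using False by (simp flip: sum_distrib_left)
qed simp

text \<open>
If \<open>P\<close>, \<open>E\<close> and \<open>H\<close> are the generating functions then \<open>P = (P E) H\<close>, and \<open>P E\<close> is known from the
convolution identity.
\<close>
lemma power_sum_eq_hooks: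
  "p m = (\<Sum>j\<le>m. (p 0 - of_nat j) * (newton_seq (-1) p j * newton_seq 1 p (m - j)))"
proof -
  define P E H where "P = Abs_fps p" and "E = Abs_fps (newton_seq (-1) p)"
    and "H = Abs_fps (newton_seq 1 p)"
  have PE: "P * E = Abs_fps (\<lambda>m. (p 0 - of_nat m) * newton_seq (-1) p m)"
  proof (rule fps_ext)
    fix m
    show "fps_nth (P * E) m = fps_nth (Abs_fps (\<lambda>m. (p 0 - of_nat m) * newton_seq (-1) p m)) m"
      using newton_seq_convolution[of "-1" p m]
      by (simp add: P_def E_def fps_mult_nth lessThan_Suc_atMost atLeast0AtMost)
  qed
  have "E * H = 1"
    by (rule fps_ext) (simp add: E_def H_def fps_mult_nth atLeast0AtMost newton_seq_inverse)
  then have "P = (P * E) * H" by (metis mult.assoc mult_1_right)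
  from arg_cong[OF this, of "\<lambda>f. fps_nth f m"]
  have "fps_nth P m = fps_nth ((P * E) * H) m" .
  then show ?thesis
    unfolding PE by (simp add: P_def H_def fps_mult_nth atLeast0AtMost mult.assoc)
qed

section \<open>Integration by parts for independent Gaussian variables\<close>

definition gauss_space :: "nat \<Rightarrow> (nat \<Rightarrow> real) measure" where
  "gauss_space d = (\<Pi>\<^sub>M j\<in>{..<d}. density lborel (\<lambda>x. ennreal (std_normal_density x)))"

lemma gauss_line_moment:
  "has_bochner_integral (density lborel (\<lambda>x. ennreal (std_normal_density x))) (\<lambda>x. x ^ k) (gauss_moment k)"
  unfolding gauss_moment_def has_bochner_integral_iff
  by (auto simp: integrable_density integral_density intro: integrable_std_normal_moment)

interpretation gauss_product: product_sigma_finite "\<lambda>_ :: nat. density lborel (\<lambda>x. ennreal (std_normal_density x))"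
proof (rule product_sigma_finite.intro)
  interpret prob_space "density lborel (\<lambda>x. ennreal (std_normal_density x))"
    by (rule prob_space_normal_density) simp
  show "sigma_finite_measure (density lborel (\<lambda>x. ennreal (std_normal_density x)))"
    by unfold_locales
qed

lemma prob_space_gauss_space: "prob_space (gauss_space d)"
  unfolding gauss_space_def by (rule prob_space_PiM) (rule prob_space_normal_density, simp)

lemma gauss_space_monomial:
  "has_bochner_integral (gauss_space d) (\<lambda>z. complex_of_real (\<Prod>i<d. z i ^ \<alpha> i))
     (complex_of_real (\<Prod>i<d. gauss_moment (\<alpha> i)))"
proof (rule has_bochner_integral_of_real)
  have "integrable (gauss_space d) (\<lambda>z. \<Prod>i<d. z i ^ \<alpha> i)"
    unfolding gauss_space_def
    by (rule gauss_product.product_integrable_prod)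
       (use gauss_line_moment in \<open>auto simp: has_bochner_integral_iff\<close>)
  moreover have "(LINT z|gauss_space d. (\<Prod>i<d. z i ^ \<alpha> i)) = (\<Prod>i<d. gauss_moment (\<alpha> i))"
    unfolding gauss_space_def
    by (subst gauss_product.product_integral_prod)
       (use gauss_line_moment in \<open>auto simp: has_bochner_integral_iff\<close>)
  ultimately show "has_bochner_integral (gauss_space d) (\<lambda>z. \<Prod>i<d. z i ^ \<alpha> i) (\<Prod>i<d. gauss_moment (\<alpha> i))"
    by (simp add: has_bochner_integral_iff)
qed

text \<open>
The second argument lists the formal partial derivatives. Building polynomials by multiplication with
one variable at a time makes closure under products a simple induction and reduces
integration by parts to monomials.
\<close>
inductive gauss_poly :: "nat \<Rightarrow> ((nat \<Rightarrow> real) \<Rightarrow> complex) \<Rightarrow> (nat \<Rightarrow> (nat \<Rightarrow> real) \<Rightarrow> complex) \<Rightarrow> bool"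
  for d :: nat where
  const: "gauss_poly d (\<lambda>z. c) (\<lambda>j z. 0)"
| add: "gauss_poly d f f' \<Longrightarrow> gauss_poly d g g' \<Longrightarrow> gauss_poly d (\<lambda>z. f z + g z) (\<lambda>j z. f' j z + g' j z)"
| var: "i < d \<Longrightarrow> gauss_poly d f f' \<Longrightarrow>
    gauss_poly d (\<lambda>z. complex_of_real (z i) * f z)
      (\<lambda>j z. (if j = i then f z else 0) + complex_of_real (z i) * f' j z)"

lemma gauss_poly_cong:
  assumes "gauss_poly d f f'" "\<And>z. f z = g z" "\<And>j z. f' j z = g' j z"
  shows "gauss_poly d g g'"
proof -
  have "f = g" "f' = g'" using assms(2,3) by (auto intro!: ext)
  with assms(1) show ?thesis by simp
qed

lemma gauss_poly_cmult:
  assumes "gauss_poly d f f'" shows "gauss_poly d (\<lambda>z. c * f z) (\<lambda>j z. c * f' j z)"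
  using assms
proof induction
  case (const c')
  show ?case by (rule gauss_poly_cong[OF gauss_poly.const[of d "c * c'"]]) auto
next
  case (add f f' g g')
  show ?case by (rule gauss_poly_cong[OF gauss_poly.add[OF add.IH]]) (auto simp: algebra_simps)
next
  case (var i f f')
  show ?case by (rule gauss_poly_cong[OF gauss_poly.var[OF var.hyps(1) var.IH]]) (auto simp: algebra_simps)
qed

lemma gauss_poly_mult:
  assumes "gauss_poly d f f'" "gauss_poly d g g'"
  shows "gauss_poly d (\<lambda>z. f z * g z) (\<lambda>j z. f' j z * g z + f z * g' j z)"
  using assms(1)
proof induction
  case (const c)
  show ?case by (rule gauss_poly_cong[OF gauss_poly_cmult[OF assms(2), of c]]) auto
next
  case (add f f' h h')
  show ?case by (rule gauss_poly_cong[OF gauss_poly.add[OF add.IH]]) (auto simp: algebra_simps)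
next
  case (var i f f')
  show ?case by (rule gauss_poly_cong[OF gauss_poly.var[OF var.hyps(1) var.IH]]) (auto simp: algebra_simps)
qed

lemma gauss_poly_sum:
  assumes "\<And>a. a \<in> A \<Longrightarrow> gauss_poly d (f a) (f' a)"
  shows "gauss_poly d (\<lambda>z. \<Sum>a\<in>A. f a z) (\<lambda>j z. \<Sum>a\<in>A. f' a j z)"
  using assms
proof (induction A rule: infinite_finite_induct)
  case (insert a A)
  have "gauss_poly d (\<lambda>z. f a z + (\<Sum>a\<in>A. f a z)) (\<lambda>j z. f' a j z + (\<Sum>a\<in>A. f' a j z))"
    by (rule gauss_poly.add) (use insert in auto)
  with insert show ?case by simp
qed (simp_all add: gauss_poly.const)

definition monomial_fun :: "nat \<Rightarrow> (nat \<Rightarrow> nat) \<Rightarrow> (nat \<Rightarrow> real) \<Rightarrow> complex" where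
  "monomial_fun d \<alpha> z = complex_of_real (\<Prod>i<d. z i ^ \<alpha> i)"

text \<open>
Integration by parts against an arbitrary monomial factor. This generality is what the induction needs:
multiplying the polynomial by a variable raises an exponent of the monomial. For constant
\<open>f\<close> the claim is the recursion of the Gaussian moments; for \<open>\<alpha> j = 0\<close> the truncated exponent
\<open>\<alpha> j - 1\<close> is harmless because of the factor \<open>\<alpha> j\<close>.
\<close>
lemma gauss_poly_stein_aux:
  fixes \<alpha> :: "nat \<Rightarrow> nat"
  assumes "gauss_poly d f f'"
  shows "integrable (gauss_space d) (\<lambda>z. monomial_fun d \<alpha> z * f z)
     \<and> (\<forall>j<d. integrable (gauss_space d) (\<lambda>z. monomial_fun d \<alpha> z * f' j z) \<and>
        (LINT z|gauss_space d. monomial_fun d (\<alpha>(j := Suc (\<alpha> j))) z * f z)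
          = of_nat (\<alpha> j) * (LINT z|gauss_space d. monomial_fun d (\<alpha>(j := \<alpha> j - 1)) z * f z)
            + (LINT z|gauss_space d. monomial_fun d \<alpha> z * f' j z))"
  using assms
proof (induction arbitrary: \<alpha>)
  case (const c)
  have int: "integrable (gauss_space d) (monomial_fun d \<alpha>)"
    "integral\<^sup>L (gauss_space d) (monomial_fun d \<alpha>) = complex_of_real (\<Prod>i<d. gauss_moment (\<alpha> i))" for \<alpha>
    using gauss_space_monomial[of d \<alpha>] unfolding monomial_fun_def[abs_def] has_bochner_integral_iff by blast+
  have "(\<Prod>i<d. gauss_moment ((\<alpha>(j := Suc (\<alpha> j))) i))
      = real (\<alpha> j) * (\<Prod>i<d. gauss_moment ((\<alpha>(j := \<alpha> j - 1)) i))" if "j < d" for j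
  proof -
    have split: "(\<Prod>i<d. gauss_moment ((\<alpha>(j := a)) i))
        = gauss_moment a * (\<Prod>i\<in>{..<d} - {j}. gauss_moment (\<alpha> i))" for a
      using that by (subst prod.remove[of _ j]) auto
    have "gauss_moment (Suc (\<alpha> j)) = real (\<alpha> j) * gauss_moment (\<alpha> j - 1)"
      by (cases "\<alpha> j") (simp_all add: gauss_moment_Suc_Suc)
    then show ?thesis unfolding split by simp
  qed
  then show ?case by (simp add: int)
next
  case (add f f' g g')
  then show ?case by (simp add: distrib_left)
next
  case (var i f f')
  have shift: "monomial_fun d \<beta> z * (complex_of_real (z i) * h) = monomial_fun d (\<beta>(i := Suc (\<beta> i))) z * h" for \<beta> z h
  proof -
    have split: "monomial_fun d (\<beta>(i := a)) z = complex_of_real (z i ^ a) * complex_of_real (\<Prod>l\<in>{..<d} - {i}. z l ^ \<beta> l)" for a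
      unfolding monomial_fun_def using var.hyps(1) by (subst prod.remove[of _ i]) auto
    from split[of "\<beta> i"] split[of "Suc (\<beta> i)"] show ?thesis by simp
  qed
  let ?\<beta> = "\<alpha>(i := Suc (\<alpha> i))"
  note IH = var.IH[of \<alpha>] var.IH[of ?\<beta>]
  have int: "integrable (gauss_space d) (\<lambda>z. monomial_fun d \<gamma> z * f z)"
    "\<And>j. j < d \<Longrightarrow> integrable (gauss_space d) (\<lambda>z. monomial_fun d \<gamma> z * f' j z)" for \<gamma>
    using var.IH[of \<gamma>] by blast+
  have "(LINT z|gauss_space d. monomial_fun d (\<alpha>(j := Suc (\<alpha> j))) z * (complex_of_real (z i) * f z))
      = of_nat (\<alpha> j) * (LINT z|gauss_space d. monomial_fun d (\<alpha>(j := \<alpha> j - 1)) z * (complex_of_real (z i) * f z))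
        + (LINT z|gauss_space d. monomial_fun d \<alpha> z * ((if j = i then f z else 0) + complex_of_real (z i) * f' j z))"
    if "j < d" for j
  proof (cases "j = i")
    case False
    have "(LINT z|gauss_space d. monomial_fun d (\<alpha>(j := Suc (\<alpha> j))) z * (complex_of_real (z i) * f z))
        = (LINT z|gauss_space d. monomial_fun d (?\<beta>(j := Suc (?\<beta> j))) z * f z)"
      using False by (simp add: shift fun_upd_twist[OF False])
    also have "\<dots> = of_nat (?\<beta> j) * (LINT z|gauss_space d. monomial_fun d (?\<beta>(j := ?\<beta> j - 1)) z * f z)
        + (LINT z|gauss_space d. monomial_fun d ?\<beta> z * f' j z)"
      using IH(2) that by blast
    finally show ?thesis
      using False by (simp add: shift fun_upd_twist[OF False])
  next
    case True
    have 1: "of_nat (\<alpha> i) * (LINT z|gauss_space d. monomial_fun d (\<alpha>(i := \<alpha> i - 1)) z * (complex_of_real (z i) * f z))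
        = of_nat (\<alpha> i) * (LINT z|gauss_space d. monomial_fun d \<alpha> z * f z)"
    proof (cases "\<alpha> i")
      case (Suc a)
      then have "\<alpha>(i := Suc a) = \<alpha>" by auto
      then show ?thesis by (simp add: shift Suc)
    qed simp
    have 2: "(LINT z|gauss_space d. monomial_fun d \<alpha> z * (f z + complex_of_real (z i) * f' i z))
       = (LINT z|gauss_space d. monomial_fun d \<alpha> z * f z) + (LINT z|gauss_space d. monomial_fun d ?\<beta> z * f' i z)"
      using int that True by (simp add: distrib_left shift)
    have "(LINT z|gauss_space d. monomial_fun d (\<alpha>(i := Suc (\<alpha> i))) z * (complex_of_real (z i) * f z))
        = (LINT z|gauss_space d. monomial_fun d (?\<beta>(i := Suc (?\<beta> i))) z * f z)"
      by (simp add: shift)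
    also have "\<dots> = of_nat (?\<beta> i) * (LINT z|gauss_space d. monomial_fun d (?\<beta>(i := ?\<beta> i - 1)) z * f z)
        + (LINT z|gauss_space d. monomial_fun d ?\<beta> z * f' i z)"
      using IH(2) that True by blast
    also have "\<dots> = of_nat (Suc (\<alpha> i)) * (LINT z|gauss_space d. monomial_fun d \<alpha> z * f z)
        + (LINT z|gauss_space d. monomial_fun d ?\<beta> z * f' i z)"
      by simp
    finally show ?thesis unfolding True 1 using 2 by (simp add: algebra_simps)
  qed
  moreover have "integrable (gauss_space d) (\<lambda>z. monomial_fun d \<alpha> z * ((if j = i then f z else 0) + complex_of_real (z i) * f' j z))"
    if "j < d" for j
    using int that by (cases "j = i") (simp_all add: distrib_left shift)
  moreover have "integrable (gauss_space d) (\<lambda>z. monomial_fun d \<alpha> z * (complex_of_real (z i) * f z))"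
    using int by (simp add: shift)
  ultimately show ?case by blast
qed

lemma gauss_poly_integrable: "gauss_poly d f f' \<Longrightarrow> integrable (gauss_space d) f"
  using gauss_poly_stein_aux[of d f f' "\<lambda>_. 0"] by (simp add: monomial_fun_def)

lemma gauss_poly_stein:
  assumes "gauss_poly d f f'" "j < d"
  shows "(LINT z|gauss_space d. complex_of_real (z j) * f z) = (LINT z|gauss_space d. f' j z)"
    "integrable (gauss_space d) (f' j)"
proof -
  have "(\<Prod>i<d. z i ^ (if i = j then Suc 0 else 0)) = z j" for z :: "nat \<Rightarrow> real"
    using assms(2) by (subst prod.remove[of _ j]) auto
  then have "monomial_fun d ((\<lambda>_. 0)(j := Suc 0)) z = complex_of_real (z j)" for z
    unfolding monomial_fun_def fun_upd_def by simp
  moreover have "monomial_fun d (\<lambda>_. 0) z = 1" for z by (simp add: monomial_fun_def)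
  ultimately show "(LINT z|gauss_space d. complex_of_real (z j) * f z) = (LINT z|gauss_space d. f' j z)"
    "integrable (gauss_space d) (f' j)"
    using gauss_poly_stein_aux[OF assms(1), of "\<lambda>_. 0"] assms(2) by auto
qed

section \<open>Integration by parts for the GUE\<close>

lemma sum_matrix_unit:
  fixes f :: "nat \<Rightarrow> nat \<Rightarrow> complex"
  assumes "a < n" "b < n"
  shows "(\<Sum>c<n. \<Sum>e<n. f c e * (if c = a \<and> e = b then 1 else 0)) = f a b"
proof -
  have "(\<Sum>e<n. f c e * (if c = a \<and> e = b then 1 else 0)) = (if c = a then f c b else 0)" for c
    using assms by (cases "c = a") (simp_all add: if_distrib[of "\<lambda>x. _ * x"] cong: if_cong)
  then show ?thesis using assms by simp
qed

lemma integral_double_sum: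
  fixes f :: "nat \<Rightarrow> nat \<Rightarrow> 'a \<Rightarrow> complex"
  assumes "\<And>a b. a < n \<Longrightarrow> b < n \<Longrightarrow> integrable N (f a b)"
  shows "(LINT z|N. (\<Sum>a<n. \<Sum>b<n. f a b z)) = (\<Sum>a<n. \<Sum>b<n. LINT z|N. f a b z)"
proof -
  have "(LINT z|N. (\<Sum>a<n. \<Sum>b<n. f a b z)) = (\<Sum>a<n. LINT z|N. (\<Sum>b<n. f a b z))"
    by (rule Bochner_Integration.integral_sum) (use assms in auto)
  also have "\<dots> = (\<Sum>a<n. \<Sum>b<n. LINT z|N. f a b z)"
    by (intro sum.cong refl Bochner_Integration.integral_sum) (use assms in auto)
  finally show ?thesis .
qed

lemma mat_adjoint_index:
  "i < dim_col A \<Longrightarrow> j < dim_row A \<Longrightarrow> mat_adjoint A $$ (i, j) = cnj (A $$ (j, i))"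
  unfolding mat_adjoint_def by (simp add: mat_of_rows_def)

lemma mat_adjoint_dim: "dim_row (mat_adjoint A) = dim_col A" "dim_col (mat_adjoint A) = dim_row A"
  unfolding mat_adjoint_def by simp_all

lemma hermitian_matsD:
  assumes "A \<in> hermitian_mats n" "a < n" "b < n"
  shows "cnj (A $$ (a, b)) = A $$ (b, a)"
proof -
  have A: "A \<in> carrier_mat n n" "mat_adjoint A = A"
    using assms(1) by (simp_all add: hermitian_mats_def)
  then have "mat_adjoint A $$ (b, a) = cnj (A $$ (a, b))"
    using assms(2,3) by (intro mat_adjoint_index) auto
  then show ?thesis unfolding A(2) by simp
qed

lemma hermitian_matsI:
  assumes "A \<in> carrier_mat n n" "\<And>a b. a < n \<Longrightarrow> b < n \<Longrightarrow> cnj (A $$ (a, b)) = A $$ (b, a)"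
  shows "A \<in> hermitian_mats n"
proof -
  have "mat_adjoint A = A"
  proof (rule eq_matI)
    fix a b assume "a < dim_row A" "b < dim_col A"
    with assms(1) have "a < n" "b < n" by auto
    with assms show "mat_adjoint A $$ (a, b) = A $$ (a, b)" by (subst mat_adjoint_index) auto
  qed (use assms(1) in \<open>auto simp: mat_adjoint_dim\<close>)
  with assms(1) show ?thesis by (simp add: hermitian_mats_def)
qed

text \<open>
For Hermitian matrices \<open>tr (A B)\<close> is real, so the real part in the inner product can be dropped.
\<close>
lemma mat_inner_hermitian:
  assumes "A \<in> hermitian_mats n" "B \<in> hermitian_mats n"
  shows "complex_of_real (mat_inner A B) = (\<Sum>p<n. \<Sum>q<n. A $$ (p, q) * B $$ (q, p))"
proof -
  have A: "mat_adjoint A = A" "A \<in> carrier_mat n n" and B: "B \<in> carrier_mat n n"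
    using assms by (simp_all add: hermitian_mats_def)
  let ?S = "\<Sum>p<n. \<Sum>q<n. A $$ (p, q) * B $$ (q, p)"
  have "(A * B) $$ (p, p) = (\<Sum>q<n. A $$ (p, q) * B $$ (q, p))" if "p < n" for p
    using A(2) B that by (simp add: scalar_prod_def atLeast0LessThan)
  then have tr: "mat_tr (A * B) = ?S"
    unfolding mat_tr_def using A(2) by simp
  have "cnj ?S = (\<Sum>p<n. \<Sum>q<n. cnj (A $$ (p, q)) * cnj (B $$ (q, p)))" by simp
  also have "\<dots> = (\<Sum>p<n. \<Sum>q<n. A $$ (q, p) * B $$ (p, q))"
    by (intro sum.cong refl) (simp add: hermitian_matsD[OF assms(1)] hermitian_matsD[OF assms(2)])
  also have "\<dots> = ?S" by (rule sum.swap)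
  finally have "cnj ?S = ?S" .
  then have "complex_of_real (Re ?S) = ?S"
    by (simp only: Reals_cnj_iff[symmetric] of_real_Re)
  then show ?thesis unfolding mat_inner_def A(1) tr .
qed

locale gue_basis =
  fixes n d :: nat and E :: "nat \<Rightarrow> complex mat"
  assumes basis: "hermitian_orthonormal_basis n d E"
begin

lemma basis_hermitian: "j < d \<Longrightarrow> E j \<in> hermitian_mats n"
  using basis unfolding hermitian_orthonormal_basis_def by blast

abbreviation M :: "(nat \<Rightarrow> real) \<Rightarrow> complex mat" where
  "M z \<equiv> real_lincomb n d E z"

lemma M_carrier: "M z \<in> carrier_mat n n"
  by (simp add: real_lincomb_def)

lemma M_index: "a < n \<Longrightarrow> b < n \<Longrightarrow> M z $$ (a, b) = (\<Sum>j<d. complex_of_real (z j) * E j $$ (a, b))"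
  by (simp add: real_lincomb_def)

lemma M_hermitian: "M z \<in> hermitian_mats n"
proof (rule hermitian_matsI[OF M_carrier])
  fix a b assume ab: "a < n" "b < n"
  then have "cnj (M z $$ (a, b)) = (\<Sum>j<d. complex_of_real (z j) * cnj (E j $$ (a, b)))"
    by (simp add: M_index)
  also have "\<dots> = M z $$ (b, a)"
    unfolding M_index[OF ab(2,1)]
    by (intro sum.cong refl) (simp add: hermitian_matsD[OF basis_hermitian] ab)
  finally show "cnj (M z $$ (a, b)) = M z $$ (b, a)" .
qed

lemma basis_expansion:
  assumes "A \<in> hermitian_mats n" "a < n" "b < n"
  shows "(\<Sum>j<d. (\<Sum>p<n. \<Sum>q<n. E j $$ (p, q) * A $$ (q, p)) * E j $$ (a, b)) = A $$ (a, b)"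
proof -
  from basis assms(1) obtain c where c: "A = M c"
    unfolding hermitian_orthonormal_basis_def by blast
  have "(\<Sum>p<n. \<Sum>q<n. E j $$ (p, q) * A $$ (q, p)) = complex_of_real (c j)" if "j < d" for j
  proof -
    have "(\<Sum>p<n. \<Sum>q<n. E j $$ (p, q) * A $$ (q, p))
        = (\<Sum>p<n. \<Sum>q<n. \<Sum>i<d. complex_of_real (c i) * (E j $$ (p, q) * E i $$ (q, p)))"
      unfolding c by (simp add: M_index sum_distrib_left mult_ac)
    also have "\<dots> = (\<Sum>i<d. complex_of_real (c i) * (\<Sum>p<n. \<Sum>q<n. E j $$ (p, q) * E i $$ (q, p)))"
      unfolding sum_distrib_left by (subst sum.swap[of _ "{..<d}"], subst sum.swap[of _ "{..<d}"]) (rule refl)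
    also have "\<dots> = (\<Sum>i<d. complex_of_real (c i) * (if j = i then 1 else 0))"
    proof (intro sum.cong refl)
      fix i assume "i \<in> {..<d}"
      then have "mat_inner (E j) (E i) = (if j = i then 1 else 0)"
        using basis that unfolding hermitian_orthonormal_basis_def by blast
      with \<open>i \<in> {..<d}\<close> that show "complex_of_real (c i) * (\<Sum>p<n. \<Sum>q<n. E j $$ (p, q) * E i $$ (q, p))
          = complex_of_real (c i) * (if j = i then 1 else 0)"
        by (simp flip: mat_inner_hermitian[OF basis_hermitian basis_hermitian])
    qed
    also have "\<dots> = complex_of_real (c j)"
      using that by (simp add: if_distrib sum.delta cong: if_cong)
    finally show ?thesis .
  qed
  then show ?thesis using assms(2,3) unfolding c by (simp add: M_index)
qed

text \<open>
The covariance of the entries, \<open>E M\<^sub>a\<^sub>b M\<^sub>c\<^sub>e = \<delta>\<^sub>a\<^sub>e \<delta>\<^sub>b\<^sub>c\<close>. The expansion of Hermitian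
matrices in the basis extends complex-linearly to all matrices, and a matrix unit is \<open>X + \<i> Y\<close>
with Hermitian \<open>X\<close> and \<open>Y\<close>.
\<close>
lemma basis_completeness:
  assumes "a < n" "b < n" "c < n" "e < n"
  shows "(\<Sum>j<d. E j $$ (a, b) * E j $$ (c, e)) = (if a = e \<and> b = c then 1 else 0)"
proof -
  define \<delta> where "\<delta> p q = (if p = e \<and> q = c then 1 else 0 :: complex)" for p q
  define X where "X = Matrix.mat n n (\<lambda>(p, q). (\<delta> p q + \<delta> q p) / 2)"
  define Y where "Y = Matrix.mat n n (\<lambda>(p, q). - \<i> * (\<delta> p q - \<delta> q p) / 2)"
  have cnj_\<delta>: "cnj (\<delta> p q) = \<delta> p q" for p q by (simp add: \<delta>_def)
  have herm: "X \<in> hermitian_mats n" "Y \<in> hermitian_mats n"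
  proof -
    have "cnj (X $$ (p, q)) = X $$ (q, p)" "cnj (Y $$ (p, q)) = Y $$ (q, p)" if "p < n" "q < n" for p q
    proof -
      have "(cnj x + cnj y) / 2 = (y + x) / 2" "\<i> * (x - y) / 2 = - \<i> * (y - x) / 2"
        if "cnj x = x" "cnj y = y" for x y :: complex
        using that by (simp_all add: add.commute algebra_simps)
      note e = this[OF cnj_\<delta> cnj_\<delta>]
      show "cnj (X $$ (p, q)) = X $$ (q, p)"
        using that e(1)[of p q q p] by (simp add: X_def)
      show "cnj (Y $$ (p, q)) = Y $$ (q, p)"
        using that e(2)[of p q q p] by (simp add: Y_def cnj_\<delta>)
    qed
    moreover have "X \<in> carrier_mat n n" "Y \<in> carrier_mat n n" by (simp_all add: X_def Y_def)
    ultimately show "X \<in> hermitian_mats n" "Y \<in> hermitian_mats n"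
      by (auto intro: hermitian_matsI)
  qed
  have XY: "X $$ (q, p) + \<i> * Y $$ (q, p) = \<delta> q p" if "q < n" "p < n" for p q
  proof -
    have "(x + y) / 2 + \<i> * (- \<i> * (x - y) / 2) = x" for x y :: complex
      by (simp add: complex_eq_iff field_simps)
    moreover have "X $$ (q, p) = (\<delta> q p + \<delta> p q) / 2" "Y $$ (q, p) = - \<i> * (\<delta> q p - \<delta> p q) / 2"
      using that by (simp_all add: X_def Y_def)
    ultimately show ?thesis by (simp only:)
  qed
  let ?c = "\<lambda>A j. \<Sum>p<n. \<Sum>q<n. E j $$ (p, q) * A $$ (q, p)"
  have comb: "?c X j + \<i> * ?c Y j = E j $$ (c, e)" for j
  proof -
    have "?c X j + \<i> * ?c Y j = (\<Sum>p<n. \<Sum>q<n. E j $$ (p, q) * (X $$ (q, p) + \<i> * Y $$ (q, p)))"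
      unfolding sum_distrib_left sum.distrib[symmetric]
      by (intro sum.cong refl) (simp add: distrib_left mult.left_commute)
    also have "\<dots> = (\<Sum>p<n. \<Sum>q<n. E j $$ (p, q) * (if p = c \<and> q = e then 1 else 0))"
      by (intro sum.cong refl) (auto simp: XY \<delta>_def)
    also have "\<dots> = E j $$ (c, e)" by (rule sum_matrix_unit[OF assms(3,4)])
    finally show ?thesis .
  qed
  have "(\<Sum>j<d. E j $$ (a, b) * E j $$ (c, e)) = (\<Sum>j<d. (?c X j + \<i> * ?c Y j) * E j $$ (a, b))"
    by (intro sum.cong refl) (subst comb, rule mult.commute)
  also have "\<dots> = (\<Sum>j<d. ?c X j * E j $$ (a, b)) + \<i> * (\<Sum>j<d. ?c Y j * E j $$ (a, b))"
  proof -
    have "(\<Sum>j<d. (u j + \<i> * v j) * w j) = (\<Sum>j<d. u j * w j) + \<i> * (\<Sum>j<d. v j * w j)"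
      for u v w :: "nat \<Rightarrow> complex"
      by (simp add: sum_distrib_left sum.distrib algebra_simps)
    then show ?thesis .
  qed
  also have "\<dots> = X $$ (a, b) + \<i> * Y $$ (a, b)"
    by (simp only: basis_expansion[OF herm(1) assms(1,2)] basis_expansion[OF herm(2) assms(1,2)])
  also have "\<dots> = (if a = e \<and> b = c then 1 else 0)"
    using XY[of a b] assms by (simp add: \<delta>_def)
  finally show ?thesis .
qed

text \<open>
Coordinates with index at least \<open>d\<close> do not occur in \<open>M\<close>, so that the corresponding derivatives vanish.
\<close>
definition basis_entry :: "nat \<Rightarrow> nat \<Rightarrow> nat \<Rightarrow> complex" where
  "basis_entry j a b = (if j < d then E j $$ (a, b) else 0)"

text \<open>
Polynomials in the entries of \<open>M\<close>, where \<open>D a b\<close> plays the role of the partial derivative with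
respect to the entry at \<open>(a, b)\<close>, all entries being treated as independent complex variables. The
entries depend on the Gaussian coordinates by the matrices of the basis, hence the chain rule.
\<close>
definition mat_poly :: "((nat \<Rightarrow> real) \<Rightarrow> complex) \<Rightarrow> (nat \<Rightarrow> nat \<Rightarrow> (nat \<Rightarrow> real) \<Rightarrow> complex) \<Rightarrow> bool" where
  "mat_poly f D \<longleftrightarrow> gauss_poly d f (\<lambda>j z. \<Sum>a<n. \<Sum>b<n. basis_entry j a b * D a b z)"

lemma mat_poly_cong:
  assumes "mat_poly f D" "\<And>z. f z = g z" "\<And>a b z. a < n \<Longrightarrow> b < n \<Longrightarrow> D a b z = D' a b z"
  shows "mat_poly g D'"
  using assms(1) unfolding mat_poly_def
  by (rule gauss_poly_cong) (use assms(2,3) in \<open>auto intro!: sum.cong\<close>)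

lemma mat_poly_const: "mat_poly (\<lambda>z. c) (\<lambda>a b z. 0)"
  unfolding mat_poly_def by (simp add: gauss_poly.const)

lemma mat_poly_cmult: "mat_poly f D \<Longrightarrow> mat_poly (\<lambda>z. c * f z) (\<lambda>a b z. c * D a b z)"
  unfolding mat_poly_def
  by (rule gauss_poly_cong, erule gauss_poly_cmult) (simp_all add: sum_distrib_left mult_ac)

lemma mat_poly_mult:
  assumes "mat_poly f D" "mat_poly g D'"
  shows "mat_poly (\<lambda>z. f z * g z) (\<lambda>a b z. D a b z * g z + f z * D' a b z)"
  using gauss_poly_mult[OF assms[unfolded mat_poly_def]] unfolding mat_poly_def
  by (rule gauss_poly_cong)
     (simp_all add: sum_distrib_left sum_distrib_right sum.distrib distrib_left mult_ac)

lemma mat_poly_sum: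
  assumes "\<And>i. i \<in> A \<Longrightarrow> mat_poly (f i) (D i)"
  shows "mat_poly (\<lambda>z. \<Sum>i\<in>A. f i z) (\<lambda>a b z. \<Sum>i\<in>A. D i a b z)"
proof -
  have "gauss_poly d (\<lambda>z. \<Sum>i\<in>A. f i z) (\<lambda>j z. \<Sum>i\<in>A. \<Sum>a<n. \<Sum>b<n. basis_entry j a b * D i a b z)"
    by (rule gauss_poly_sum) (use assms in \<open>simp add: mat_poly_def\<close>)
  then show ?thesis
    unfolding mat_poly_def
  proof (rule gauss_poly_cong)
    fix j z
    show "(\<Sum>i\<in>A. \<Sum>a<n. \<Sum>b<n. basis_entry j a b * D i a b z)
        = (\<Sum>a<n. \<Sum>b<n. basis_entry j a b * (\<Sum>i\<in>A. D i a b z))"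
      unfolding sum_distrib_left by (subst sum.swap, intro sum.cong refl) (rule sum.swap)
  qed simp
qed

lemma mat_poly_entry:
  assumes "a < n" "b < n"
  shows "mat_poly (\<lambda>z. M z $$ (a, b)) (\<lambda>c e z. if c = a \<and> e = b then 1 else 0)"
proof -
  have "gauss_poly d (\<lambda>z. \<Sum>j<d. complex_of_real (z j) * E j $$ (a, b))
     (\<lambda>i z. \<Sum>j<d. (if i = j then E j $$ (a, b) else 0) + complex_of_real (z j) * 0)"
    by (intro gauss_poly_sum gauss_poly.var gauss_poly.const) simp
  then show ?thesis
    unfolding mat_poly_def
  proof (rule gauss_poly_cong)
    fix i z
    have "(\<Sum>c<n. \<Sum>e<n. basis_entry i c e * (if c = a \<and> e = b then 1 else 0)) = basis_entry i a b"
      by (rule sum_matrix_unit[OF assms])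
    also have "\<dots> = (\<Sum>j<d. (if i = j then E j $$ (a, b) else 0) + complex_of_real (z j) * 0)"
      by (simp add: basis_entry_def sum.delta')
    finally show "(\<Sum>j<d. (if i = j then E j $$ (a, b) else 0) + complex_of_real (z j) * 0)
      = (\<Sum>c<n. \<Sum>e<n. basis_entry i c e * (if c = a \<and> e = b then 1 else 0))" by (rule sym)
  qed (simp add: M_index assms)
qed

abbreviation mean :: "((nat \<Rightarrow> real) \<Rightarrow> complex) \<Rightarrow> complex" where
  "mean f \<equiv> (LINT z|gauss_space d. f z)"

lemma mat_poly_integrable: "mat_poly f D \<Longrightarrow> integrable (gauss_space d) f"
  unfolding mat_poly_def by (rule gauss_poly_integrable)

text \<open>
Integrate by parts in each coordinate \<open>z\<^sub>j\<close> of \<open>M\<^sub>a\<^sub>b = \<Sum>\<^sub>j z\<^sub>j E\<^sub>j(a, b)\<close>; the sum over \<open>j\<close> is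
then contracted by completeness. The transposition of the indices reflects that \<open>M\<close> is Hermitian.
\<close>
lemma mat_poly_stein:
  assumes f: "mat_poly f D" and ab: "a < n" "b < n"
  shows "mean (\<lambda>z. M z $$ (a, b) * f z) = mean (D b a)"
    and "integrable (gauss_space d) (D b a)"
proof -
  note gp = f[unfolded mat_poly_def]
  let ?f' = "\<lambda>j z. \<Sum>c<n. \<Sum>e<n. basis_entry j c e * D c e z"
  have contract: "(\<Sum>j<d. E j $$ (a, b) * ?f' j z) = D b a z" for z
  proof -
    have "(\<Sum>j<d. E j $$ (a, b) * ?f' j z)
        = (\<Sum>j<d. \<Sum>c<n. \<Sum>e<n. (E j $$ (a, b) * E j $$ (c, e)) * D c e z)"
      by (simp add: basis_entry_def sum_distrib_left mult_ac)
    also have "\<dots> = (\<Sum>c<n. \<Sum>e<n. \<Sum>j<d. (E j $$ (a, b) * E j $$ (c, e)) * D c e z)"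
      by (simp only: sum.swap[of _ "{..<n}" "{..<d}"])
    also have "\<dots> = (\<Sum>c<n. \<Sum>e<n. D c e z * (if c = b \<and> e = a then 1 else 0))"
      by (intro sum.cong refl) (auto simp: sum_distrib_right[symmetric] basis_completeness ab)
    also have "\<dots> = D b a z" by (rule sum_matrix_unit[OF ab(2,1)])
    finally show ?thesis .
  qed
  have int: "integrable (gauss_space d) (?f' j)" if "j < d" for j
    by (rule gauss_poly_stein(2)[OF gp that])
  have int2: "integrable (gauss_space d) (\<lambda>z. complex_of_real (z j) * f z)" if "j < d" for j
    by (rule gauss_poly_integrable[OF gauss_poly.var[OF that gp]])
  have "mean (\<lambda>z. M z $$ (a, b) * f z) = mean (\<lambda>z. \<Sum>j<d. E j $$ (a, b) * (complex_of_real (z j) * f z))"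
    by (simp add: M_index ab sum_distrib_left mult_ac)
  also have "\<dots> = (\<Sum>j<d. E j $$ (a, b) * mean (\<lambda>z. complex_of_real (z j) * f z))"
    by (subst Bochner_Integration.integral_sum) (use int2 in auto)
  also have "\<dots> = (\<Sum>j<d. E j $$ (a, b) * mean (?f' j))"
    using gauss_poly_stein(1)[OF gp] by simp
  also have "\<dots> = mean (\<lambda>z. \<Sum>j<d. E j $$ (a, b) * ?f' j z)"
    by (subst Bochner_Integration.integral_sum) (use int in auto)
  finally show "mean (\<lambda>z. M z $$ (a, b) * f z) = mean (D b a)"
    by (simp only: contract)
  have "integrable (gauss_space d) (\<lambda>z. \<Sum>j<d. E j $$ (a, b) * ?f' j z)"
    by (intro Bochner_Integration.integrable_sum integrable_mult_right int) simp
  then show "integrable (gauss_space d) (D b a)"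
    by (simp only: contract)
qed

definition mpow :: "nat \<Rightarrow> nat \<Rightarrow> nat \<Rightarrow> (nat \<Rightarrow> real) \<Rightarrow> complex" where
  "mpow i a b z = (M z ^\<^sub>m i) $$ (a, b)"

lemma mpow_0: "a < n \<Longrightarrow> b < n \<Longrightarrow> mpow 0 a b z = (if a = b then 1 else 0)"
  using M_carrier[of z] by (simp add: mpow_def)

lemma mpow_Suc:
  "a < n \<Longrightarrow> b < n \<Longrightarrow> mpow (Suc i) a b z = (\<Sum>c<n. mpow i a c z * M z $$ (c, b))"
  using M_carrier[of z] pow_carrier_mat[OF M_carrier[of z], of i]
  by (auto simp: mpow_def scalar_prod_def atLeast0LessThan intro!: sum.cong)

lemma mpow_1: "a < n \<Longrightarrow> b < n \<Longrightarrow> mpow (Suc 0) a b z = M z $$ (a, b)"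
  by (simp add: mpow_Suc mpow_0 if_distrib[of "\<lambda>x. x * _"] cong: if_cong)

lemma mpow_add:
  "a < n \<Longrightarrow> b < n \<Longrightarrow> mpow (i + j) a b z = (\<Sum>c<n. mpow i a c z * mpow j c b z)"
proof (induction j arbitrary: b)
  case 0
  then show ?case by (simp add: mpow_0 if_distrib[of "\<lambda>x. _ * x"] cong: if_cong)
next
  case (Suc j)
  have "mpow (i + Suc j) a b z = (\<Sum>e<n. \<Sum>c<n. mpow i a c z * mpow j c e z * M z $$ (e, b))"
    using Suc by (simp add: mpow_Suc sum_distrib_right)
  also have "\<dots> = (\<Sum>c<n. \<Sum>e<n. mpow i a c z * mpow j c e z * M z $$ (e, b))"
    by (rule sum.swap)
  also have "\<dots> = (\<Sum>c<n. mpow i a c z * mpow (Suc j) c b z)"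
    using Suc.prems by (simp add: mpow_Suc sum_distrib_left mult_ac)
  finally show ?case .
qed

lemma mat_poly_mpow:
  assumes "a < n" "b < n"
  shows "mat_poly (mpow i a b) (\<lambda>c e z. \<Sum>s<i. mpow s a c z * mpow (i - 1 - s) e b z)"
  using assms
proof (induction i arbitrary: b)
  case 0
  show ?case
    by (rule mat_poly_cong[OF mat_poly_const[of "if a = b then 1 else 0"]]) (use 0 in \<open>auto simp: mpow_0\<close>)
next
  case (Suc i)
  have "mat_poly (\<lambda>z. \<Sum>k<n. mpow i a k z * M z $$ (k, b))
     (\<lambda>c e z. \<Sum>k<n. (\<Sum>s<i. mpow s a c z * mpow (i - 1 - s) e k z) * M z $$ (k, b)
        + mpow i a k z * (if c = k \<and> e = b then 1 else 0))"
    by (intro mat_poly_sum mat_poly_mult mat_poly_entry Suc.IH) (use Suc.prems in auto)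
  then show ?case
  proof (rule mat_poly_cong)
    fix c e z assume ce: "c < n" "e < n"
    have "(\<Sum>k<n. (\<Sum>s<i. mpow s a c z * mpow (i - 1 - s) e k z) * M z $$ (k, b))
        = (\<Sum>k<n. \<Sum>s<i. mpow s a c z * (mpow (i - 1 - s) e k z * M z $$ (k, b)))"
      by (simp add: sum_distrib_left mult_ac)
    also have "\<dots> = (\<Sum>s<i. mpow s a c z * (\<Sum>k<n. mpow (i - 1 - s) e k z * M z $$ (k, b)))"
      unfolding sum_distrib_left by (rule sum.swap)
    also have "\<dots> = (\<Sum>s<i. mpow s a c z * mpow (i - s) e b z)"
    proof (intro sum.cong refl)
      fix s assume "s \<in> {..<i}"
      then have "i - s = Suc (i - 1 - s)" by auto
      then show "mpow s a c z * (\<Sum>k<n. mpow (i - 1 - s) e k z * M z $$ (k, b)) = mpow s a c z * mpow (i - s) e b z"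
        by (simp only: mpow_Suc[OF ce(2) Suc.prems(2)])
    qed
    finally have 1: "(\<Sum>k<n. (\<Sum>s<i. mpow s a c z * mpow (i - 1 - s) e k z) * M z $$ (k, b)) = \<dots>" .
    have "(\<Sum>k<n. mpow i a k z * (if c = k \<and> e = b then 1 else 0))
        = (\<Sum>k<n. if c = k then mpow i a k z * (if e = b then 1 else 0) else 0)"
      by (intro sum.cong) auto
    also have "\<dots> = mpow i a c z * mpow 0 e b z"
      using ce Suc.prems by (simp add: sum.delta' mpow_0)
    finally show "(\<Sum>k<n. (\<Sum>s<i. mpow s a c z * mpow (i - 1 - s) e k z) * M z $$ (k, b)
        + mpow i a k z * (if c = k \<and> e = b then 1 else 0))
      = (\<Sum>s<Suc i. mpow s a c z * mpow (Suc i - 1 - s) e b z)"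
      unfolding sum.distrib 1 by simp
  qed (simp add: mpow_Suc Suc.prems)
qed

definition power_trace :: "nat \<Rightarrow> (nat \<Rightarrow> real) \<Rightarrow> complex" where
  "power_trace i z = (\<Sum>a<n. mpow i a a z)"

lemma power_trace_0: "power_trace 0 z = of_nat n"
  by (simp add: power_trace_def mpow_0)

lemma power_trace_add: "power_trace (i + j) z = (\<Sum>a<n. \<Sum>b<n. mpow i a b z * mpow j b a z)"
  by (simp add: power_trace_def mpow_add)

lemma mat_poly_power_trace:
  "mat_poly (power_trace i) (\<lambda>c e z. of_nat i * mpow (i - 1) e c z)"
proof -
  have "mat_poly (\<lambda>z. \<Sum>a<n. mpow i a a z)
      (\<lambda>c e z. \<Sum>a<n. \<Sum>s<i. mpow s a c z * mpow (i - 1 - s) e a z)"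
    by (intro mat_poly_sum mat_poly_mpow) auto
  then show ?thesis
  proof (rule mat_poly_cong)
    fix c e z assume ce: "c < n" "e < n"
    have "(\<Sum>a<n. \<Sum>s<i. mpow s a c z * mpow (i - 1 - s) e a z)
        = (\<Sum>s<i. \<Sum>a<n. mpow (i - 1 - s) e a z * mpow s a c z)"
      by (subst sum.swap) (simp add: mult_ac)
    also have "\<dots> = (\<Sum>s<i. mpow (i - 1) e c z)"
      by (intro sum.cong refl) (simp add: mpow_add[OF ce(2) ce(1), symmetric])
    finally show "(\<Sum>a<n. \<Sum>s<i. mpow s a c z * mpow (i - 1 - s) e a z) = of_nat i * mpow (i - 1) e c z"
      by simp
  qed (simp add: power_trace_def)
qed

abbreviation trace_newton :: "complex \<Rightarrow> nat \<Rightarrow> (nat \<Rightarrow> real) \<Rightarrow> complex" where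
  "trace_newton s k z \<equiv> newton_seq s (\<lambda>i. power_trace i z) k"

lemma mat_poly_newton:
  "mat_poly (trace_newton s k) (\<lambda>c e z. s * (\<Sum>r<k. mpow r e c z * trace_newton s (k - 1 - r) z))"
proof (induction k rule: less_induct)
  case (less k)
  show ?case
  proof (cases k)
    case 0
    show ?thesis by (rule mat_poly_cong[OF mat_poly_const[of 1]]) (auto simp: 0)
  next
    case (Suc m)
    have "mat_poly (\<lambda>z. s / of_nat (Suc m) * (\<Sum>i<Suc m. power_trace (Suc i) z * trace_newton s (m - i) z))
      (\<lambda>c e z. s / of_nat (Suc m) * (\<Sum>i<Suc m. (of_nat (Suc i) * mpow (Suc i - 1) e c z) * trace_newton s (m - i) z
        + power_trace (Suc i) z * (s * (\<Sum>r<m - i. mpow r e c z * trace_newton s (m - i - 1 - r) z))))"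
      by (intro mat_poly_cmult mat_poly_sum mat_poly_mult mat_poly_power_trace less.IH) (simp add: Suc)
    then show ?thesis
    proof (rule mat_poly_cong)
      fix z
      show "s / of_nat (Suc m) * (\<Sum>i<Suc m. power_trace (Suc i) z * trace_newton s (m - i) z) = trace_newton s k z"
        using newton_seq_Suc[of m s "\<lambda>i. power_trace i z"] unfolding Suc
        by (simp add: field_simps del: of_nat_Suc)
    next
      fix c e z
      show "s / of_nat (Suc m) * (\<Sum>i<Suc m. (of_nat (Suc i) * mpow (Suc i - 1) e c z) * trace_newton s (m - i) z
          + power_trace (Suc i) z * (s * (\<Sum>r<m - i. mpow r e c z * trace_newton s (m - i - 1 - r) z)))
        = s * (\<Sum>r<k. mpow r e c z * trace_newton s (k - 1 - r) z)"
        using newton_seq_derivation[where m = m and q = "\<lambda>r. mpow r e c z" and s = s and p = "\<lambda>i. power_trace i z"] unfolding Suc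
        by (simp del: of_nat_Suc sum.lessThan_Suc)
    qed
  qed
qed

text \<open>
Integration by parts in each entry of \<open>tr (M M\<^sup>i) F\<close>. Differentiating \<open>M\<^sup>i\<close> splits the trace into
two, and differentiating \<open>F\<close> gives its derivative in the direction \<open>M\<^sup>i\<close>.
\<close>
lemma loop_equation:
  assumes F: "mat_poly F D"
  shows "mean (\<lambda>z. power_trace (Suc i) z * F z)
     = mean (\<lambda>z. (\<Sum>s<i. power_trace s z * power_trace (i - 1 - s) z) * F z
          + (\<Sum>a<n. \<Sum>b<n. mpow i b a z * D b a z))"
    and "integrable (gauss_space d) (\<lambda>z. (\<Sum>s<i. power_trace s z * power_trace (i - 1 - s) z) * F z
          + (\<Sum>a<n. \<Sum>b<n. mpow i b a z * D b a z))"
proof -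
  define G where "G a b z = (\<Sum>s<i. mpow s b b z * mpow (i - 1 - s) a a z) * F z + mpow i b a z * D b a z" for a b z
  have stein: "mean (\<lambda>z. M z $$ (a, b) * (mpow i b a z * F z)) = mean (G a b)"
    "integrable (gauss_space d) (G a b)"
    "integrable (gauss_space d) (\<lambda>z. M z $$ (a, b) * (mpow i b a z * F z))"
    if "a < n" "b < n" for a b
  proof -
    have mp: "mat_poly (\<lambda>z. mpow i b a z * F z)
       (\<lambda>c e z. (\<Sum>s<i. mpow s b c z * mpow (i - 1 - s) e a z) * F z + mpow i b a z * D c e z)"
      by (intro mat_poly_mult mat_poly_mpow that F)
    show "mean (\<lambda>z. M z $$ (a, b) * (mpow i b a z * F z)) = mean (G a b)"
      "integrable (gauss_space d) (G a b)"
      using mat_poly_stein[OF mp that] unfolding G_def .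
    show "integrable (gauss_space d) (\<lambda>z. M z $$ (a, b) * (mpow i b a z * F z))"
      by (rule mat_poly_integrable[OF mat_poly_mult[OF mat_poly_entry[OF that] mp]])
  qed
  have G: "(\<Sum>a<n. \<Sum>b<n. G a b z) = (\<Sum>s<i. power_trace s z * power_trace (i - 1 - s) z) * F z
          + (\<Sum>a<n. \<Sum>b<n. mpow i b a z * D b a z)" for z
  proof -
    have "(\<Sum>a<n. \<Sum>b<n. \<Sum>s<i. mpow s b b z * mpow (i - 1 - s) a a z)
        = (\<Sum>s<i. \<Sum>a<n. \<Sum>b<n. mpow s b b z * mpow (i - 1 - s) a a z)"
      by (simp only: sum.swap[of _ "{..<i}" "{..<n}"])
    also have "\<dots> = (\<Sum>s<i. power_trace s z * power_trace (i - 1 - s) z)"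
      unfolding power_trace_def sum_product by (subst sum.swap) (rule refl)
    finally show ?thesis
      unfolding G_def sum.distrib sum_distrib_right[symmetric] by simp
  qed
  have "power_trace (Suc i) z * F z = (\<Sum>a<n. \<Sum>b<n. M z $$ (a, b) * (mpow i b a z * F z))" for z
    using power_trace_add[of "Suc 0" i z] by (simp add: mpow_1 sum_distrib_left mult_ac)
  then have "mean (\<lambda>z. power_trace (Suc i) z * F z)
      = mean (\<lambda>z. \<Sum>a<n. \<Sum>b<n. M z $$ (a, b) * (mpow i b a z * F z))"
    by (simp only:)
  also have "\<dots> = (\<Sum>a<n. \<Sum>b<n. mean (\<lambda>z. M z $$ (a, b) * (mpow i b a z * F z)))"
    by (rule integral_double_sum) (rule stein(3))
  also have "\<dots> = (\<Sum>a<n. \<Sum>b<n. mean (G a b))"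
    by (intro sum.cong refl stein(1)) auto
  also have "\<dots> = mean (\<lambda>z. \<Sum>a<n. \<Sum>b<n. G a b z)"
    by (rule integral_double_sum[symmetric]) (rule stein(2))
  finally show "mean (\<lambda>z. power_trace (Suc i) z * F z)
     = mean (\<lambda>z. (\<Sum>s<i. power_trace s z * power_trace (i - 1 - s) z) * F z
          + (\<Sum>a<n. \<Sum>b<n. mpow i b a z * D b a z))" by (simp only: G)
  have "integrable (gauss_space d) (\<lambda>z. \<Sum>a<n. \<Sum>b<n. G a b z)"
    by (intro Bochner_Integration.integrable_sum stein) auto
  then show "integrable (gauss_space d) (\<lambda>z. (\<Sum>s<i. power_trace s z * power_trace (i - 1 - s) z) * F z
          + (\<Sum>a<n. \<Sum>b<n. mpow i b a z * D b a z))" by (simp only: G)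
qed
end

section \<open>A recursion that determines the GUE means of hook products\<close>

text \<open>
The equations satisfied by \<open>x j k = E e\<^sub>j h\<^sub>k\<close> and by the mean \<open>t j k\<close> of the mixed term
\<open>hook_sum\<close> for matrices of size \<open>c\<close>. The third and fourth are the loop equations, and the last is
\<open>hook_sum_step\<close>.
\<close>
definition hook_recursion :: "complex \<Rightarrow> (nat \<Rightarrow> nat \<Rightarrow> complex) \<Rightarrow> (nat \<Rightarrow> nat \<Rightarrow> complex) \<Rightarrow> bool" where
  "hook_recursion c x t \<longleftrightarrow> x 0 0 = 1 \<and> (\<forall>k. t 0 k = 0) \<and>
     (\<forall>k. of_nat k * x 0 k
        = (if k < 2 then 0 else (c + of_nat (k - 1)) * (c + of_nat (k - 2)) * x 0 (k - 2))) \<and>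
     (\<forall>j k. of_nat j * x j k
        = - (if j < 2 then 0 else (c - of_nat (j - 1)) * (c - of_nat (j - 2)) * x (j - 2) k) - t j k) \<and>
     (\<forall>j k. t (Suc j) k - t j (Suc k)
        = (if k = 0 then 0 else (c + of_nat (k - 1)) * x j (k - 1))
          - (if j = 0 then 0 else (c - of_nat (j - 1)) * x (j - 1) k))"

text \<open>
Row \<open>j = 0\<close> of \<open>x\<close> is determined by the third equation. The last equation expresses row \<open>j + 1\<close> of
\<open>t\<close> by earlier rows, and then the fourth one gives that row of \<open>x\<close>.
\<close>
lemma hook_recursion_unique:
  assumes "hook_recursion c x t" "hook_recursion c x' t'"
  shows "x j k = x' j k"
proof -
  note r = assms[unfolded hook_recursion_def]
  have x0: "x 0 k = x' 0 k" for k
  proof (induction k rule: less_induct)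
    case (less k)
    show ?case
    proof (cases "k = 0")
      case False
      have "of_nat k * x 0 k = of_nat k * x' 0 k"
        using r less[of "k - 2"] False by (cases "k < 2") simp_all
      with False show ?thesis by simp
    qed (use r in auto)
  qed
  have "t j k = t' j k \<and> x j k = x' j k" for k
  proof (induction j arbitrary: k rule: less_induct)
    case (less j)
    show ?case
    proof (cases j)
      case 0
      then show ?thesis using x0 r by simp
    next
      case (Suc i)
      have t: "t j k = t' j k"
      proof -
        have e: "t (Suc i) k - t i (Suc k)
            = (if k = 0 then 0 else (c + of_nat (k - 1)) * x i (k - 1))
              - (if i = 0 then 0 else (c - of_nat (i - 1)) * x (i - 1) k)"
          using assms(1) unfolding hook_recursion_def by blast
        have e': "t' (Suc i) k - t' i (Suc k)
            = (if k = 0 then 0 else (c + of_nat (k - 1)) * x' i (k - 1))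
              - (if i = 0 then 0 else (c - of_nat (i - 1)) * x' (i - 1) k)"
          using assms(2) unfolding hook_recursion_def by blast
        have ih: "x i (k - 1) = x' i (k - 1)" "x (i - 1) k = x' (i - 1) k" "t i (Suc k) = t' i (Suc k)"
          using less[of i] less[of "i - 1"] Suc by auto
        have "t (Suc i) k - t' i (Suc k) = t' (Suc i) k - t' i (Suc k)"
          using e unfolding e' ih .
        then show ?thesis using Suc by simp
      qed
      have "of_nat j * x j k = of_nat j * x' j k"
        using r less[of "j - 2"] t by (cases "j < 2") simp_all
      with t Suc show ?thesis by (simp del: of_nat_Suc)
    qed
  qed
  then show ?thesis by simp
qed

lemma binomial_Suc_absorb_real:
  "real (Suc k) * real (m + Suc k choose Suc k) = real (Suc (m + k)) * real (m + k choose k)"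
  using Suc_times_binomial[of k "m + k"] by (metis add_Suc_right of_nat_mult)

lemma binomial_Suc_right_real:
  "real (Suc j) * real (m choose Suc j) = (real m - real j) * real (m choose j)"
proof (cases "j \<le> m")
  case True
  have "Suc j * (m choose Suc j) = (m - j) * (m choose j)"
    using binomial_absorb_comp[of m j] binomial_absorption[of j "m"] by (simp add: mult.commute)
  then show ?thesis using True by (metis of_nat_mult of_nat_diff)
qed (simp add: binomial_eq_0)

abbreviation hermite_at_0 :: "nat \<Rightarrow> real" where
  "hermite_at_0 j \<equiv> poly (monic_hermite j) 0"

lemma hermite_at_0_Suc_Suc: "hermite_at_0 (Suc (Suc j)) = - real (Suc j) * hermite_at_0 j"
  by (simp add: monic_hermite_recurrence algebra_simps)

lemma hermite_at_0_1 [simp]: "hermite_at_0 (Suc 0) = 0"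
  by (simp add: monic_hermite.simps(2) pderiv_1)

text \<open>
Shifting \<open>j\<close> in \<open>(m choose j) He\<^sub>j(0)\<close>, the coefficient of \<open>x\<^sup>m\<^sup>-\<^sup>j\<close> in \<open>He\<^sub>m\<close>, aligns it with
the coefficient \<open>(m + 1 choose j) He\<^sub>j(0)\<close> of \<open>x\<^sup>m\<^sup>+\<^sup>1\<^sup>-\<^sup>j\<close> in \<open>He\<^sub>m\<^sub>+\<^sub>1\<close>.
\<close>
definition hook_coeff :: "nat \<Rightarrow> nat \<Rightarrow> real" where
  "hook_coeff m j = (if j = 0 then 0 else real (m choose (j - 1)) * hermite_at_0 (j - 1))"
text \<open>
The value of \<open>E e\<^sub>j h\<^sub>k\<close> for size \<open>n = m + 1\<close>. The formula comes from \<open>k! h\<^sub>k = E (v\<^sup>* M v)\<^sup>k\<close>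
for a standard complex Gaussian vector \<open>v\<close>: by unitary invariance \<open>v\<close> may be rotated to a multiple of a
unit vector, \<open>E |v|\<^sup>2\<^sup>k / k!\<close> is the binomial coefficient, and what remains is the mean of
\<open>det (z - M) g\<^sup>k\<close> for one diagonal entry \<open>g\<close>. The determinant is affine in \<open>g\<close>, and its two
coefficients have the means \<open>He\<^sub>n(z)\<close> and \<open>- He\<^sub>m(z)\<close>. The lemmas below verify the formula directly
from the recursion.
\<close>
definition hook_mean :: "nat \<Rightarrow> nat \<Rightarrow> nat \<Rightarrow> real" where
  "hook_mean m j k = real (m + k choose k) *
     (real (Suc m choose j) * hermite_at_0 j * gauss_moment k - hook_coeff m j * gauss_moment (Suc k))"
definition hook_sum_mean :: "nat \<Rightarrow> nat \<Rightarrow> nat \<Rightarrow> real" where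
  "hook_sum_mean m j k = real (m + k choose k) * hook_coeff m j * gauss_moment (Suc k)"

text \<open>
For \<open>j = 0\<close> only the factor \<open>gauss_moment k\<close> and the binomial coefficient remain.
\<close>
lemma hook_mean_step_h: 
  "real k * hook_mean m 0 k = (if k < 2 then 0 else
     (real (Suc m) + real (k - 1)) * (real (Suc m) + real (k - 2)) * hook_mean m 0 (k - 2))"
proof -
  consider "k = 0" | "k = 1" | i where "k = Suc (Suc i)" by (metis One_nat_def not0_implies_Suc)
  then show ?thesis
  proof cases
    case 3
    have "real k * hook_mean m 0 k
        = real (Suc (Suc i)) * real (m + Suc (Suc i) choose Suc (Suc i)) * (real (Suc i) * gauss_moment i)"
      by (simp add: hook_mean_def hook_coeff_def 3 gauss_moment_Suc_Suc del: binomial_Suc_Suc)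
    also have "\<dots> = real (Suc (m + Suc i)) * (real (Suc i) * real (m + Suc i choose Suc i)) * gauss_moment i"
      unfolding binomial_Suc_absorb_real[of "Suc i"] by (simp only: mult_ac)
    also have "\<dots> = real (Suc (m + Suc i)) * real (Suc (m + i)) * (real (m + i choose i) * gauss_moment i)"
      unfolding binomial_Suc_absorb_real by (simp only: mult_ac)
    finally show ?thesis by (simp add: 3 hook_mean_def hook_coeff_def algebra_simps)
  qed (simp_all add: hook_mean_def hook_coeff_def)
qed

text \<open>
The coefficients of \<open>He\<^sub>n\<close> and \<open>He\<^sub>m\<close> satisfy two-step recursions in \<open>j\<close>, which amount to Hermite's
equation at the level of coefficients. In front of the shifted coefficient the factor is
\<open>j = (j - 1) + 1\<close>, and the last summand leaves the mixed term.
\<close>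
lemma hook_mean_step_e:
  "real j * hook_mean m j k = - (if j < 2 then 0 else
      (real (Suc m) - real (j - 1)) * (real (Suc m) - real (j - 2)) * hook_mean m (j - 2) k)
      - hook_sum_mean m j k"
proof -
  consider "j = 0" | "j = 1" | "j = 2" | i where "j = Suc (Suc (Suc i))"
    by (metis One_nat_def not0_implies_Suc numeral_2_eq_2)
  then show ?thesis
  proof cases
    case 3
    have "real (Suc m choose 2) * 2 = real (Suc m) * real m"
      using binomial_Suc_right_real[of 1 "Suc m"] by (simp add: numeral_2_eq_2 algebra_simps)
    then have "real (Suc m choose 2) * 2 * X = real (Suc m) * real m * X" for X by simp
    from this[of "gauss_moment k * real (m + k choose k)"] show ?thesis
      using hermite_at_0_Suc_Suc[of 0] by (simp add: 3 hook_mean_def hook_sum_mean_def hook_coeff_def numeral_2_eq_2 algebra_simps)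
  next
    case (4 i)
    define c where "c = real (m + k choose k)"
    have a: "real (Suc (Suc (Suc i))) * real (Suc m choose Suc (Suc (Suc i)))
        * hermite_at_0 (Suc (Suc (Suc i)))
      = - ((real (Suc m) - real (Suc (Suc i))) * (real (Suc m) - real (Suc i))
           * (real (Suc m choose Suc i) * hermite_at_0 (Suc i)))"
    proof -
      have "P * y * (- s * v) = - (P * Q * (w * v))" if "s * y = Q * w" for P y s v Q w :: real
        using arg_cong[OF that, of "\<lambda>t. P * t * v"] by (simp add: algebra_simps)
      from this[OF binomial_Suc_right_real[of "Suc i" "Suc m"]] show ?thesis
        unfolding hermite_at_0_Suc_Suc binomial_Suc_right_real[of "Suc (Suc i)"] .
    qed
    have b: "real (Suc (Suc i)) * (real (m choose Suc (Suc i)) * hermite_at_0 (Suc (Suc i)))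
      = - ((real (Suc m) - real (Suc (Suc i))) * (real (Suc m) - real (Suc i))
           * (real (m choose i) * hermite_at_0 i))"
    proof -
      have "s * (y * (- s' * v)) = - (P * Q * (w' * v))"
        if "s * y = P * w" "s' * w = Q * w'" for s s' y v P Q w w' :: real
      proof -
        have "s * (y * (- s' * v)) = - ((s * y) * s' * v)" by simp
        also have "\<dots> = - (P * (s' * w) * v)" unfolding that(1) by (simp add: mult_ac)
        also have "\<dots> = - (P * Q * (w' * v))" unfolding that(2) by (simp add: mult_ac)
        finally show ?thesis .
      qed
      from this[OF binomial_Suc_right_real binomial_Suc_right_real] show ?thesis
        unfolding hermite_at_0_Suc_Suc by simp
    qed
    have jj: "real j = real (Suc (Suc i)) + 1" using 4 by simp
    have idx: "j - 1 = Suc (Suc i)" "j - 2 = Suc i" "j \<noteq> 0" "\<not> j < 2" "Suc i \<noteq> 0" "Suc i - 1 = i"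
      using 4 by simp_all
    have comb: "(J + 1) * (c * (X * g - Y * g')) = - (Q * (c * (X' * g - Y' * g'))) - c * Y * g'"
      if "(J + 1) * X = - (Q * X')" "J * Y = - (Q * Y')" for J X Y Q X' Y' g g' :: real
    proof -
      have "(J + 1) * (c * (X * g - Y * g')) = c * g * ((J + 1) * X) - c * g' * (J * Y) - c * Y * g'"
        by (simp add: algebra_simps)
      then show ?thesis unfolding that by (simp add: algebra_simps)
    qed
    have a': "(real (Suc (Suc i)) + 1) * (real (Suc m choose j) * hermite_at_0 j)
      = - ((real (Suc m) - real (Suc (Suc i))) * (real (Suc m) - real (Suc i))
           * (real (Suc m choose Suc i) * hermite_at_0 (Suc i)))"
      using a unfolding jj[symmetric] 4 by (simp only: mult.assoc)
    show ?thesis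
      using comb[OF a' b]
      unfolding hook_mean_def hook_sum_mean_def hook_coeff_def idx if_False c_def[symmetric]
      by (simp only: idx simp_thms if_False jj)
  qed (simp_all add: hook_mean_def hook_sum_mean_def hook_coeff_def)
qed

text \<open>
Comparing the coefficients of the two moments \<open>gauss_moment (k - 1)\<close> and \<open>gauss_moment k\<close> leaves
\<open>He\<^sub>n' = n He\<^sub>m\<close> (fact \<open>d\<close>) and \<open>He\<^sub>n = x He\<^sub>m - He\<^sub>m'\<close> (fact \<open>r\<close>), both read off at coefficients.
\<close>
lemma hook_mean_step_mixed:
  "hook_sum_mean m (Suc j) k - hook_sum_mean m j (Suc k)
     = (if k = 0 then 0 else (real (Suc m) + real (k - 1)) * hook_mean m j (k - 1))
       - (if j = 0 then 0 else (real (Suc m) - real (j - 1)) * hook_mean m (j - 1) k)"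
proof -
  define A where "A = real (m choose j) * hermite_at_0 j"
  define B where "B = hook_coeff m j"
  have cS: "hook_coeff m (Suc j) = A" by (simp add: hook_coeff_def A_def)
  have d: "(real (Suc m) - real (j - 1)) * (real (Suc m choose (j - 1)) * hermite_at_0 (j - 1)) = real (Suc m) * B" if "j \<noteq> 0"
  proof -
    from that obtain i where i: "j = Suc i" using not0_implies_Suc by blast
    have "(real (Suc m) - real i) * real (Suc m choose i) = real (Suc i) * real (Suc m choose Suc i)"
      by (rule binomial_Suc_right_real[symmetric])
    also have "\<dots> = real (Suc m) * real (m choose i)"
      using Suc_times_binomial[of i m] by (metis of_nat_mult)
    finally show ?thesis by (simp add: i B_def hook_coeff_def)
  qed
  have r: "A = real (Suc m choose j) * hermite_at_0 j
      + (if j = 0 then 0 else (real (Suc m) - real (j - 1)) * hook_coeff m (j - 1))"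
  proof -
    consider "j = 0" | "j = 1" | i where "j = Suc (Suc i)" by (metis One_nat_def not0_implies_Suc)
    then show ?thesis
    proof cases
      case (3 i)
      have "real (Suc i) * real (m choose Suc i) * hermite_at_0 i
          = (real m - real i) * real (m choose i) * hermite_at_0 i"
        by (simp only: binomial_Suc_right_real)
      moreover have "real (Suc m choose Suc (Suc i)) = real (m choose Suc i) + real (m choose Suc (Suc i))"
        by simp
      ultimately show ?thesis
        unfolding A_def 3 hermite_at_0_Suc_Suc by (simp add: hook_coeff_def algebra_simps del: binomial_Suc_Suc)
    qed (simp_all add: A_def hook_coeff_def)
  qed
  define R where "R = (if j = 0 then 0 else (real (Suc m) - real (j - 1)) * hook_coeff m (j - 1))"
  define a where "a = real (Suc m choose j) * hermite_at_0 j"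
  have A: "A = a + R" using r by (simp only: a_def R_def)
  define c where "c = real (m + k choose k)"
  have prev: "(if j = 0 then 0 else (real (Suc m) - real (j - 1)) * hook_mean m (j - 1) k)
      = c * (real (Suc m) * B * gauss_moment k - R * gauss_moment (Suc k))"
  proof (cases "j = 0")
    case False
    have "(real (Suc m) - real (j - 1)) * hook_mean m (j - 1) k
      = c * ((real (Suc m) - real (j - 1)) * (real (Suc m choose (j - 1)) * hermite_at_0 (j - 1)) * gauss_moment k
        - (real (Suc m) - real (j - 1)) * hook_coeff m (j - 1) * gauss_moment (Suc k))"
      by (simp only: hook_mean_def c_def right_diff_distrib mult_ac)
    with False show ?thesis by (simp only: d[OF False] R_def if_False)
  qed (simp add: B_def hook_coeff_def R_def)
  show ?thesis
  proof (cases k)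
    case 0
    show ?thesis
      unfolding prev by (simp add: hook_sum_mean_def cS B_def[symmetric] 0 c_def A gauss_moment_Suc_Suc algebra_simps)
  next
    case (Suc i)
    define c' where "c' = real (m + i choose i)"
    have c: "real (Suc i) * c = real (Suc (m + i)) * c'"
      unfolding c_def c'_def Suc by (rule binomial_Suc_absorb_real)
    have c2: "real (Suc (Suc i)) * real (m + Suc (Suc i) choose Suc (Suc i)) = real (Suc (m + Suc i)) * c"
      unfolding c_def Suc by (rule binomial_Suc_absorb_real)
    have "hook_sum_mean m (Suc j) k = (real (Suc i) * c) * (A * gauss_moment i)"
      by (simp only: hook_sum_mean_def cS Suc[symmetric] c_def[symmetric]) (simp add: Suc gauss_moment_Suc_Suc)
    moreover have "hook_sum_mean m j (Suc k)
        = (real (Suc (Suc i)) * real (m + Suc (Suc i) choose Suc (Suc i))) * (B * gauss_moment (Suc i))"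
      by (simp only: hook_sum_mean_def Suc B_def[symmetric] gauss_moment_Suc_Suc mult_ac)
    ultimately have L: "hook_sum_mean m (Suc j) k - hook_sum_mean m j (Suc k)
        = real (Suc (m + i)) * c' * (A * gauss_moment i) - real (Suc (m + Suc i)) * c * (B * gauss_moment (Suc i))"
      by (simp only: c c2)
    have k: "k - 1 = i" "k \<noteq> 0" using Suc by simp_all
    have "real (Suc (m + i)) * hook_mean m j i
        = real (Suc (m + i)) * c' * (a * gauss_moment i) - (real (Suc i) * c) * (B * gauss_moment (Suc i))"
      unfolding c hook_mean_def c'_def[symmetric] a_def[symmetric] B_def[symmetric]
      by (simp only: right_diff_distrib mult_ac)
    moreover have "c * (real (Suc m) * B * gauss_moment k - R * gauss_moment (Suc k))
        = c * (real (Suc m) * B * gauss_moment (Suc i)) - (real (Suc i) * c) * (R * gauss_moment i)"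
      by (simp only: Suc gauss_moment_Suc_Suc right_diff_distrib mult_ac)
    moreover have "B * (c * (gauss_moment (Suc i) * real (Suc i)))
        = B * (c' * (gauss_moment (Suc i) * real (Suc (i + m))))"
      using arg_cong[OF c, of "\<lambda>t. B * gauss_moment (Suc i) * t"] by (simp only: mult_ac add.commute)
    moreover have "real (Suc m) + real i = real (Suc (m + i))"
      "real (Suc (m + Suc i)) = real (Suc m) + real (Suc i)" by simp_all
    ultimately show ?thesis
      unfolding prev L k c A by (simp only: k simp_thms if_False c) (simp only: algebra_simps)
  qed
qed

section \<open>The GUE means satisfy the recursion\<close>

lemma newton_seq_quadratic_total:
  assumes "s * s = 1"
  shows "(\<Sum>i<j. (\<Sum>a<i. p a * p (i - 1 - a)) * newton_seq s p (j - 1 - i)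
            + s * (\<Sum>r<j - 1 - i. p (i + r) * newton_seq s p (j - 1 - i - 1 - r)))
       = (if j < 2 then 0 else
           (p 0 + s * of_nat (j - 1)) * (p 0 + s * of_nat (j - 2)) * newton_seq s p (j - 2))"
proof -
  consider "j = 0" | "j = 1" | m where "j = Suc (Suc m)" by (metis One_nat_def not0_implies_Suc)
  then show ?thesis
  proof cases
    case (3 m)
    show ?thesis using newton_seq_quadratic[OF assms, where m = m and p = p] unfolding 3
      by (simp del: sum.lessThan_Suc)
  qed simp_all
qed

context gue_basis
begin

text \<open>
Newton's identity writes the \<open>j\<close>-th term as a sum of traces \<open>tr M\<^sup>i\<^sup>+\<^sup>1\<close> times earlier terms, each of
which is integrated by parts. The contributions without derivatives of \<open>g\<close> collapse by
\<open>newton_seq_quadratic\<close>.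
\<close>
lemma newton_loop_equation:
  assumes s: "s * s = 1" and g: "mat_poly g (\<lambda>c e z. \<Sum>r<k. mpow r e c z * G r z)"
  shows "of_nat j * mean (\<lambda>z. trace_newton s j z * g z)
    = s * ((if j < 2 then 0 else (of_nat n + s * of_nat (j - 1)) * (of_nat n + s * of_nat (j - 2))
              * mean (\<lambda>z. trace_newton s (j - 2) z * g z))
           + mean (\<lambda>z. \<Sum>i<j. \<Sum>r<k. power_trace (i + r) z * trace_newton s (j - 1 - i) z * G r z))"
proof -
  define D where "D i b a z = (s * (\<Sum>r<j - 1 - i. mpow r a b z * trace_newton s (j - 1 - i - 1 - r) z)) * g z
      + trace_newton s (j - 1 - i) z * (\<Sum>r<k. mpow r a b z * G r z)" for i b a z
  define L where "L i z = (\<Sum>a<i. power_trace a z * power_trace (i - 1 - a) z) * (trace_newton s (j - 1 - i) z * g z)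
      + (\<Sum>a<n. \<Sum>b<n. mpow i b a z * D i b a z)" for i z
  define T where "T z = (\<Sum>i<j. \<Sum>r<k. power_trace (i + r) z * trace_newton s (j - 1 - i) z * G r z)" for z
  define Q where "Q = (if j < 2 then 0 else (of_nat n + s * of_nat (j - 1)) * (of_nat n + s * of_nat (j - 2)))"
  have F: "mat_poly (\<lambda>z. trace_newton s (j - 1 - i) z * g z) (D i)" for i
    unfolding D_def by (intro mat_poly_mult mat_poly_newton g)
  have loop: "mean (\<lambda>z. power_trace (Suc i) z * (trace_newton s (j - 1 - i) z * g z)) = mean (L i)"
    "integrable (gauss_space d) (L i)" for i
    using loop_equation[OF F[of i], of i] by (simp_all only: L_def[abs_def])
  have ng: "integrable (gauss_space d) (\<lambda>z. trace_newton s i z * g z)" for i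
    by (rule mat_poly_integrable[OF mat_poly_mult[OF mat_poly_newton g]])
  have pw: "(\<Sum>a<n. \<Sum>b<n. mpow i b a z * D i b a z)
      = (s * (\<Sum>r<j - 1 - i. power_trace (i + r) z * trace_newton s (j - 1 - i - 1 - r) z)) * g z
        + (\<Sum>r<k. power_trace (i + r) z * trace_newton s (j - 1 - i) z * G r z)" for i z
  proof -
    have pt: "(\<Sum>a<n. \<Sum>b<n. mpow i b a z * (\<Sum>r<K. mpow r a b z * f r)) = (\<Sum>r<K. power_trace (i + r) z * f r)"
      for K :: nat and f :: "nat \<Rightarrow> complex"
    proof -
      have "(\<Sum>a<n. \<Sum>b<n. mpow i b a z * (\<Sum>r<K. mpow r a b z * f r))
          = (\<Sum>b<n. \<Sum>a<n. \<Sum>r<K. mpow i b a z * mpow r a b z * f r)"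
        by (subst sum.swap) (simp add: sum_distrib_left mult.assoc)
      also have "\<dots> = (\<Sum>b<n. \<Sum>r<K. \<Sum>a<n. mpow i b a z * mpow r a b z * f r)"
        by (rule sum.cong[OF refl], rule sum.swap)
      also have "\<dots> = (\<Sum>r<K. \<Sum>b<n. \<Sum>a<n. mpow i b a z * mpow r a b z * f r)"
        by (rule sum.swap)
      also have "\<dots> = (\<Sum>r<K. power_trace (i + r) z * f r)"
        by (simp only: power_trace_add sum_distrib_right)
      finally show ?thesis .
    qed
    have "(\<Sum>a<n. \<Sum>b<n. mpow i b a z * D i b a z)
        = (\<Sum>a<n. \<Sum>b<n. mpow i b a z * (\<Sum>r<j - 1 - i. mpow r a b z * trace_newton s (j - 1 - i - 1 - r) z)) * (s * g z)
          + (\<Sum>a<n. \<Sum>b<n. mpow i b a z * (\<Sum>r<k. mpow r a b z * G r z)) * trace_newton s (j - 1 - i) z"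
      unfolding D_def distrib_left sum.distrib sum_distrib_right[of _ "{..<n}"]
      by (simp only: mult_ac)
    then show ?thesis unfolding pt by (simp add: sum_distrib_left sum_distrib_right mult_ac)
  qed
  have total: "(\<Sum>i<j. L i z) = Q * (trace_newton s (j - 2) z * g z) + T z" for z
  proof -
    have "(\<Sum>i<j. L i z) = (\<Sum>i<j. (\<Sum>a<i. power_trace a z * power_trace (i - 1 - a) z) * trace_newton s (j - 1 - i) z
            + s * (\<Sum>r<j - 1 - i. power_trace (i + r) z * trace_newton s (j - 1 - i - 1 - r) z)) * g z + T z"
      unfolding L_def pw T_def sum_distrib_right[of _ "{..<j}"] sum.distrib[symmetric]
      by (intro sum.cong refl) (simp only: distrib_right mult.assoc add.assoc)
    then show ?thesis
      unfolding newton_seq_quadratic_total[OF s, of "\<lambda>i. power_trace i z"] by (simp add: Q_def power_trace_0)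
  qed
  have int_L: "integrable (gauss_space d) (L i)" for i by (rule loop(2))
  have int_T: "integrable (gauss_space d) T"
  proof -
    have "integrable (gauss_space d) (\<lambda>z. (\<Sum>i<j. L i z) - Q * (trace_newton s (j - 2) z * g z))"
      by (intro Bochner_Integration.integrable_diff Bochner_Integration.integrable_sum integrable_mult_right int_L ng)
    then show ?thesis unfolding total by simp
  qed
  have int_p: "integrable (gauss_space d) (\<lambda>z. power_trace (Suc i) z * (trace_newton s (j - 1 - i) z * g z))" for i
    by (rule mat_poly_integrable[OF mat_poly_mult[OF mat_poly_power_trace F]])
  have "of_nat j * mean (\<lambda>z. trace_newton s j z * g z) = mean (\<lambda>z. of_nat j * trace_newton s j z * g z)"
    by (simp add: mult.assoc)
  also have "\<dots> = mean (\<lambda>z. s * (\<Sum>i<j. power_trace (Suc i) z * (trace_newton s (j - 1 - i) z * g z)))"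
    unfolding newton_seq_mult by (simp only: sum_distrib_right mult.assoc)
  also have "\<dots> = s * (\<Sum>i<j. mean (\<lambda>z. power_trace (Suc i) z * (trace_newton s (j - 1 - i) z * g z)))"
    by (subst integral_mult_right_zero, subst Bochner_Integration.integral_sum) (use int_p in auto)
  also have "\<dots> = s * mean (\<lambda>z. \<Sum>i<j. L i z)"
    by (simp only: loop(1)) (subst Bochner_Integration.integral_sum, use int_L in auto)
  also have "\<dots> = s * (Q * mean (\<lambda>z. trace_newton s (j - 2) z * g z) + mean T)"
    unfolding total by (simp add: ng int_T)
  finally show ?thesis unfolding T_def Q_def by simp
qed

lemma hook_recursion_means:
  "hook_recursion (of_nat n) (\<lambda>j k. mean (\<lambda>z. trace_newton (-1) j z * trace_newton 1 k z))
     (\<lambda>j k. mean (\<lambda>z. hook_sum (\<lambda>i. power_trace i z) j k))"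
  unfolding hook_recursion_def
proof (intro conjI allI)
  interpret prob_space "gauss_space d" by (rule prob_space_gauss_space)
  show "mean (\<lambda>z. trace_newton (- 1) 0 z * trace_newton 1 0 z) = 1" by (simp add: prob_space)
next
  fix k show "mean (\<lambda>z. hook_sum (\<lambda>i. power_trace i z) 0 k) = 0" by simp
next
  fix k
  have g: "mat_poly (\<lambda>z. 1) (\<lambda>c e z. \<Sum>r<0. mpow r e c z * 0)"
    using mat_poly_const[of 1] by simp
  show "of_nat k * mean (\<lambda>z. trace_newton (- 1) 0 z * trace_newton 1 k z) = (if k < 2 then 0 else
      (of_nat n + of_nat (k - 1)) * (of_nat n + of_nat (k - 2)) * mean (\<lambda>z. trace_newton (- 1) 0 z * trace_newton 1 (k - 2) z))"
    using newton_loop_equation[OF _ g, of 1 k] by simp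
next
  fix j k
  have g: "mat_poly (trace_newton 1 k) (\<lambda>c e z. \<Sum>r<k. mpow r e c z * trace_newton 1 (k - 1 - r) z)"
    using mat_poly_newton[of 1 k] by simp
  have T: "(\<Sum>i<j. \<Sum>r<k. power_trace (i + r) z * trace_newton (-1) (j - 1 - i) z * trace_newton 1 (k - 1 - r) z)
      = hook_sum (\<lambda>i. power_trace i z) j k" for z
    unfolding hook_sum_def by (subst sum.swap) (simp add: add.commute)
  show "of_nat j * mean (\<lambda>z. trace_newton (- 1) j z * trace_newton 1 k z) = - (if j < 2 then 0 else
      (of_nat n - of_nat (j - 1)) * (of_nat n - of_nat (j - 2)) * mean (\<lambda>z. trace_newton (- 1) (j - 2) z * trace_newton 1 k z))
      - mean (\<lambda>z. hook_sum (\<lambda>i. power_trace i z) j k)"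
    using newton_loop_equation[OF _ g, of "-1" j] unfolding T
    by (cases "j < 2") (simp_all add: algebra_simps)
next
  fix j k
  have int: "integrable (gauss_space d) (\<lambda>z. trace_newton (-1) j z * trace_newton 1 k z)" for j k
    by (rule mat_poly_integrable[OF mat_poly_mult[OF mat_poly_newton mat_poly_newton]])
  have int_T: "integrable (gauss_space d) (\<lambda>z. hook_sum (\<lambda>i. power_trace i z) j k)" for j k
    unfolding hook_sum_def
    by (intro Bochner_Integration.integrable_sum
        mat_poly_integrable[OF mat_poly_mult[OF mat_poly_mult[OF mat_poly_power_trace mat_poly_newton] mat_poly_newton]])
  have "mean (\<lambda>z. hook_sum (\<lambda>i. power_trace i z) (Suc j) k) - mean (\<lambda>z. hook_sum (\<lambda>i. power_trace i z) j (Suc k))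
     = mean (\<lambda>z. hook_sum (\<lambda>i. power_trace i z) (Suc j) k - hook_sum (\<lambda>i. power_trace i z) j (Suc k))"
    by (simp add: int_T)
  also have "\<dots> = (if k = 0 then 0 else (of_nat n + of_nat (k - 1)) * mean (\<lambda>z. trace_newton (- 1) j z * trace_newton 1 (k - 1) z))
      - (if j = 0 then 0 else (of_nat n - of_nat (j - 1)) * mean (\<lambda>z. trace_newton (- 1) (j - 1) z * trace_newton 1 k z))"
    unfolding hook_sum_step power_trace_0 using int by (cases "j = 0"; cases "k = 0") simp_all
  finally show "mean (\<lambda>z. hook_sum (\<lambda>i. power_trace i z) (Suc j) k) - mean (\<lambda>z. hook_sum (\<lambda>i. power_trace i z) j (Suc k))
     = (if k = 0 then 0 else (of_nat n + of_nat (k - 1)) * mean (\<lambda>z. trace_newton (- 1) j z * trace_newton 1 (k - 1) z))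
      - (if j = 0 then 0 else (of_nat n - of_nat (j - 1)) * mean (\<lambda>z. trace_newton (- 1) (j - 1) z * trace_newton 1 k z))" .
qed

end

lemma hook_recursion_hook_mean:
  "hook_recursion (of_nat (Suc m)) (\<lambda>j k. complex_of_real (hook_mean m j k))
     (\<lambda>j k. complex_of_real (hook_sum_mean m j k))"
  unfolding hook_recursion_def
proof (intro conjI allI)
  fix j k
  show "of_nat k * complex_of_real (hook_mean m 0 k) = (if k < 2 then 0 else (of_nat (Suc m) + of_nat (k - 1))
      * (of_nat (Suc m) + of_nat (k - 2)) * complex_of_real (hook_mean m 0 (k - 2)))"
    using arg_cong[OF hook_mean_step_h[of k m], of complex_of_real] by (cases "k < 2") simp_all
  show "of_nat j * complex_of_real (hook_mean m j k) = - (if j < 2 then 0 else (of_nat (Suc m) - of_nat (j - 1))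
      * (of_nat (Suc m) - of_nat (j - 2)) * complex_of_real (hook_mean m (j - 2) k)) - complex_of_real (hook_sum_mean m j k)"
    using arg_cong[OF hook_mean_step_e[of j m k], of complex_of_real] by (cases "j < 2") simp_all
  show "complex_of_real (hook_sum_mean m (Suc j) k) - complex_of_real (hook_sum_mean m j (Suc k))
     = (if k = 0 then 0 else (of_nat (Suc m) + of_nat (k - 1)) * complex_of_real (hook_mean m j (k - 1)))
       - (if j = 0 then 0 else (of_nat (Suc m) - of_nat (j - 1)) * complex_of_real (hook_mean m (j - 1) k))"
    using arg_cong[OF hook_mean_step_mixed[of m j k], of complex_of_real] by (cases "j = 0"; cases "k = 0") simp_all
qed (simp_all add: hook_mean_def hook_sum_mean_def hook_coeff_def)

definition gue_moment :: "nat \<Rightarrow> nat \<Rightarrow> real" where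
  "gue_moment m i = (\<Sum>j\<le>i. (real (Suc m) - real j) * hook_mean m j (i - j))"

lemma (in gue_basis) mean_power_trace:
  assumes "n = Suc m"
  shows "mean (power_trace i) = complex_of_real (gue_moment m i)"
    and "integrable (gauss_space d) (power_trace i)"
proof -
  have int: "integrable (gauss_space d) (\<lambda>z. trace_newton (-1) j z * trace_newton 1 k z)" for j k
    by (rule mat_poly_integrable[OF mat_poly_mult[OF mat_poly_newton mat_poly_newton]])
  have x: "mean (\<lambda>z. trace_newton (-1) j z * trace_newton 1 k z) = complex_of_real (hook_mean m j k)" for j k
    by (rule hook_recursion_unique[OF hook_recursion_means hook_recursion_hook_mean[of m, folded assms]])
  have "power_trace i z = (\<Sum>j\<le>i. (of_nat n - of_nat j) * (trace_newton (-1) j z * trace_newton 1 (i - j) z))" for z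
    using power_sum_eq_hooks[of "\<lambda>i. power_trace i z" i] by (simp add: power_trace_0)
  then have "mean (power_trace i) = (\<Sum>j\<le>i. (of_nat n - of_nat j) * mean (\<lambda>z. trace_newton (-1) j z * trace_newton 1 (i - j) z))"
    by (simp add: Bochner_Integration.integral_sum int)
  then show "mean (power_trace i) = complex_of_real (gue_moment m i)"
    unfolding x by (simp add: gue_moment_def assms)
  show "integrable (gauss_space d) (power_trace i)"
    by (rule mat_poly_integrable[OF mat_poly_power_trace])
qed

section \<open>Moments of the density\<close>

text \<open>
Since \<open>He\<^sub>n' = n He\<^sub>n\<^sub>-\<^sub>1\<close>, the Taylor coefficients at \<open>0\<close> are values of lower Hermite polynomials
at \<open>0\<close>.
\<close>
lemma coeff_monic_hermite:
  "coeff (monic_hermite n) k = real (n choose k) * hermite_at_0 (n - k)"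
proof (induction n arbitrary: k)
  case 0
  show ?case by (cases k) simp_all
next
  case (Suc n)
  show ?case
  proof (cases k)
    case 0
    then show ?thesis by (simp add: poly_0_coeff_0)
  next
    case (Suc i)
    have "real (Suc i) * coeff (monic_hermite (Suc n)) (Suc i) = coeff (pderiv (monic_hermite (Suc n))) i"
      by (simp add: coeff_pderiv)
    also have "\<dots> = real (Suc n) * (real (n choose i) * hermite_at_0 (n - i))"
      by (simp only: pderiv_monic_hermite_Suc coeff_smult Suc.IH)
    also have "\<dots> = real (Suc i) * (real (Suc n choose Suc i) * hermite_at_0 (n - i))"
      using Suc_times_binomial[of i n] by (metis (no_types) mult.assoc of_nat_mult)
    finally show ?thesis using Suc by (simp del: of_nat_Suc binomial_Suc_Suc)
  qed
qed

text \<open>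
Integrating by parts \<open>n\<close> times moves all derivatives to the monomial.
\<close>
lemma gauss_integral_monom_hermite:
  "gauss_integral (Polynomial.monom 1 p * monic_hermite n)
     = (if n \<le> p then fact p / fact (p - n) * gauss_moment (p - n) else 0)"
proof (induction n arbitrary: p)
  case 0
  show ?case by (simp add: gauss_integral_monom)
next
  case (Suc n)
  have "gauss_integral (Polynomial.monom 1 p * monic_hermite (Suc n))
      = gauss_integral (pderiv (Polynomial.monom 1 p * monic_hermite n) - Polynomial.monom 1 p * pderiv (monic_hermite n))"
    by (simp only: monic_hermite.simps(2) right_diff_distrib gauss_integral_diff mult_pCons_right smult_0_left
        add_0_left gauss_integral_by_parts)
  also have "\<dots> = gauss_integral (Polynomial.smult (real p) (Polynomial.monom 1 (p - 1) * monic_hermite n))"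
    by (simp add: pderiv_mult pderiv_monom smult_monom[symmetric] mult.commute[of "pderiv _"] flip: mult_smult_left)
       (simp add: smult_monom mult.commute)
  also have "\<dots> = real p * gauss_integral (Polynomial.monom 1 (p - 1) * monic_hermite n)"
    by (rule gauss_integral_smult)
  also have "\<dots> = (if Suc n \<le> p then fact p / fact (p - Suc n) * gauss_moment (p - Suc n) else 0)"
  proof (cases p)
    case (Suc q)
    then show ?thesis unfolding Suc.IH by (simp add: add_divide_distrib algebra_simps)
  qed simp
  finally show ?case .
qed

text \<open>
Expanding the derivative in each of the two products of the Wronskian in monomials, and integrating these
against the other factor, gives the two parts of \<open>hook_mean\<close> term by term.
\<close>
lemma gue_density_moment:
  "has_bochner_integral lborel (\<lambda>x. x ^ i * gue_density m x) (gue_moment m i)"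
proof -
  let ?H = monic_hermite
  let ?X = "\<lambda>k. Polynomial.monom (1::real) k"
  define A where "A = ?X i * (pderiv (?H (Suc m)) * ?H m)"
  define B where "B = ?X i * (?H (Suc m) * pderiv (?H m))"
  have eq: "x ^ i * gue_density m x = (std_normal_density x * poly (A - B) x) / fact m" for x
    unfolding gue_density_def hermite_wronskian_eq_derivatives A_def B_def
    by (simp add: poly_monom algebra_simps)
  have expand: "gauss_integral (?X i * (pderiv (?H (Suc l)) * ?H N))
      = (\<Sum>j\<le>l. (real (Suc l) - real j) * real (Suc l choose j) * hermite_at_0 j
            * gauss_integral (?X (i + (l - j)) * ?H N))" for l N
  proof -
    have deg: "degree (pderiv (?H (Suc l))) \<le> l"
      by (rule degree_le) (simp add: coeff_pderiv coeff_monic_hermite binomial_eq_0)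
    have "pderiv (?H (Suc l)) = (\<Sum>k\<le>l. Polynomial.monom (coeff (pderiv (?H (Suc l))) k) k)"
      by (rule poly_as_sum_of_monoms'[symmetric, OF deg])
    also have "\<dots> = (\<Sum>j\<le>l. Polynomial.monom (coeff (pderiv (?H (Suc l))) (l - j)) (l - j))"
      using sum.nat_diff_reindex[of "\<lambda>k. Polynomial.monom (coeff (pderiv (?H (Suc l))) k) k" "Suc l"]
      by (simp only: lessThan_Suc_atMost diff_Suc_Suc)
    also have "\<dots> = (\<Sum>j\<le>l. Polynomial.smult ((real (Suc l) - real j) * real (Suc l choose j) * hermite_at_0 j) (?X (l - j)))"
    proof (intro sum.cong refl)
      fix j assume "j \<in> {..l}"
      then have "Suc (l - j) = Suc l - j" "j \<le> Suc l" "Suc l - (Suc l - j) = j" by auto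
      then have "coeff (pderiv (?H (Suc l))) (l - j)
          = (real (Suc l) - real j) * (real (Suc l choose j) * hermite_at_0 j)"
        unfolding coeff_pderiv coeff_monic_hermite
        by (simp only: binomial_symmetric[of j "Suc l", symmetric] of_nat_diff)
      then show "Polynomial.monom (coeff (pderiv (?H (Suc l))) (l - j)) (l - j)
        = Polynomial.smult ((real (Suc l) - real j) * real (Suc l choose j) * hermite_at_0 j) (?X (l - j))"
        by (simp add: smult_monom mult.assoc)
    qed
    finally have "?X i * (pderiv (?H (Suc l)) * ?H N)
       = (\<Sum>j\<le>l. Polynomial.smult ((real (Suc l) - real j) * real (Suc l choose j) * hermite_at_0 j)
             (?X (i + (l - j)) * ?H N))"
      by (simp only: sum_distrib_left sum_distrib_right mult_smult_left mult_smult_right mult.assoc[symmetric] mult_monom mult_1)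
    then show ?thesis by (simp only: gauss_integral_sum gauss_integral_smult)
  qed
  have A: "gauss_integral A / fact m
      = (\<Sum>j\<le>i. (real (Suc m) - real j) * (real (m + (i - j) choose (i - j)) * (real (Suc m choose j) * hermite_at_0 j * gauss_moment (i - j))))"
  proof -
    have "gauss_integral A / fact m = (\<Sum>j\<le>m. (real (Suc m) - real j) * real (Suc m choose j) * hermite_at_0 j
            * (gauss_integral (?X (i + (m - j)) * ?H m) / fact m))"
      unfolding A_def expand by (simp add: sum_divide_distrib)
    also have "\<dots> = (\<Sum>j\<le>i. (real (Suc m) - real j) * (real (m + (i - j) choose (i - j)) * (real (Suc m choose j) * hermite_at_0 j * gauss_moment (i - j))))"
    \<comment> \<open>Terms with \<open>j > i\<close> vanish by orthogonality, those with \<open>j > m\<close> by their coefficient.\<close>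
    proof (rule sum.mono_neutral_cong)
      fix j assume "j \<in> {..i} - {..m}"
      then have "j = Suc m \<or> Suc m < j" by auto
      then show "(real (Suc m) - real j) * (real (m + (i - j) choose (i - j)) * (real (Suc m choose j) * hermite_at_0 j * gauss_moment (i - j))) = 0"
        by (auto simp: binomial_eq_0 simp del: binomial_Suc_Suc)
    next
      fix j assume "j \<in> {..m} - {..i}"
      then show "(real (Suc m) - real j) * real (Suc m choose j) * hermite_at_0 j
            * (gauss_integral (?X (i + (m - j)) * ?H m) / fact m) = 0"
        by (auto simp: gauss_integral_monom_hermite)
    next
      fix j assume "j \<in> {..m} \<inter> {..i}"
      then have j: "m \<le> i + (m - j)" "i + (m - j) - m = i - j" "i + (m - j) = m + (i - j)" by auto
      have "real (m + (i - j) choose (i - j)) = fact (m + (i - j)) / (fact (i - j) * fact m)"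
        by (subst binomial_fact) simp_all
      then have "gauss_integral (?X (i + (m - j)) * ?H m) / fact m = real (m + (i - j) choose (i - j)) * gauss_moment (i - j)"
        unfolding gauss_integral_monom_hermite using j by (simp add: mult_ac)
      then show "(real (Suc m) - real j) * real (Suc m choose j) * hermite_at_0 j
            * (gauss_integral (?X (i + (m - j)) * ?H m) / fact m)
          = (real (Suc m) - real j) * (real (m + (i - j) choose (i - j)) * (real (Suc m choose j) * hermite_at_0 j * gauss_moment (i - j)))"
        by (simp only: mult_ac)
    qed auto
    finally show ?thesis .
  qed
  have B: "gauss_integral B / fact m
      = (\<Sum>j\<le>i. (real (Suc m) - real j) * (real (m + (i - j) choose (i - j)) * (hook_coeff m j * gauss_moment (Suc (i - j)))))"
  proof (cases m)
    case 0
    have z: "(1 - real j) * (hook_coeff 0 j * g) = 0" for j g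
      by (auto simp: hook_coeff_def binomial_eq_0_iff)
    show ?thesis by (simp add: B_def 0 pderiv_1 z)
  next
    case (Suc l)
    have "gauss_integral B / fact m = (\<Sum>j\<le>l. (real (Suc l) - real j) * real (Suc l choose j) * hermite_at_0 j
            * (gauss_integral (?X (i + (l - j)) * ?H (Suc m)) / fact m))"
    proof -
      have "B = ?X i * (pderiv (?H (Suc l)) * ?H (Suc m))"
        unfolding B_def by (simp only: Suc mult.commute)
      then show ?thesis by (simp only: expand) (simp add: sum_divide_distrib)
    qed
    also have "\<dots> = (\<Sum>j\<in>Suc ` {..l}. (real (Suc m) - real j) * (hook_coeff m j
            * (gauss_integral (?X (i + (m - j)) * ?H (Suc m)) / fact m)))"
      by (subst sum.reindex) (auto simp: Suc hook_coeff_def mult_ac intro!: sum.cong)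
    also have "\<dots> = (\<Sum>j\<le>i. (real (Suc m) - real j) * (real (m + (i - j) choose (i - j)) * (hook_coeff m j * gauss_moment (Suc (i - j)))))"
    proof (rule sum.mono_neutral_cong)
      fix j assume "j \<in> {..i} - Suc ` {..l}"
      then have "j = 0 \<or> j = Suc m \<or> m < j - 1" using Suc by (cases j) auto
      then show "(real (Suc m) - real j) * (real (m + (i - j) choose (i - j)) * (hook_coeff m j * gauss_moment (Suc (i - j)))) = 0"
        by (auto simp: hook_coeff_def binomial_eq_0)
    next
      fix j assume "j \<in> Suc ` {..l} - {..i}"
      then show "(real (Suc m) - real j) * (hook_coeff m j * (gauss_integral (?X (i + (m - j)) * ?H (Suc m)) / fact m)) = 0"
        using Suc by (auto simp: gauss_integral_monom_hermite)
    next
      fix j assume "j \<in> Suc ` {..l} \<inter> {..i}"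
      then have j: "i + (m - j) = m + (i - j)" using Suc by auto
      have c: "real (m + (i - j) choose (i - j)) = fact (m + (i - j)) / (fact (i - j) * fact m)"
        by (subst binomial_fact) simp_all
      have "gauss_integral (?X (i + (m - j)) * ?H (Suc m)) / fact m
          = real (m + (i - j) choose (i - j)) * gauss_moment (Suc (i - j))"
        unfolding j gauss_integral_monom_hermite c
        by (cases "i - j") (simp_all add: gauss_moment_Suc_Suc)
      then show "(real (Suc m) - real j) * (hook_coeff m j * (gauss_integral (?X (i + (m - j)) * ?H (Suc m)) / fact m))
         = (real (Suc m) - real j) * (real (m + (i - j) choose (i - j)) * (hook_coeff m j * gauss_moment (Suc (i - j))))"
        by (simp only: mult_ac)
    qed auto
    finally show ?thesis .
  qed
  have "(LINT x|lborel. x ^ i * gue_density m x) = (gauss_integral A - gauss_integral B) / fact m"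
    unfolding eq integral_divide_zero gauss_integral_diff[symmetric] by (simp only: gauss_integral_def)
  also have "\<dots> = gue_moment m i"
    unfolding diff_divide_distrib A B gue_moment_def hook_mean_def sum_subtractf[symmetric]
    by (intro sum.cong refl) (simp only: right_diff_distrib)
  finally have "(LINT x|lborel. x ^ i * gue_density m x) = gue_moment m i" .
  moreover have "integrable lborel (\<lambda>x. x ^ i * gue_density m x)"
    unfolding eq by (intro integrable_divide std_normal_integrable_poly)
  ultimately show ?thesis by (simp add: has_bochner_integral_iff)
qed

section \<open>Determinacy of the moment problem\<close>

lemma continuous_AE_eq_imp_eq:
  fixes f g :: "real \<Rightarrow> real"
  assumes "continuous_on UNIV f" "continuous_on UNIV g" and ae: "AE x in lborel. f x = g x"
  shows "f = g"
proof -
  have op: "open {x. f x \<noteq> g x}"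
    by (rule open_Collect_neq[OF assms(1,2)])
  have "{x. f x \<noteq> g x} \<in> null_sets lborel"
    using ae op by (subst AE_iff_null_sets) auto
  then have "negligible {x. f x \<noteq> g x}"
    by (simp add: negligible_iff_null_sets null_sets_completionI)
  then have "{x. f x \<noteq> g x} = {}"
    using open_not_negligible[OF op] by blast
  then show ?thesis by auto
qed

lemma real_distribution_normalized_density:
  fixes f :: "real \<Rightarrow> real"
  assumes cont: "continuous_on UNIV f" and nonneg: "\<And>x. 0 \<le> f x"
    and mom: "\<And>k. has_bochner_integral lborel (\<lambda>x. x ^ k * f x) (\<mu> k)" and "\<mu> 0 > 0"
  defines "D \<equiv> density lborel (\<lambda>x. ennreal (f x / \<mu> 0))"
  shows "real_distribution D"
    and "integrable D (\<lambda>x. x ^ k)"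
    and "(LINT x|D. x ^ k) = \<mu> k / \<mu> 0"
proof -
  have meas [measurable]: "f \<in> borel_measurable borel"
    by (rule borel_measurable_continuous_onI[OF cont])
  have int: "integrable lborel (\<lambda>x. x ^ k * f x)" "(LINT x|lborel. x ^ k * f x) = \<mu> k" for k
    using mom[of k] by (auto simp: has_bochner_integral_iff)
  have "emeasure D (space D) = (\<integral>\<^sup>+x. ennreal (f x / \<mu> 0) \<partial>lborel)"
    unfolding D_def by (subst emeasure_density) auto
  also have "\<dots> = ennreal (LINT x|lborel. f x / \<mu> 0)"
    using int(1)[of 0] nonneg \<open>\<mu> 0 > 0\<close> by (intro nn_integral_eq_integral) auto
  also have "\<dots> = 1"
    using int(2)[of 0] \<open>\<mu> 0 > 0\<close> by simp
  finally have "prob_space D" by (rule prob_spaceI)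
  then show "real_distribution D"
    unfolding real_distribution_def real_distribution_axioms_def by (simp add: D_def)
  have dens: "0 \<le> f x / \<mu> 0" for x using nonneg \<open>\<mu> 0 > 0\<close> by simp
  have eq: "(\<lambda>x. (f x / \<mu> 0) *\<^sub>R x ^ k) = (\<lambda>x. (x ^ k * f x) / \<mu> 0)"
    by (auto simp: mult.commute)
  have "integrable D (\<lambda>x. x ^ k) \<longleftrightarrow> integrable lborel (\<lambda>x. (f x / \<mu> 0) *\<^sub>R x ^ k)"
    unfolding D_def by (rule integrable_density) (use dens in auto)
  then show "integrable D (\<lambda>x. x ^ k)"
    unfolding eq by (simp only: integrable_divide[OF int(1)])
  have "(LINT x|D. x ^ k) = (LINT x|lborel. (f x / \<mu> 0) *\<^sub>R x ^ k)"
    unfolding D_def by (rule integral_density) (use dens in auto)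
  then show "(LINT x|D. x ^ k) = \<mu> k / \<mu> 0"
    unfolding eq by (simp only: integral_divide_zero int(2))
qed

text \<open>
The growth condition makes the Taylor polynomials of the characteristic functions converge, and
these polynomials depend on the moments only. Even orders suffice and avoid absolute moments.
\<close>
lemma density_determined_by_moments:
  fixes f g :: "real \<Rightarrow> real"
  assumes f: "continuous_on UNIV f" "\<And>x. 0 \<le> f x" "\<And>k. has_bochner_integral lborel (\<lambda>x. x ^ k * f x) (\<mu> k)"
    and g: "continuous_on UNIV g" "\<And>x. 0 \<le> g x" "\<And>k. has_bochner_integral lborel (\<lambda>x. x ^ k * g x) (\<mu> k)"
    and pos: "\<mu> 0 > 0"
    and growth: "\<And>t. (\<lambda>l. t ^ (2 * l) / fact (2 * l) * \<mu> (2 * l)) \<longlonglongrightarrow> 0"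
  shows "f = g"
proof -
  define F where "F = density lborel (\<lambda>x. ennreal (f x / \<mu> 0))"
  define G where "G = density lborel (\<lambda>x. ennreal (g x / \<mu> 0))"
  note Fd = real_distribution_normalized_density[OF f pos, folded F_def]
  note Gd = real_distribution_normalized_density[OF g pos, folded G_def]
  interpret F: real_distribution F by (rule Fd(1))
  interpret G: real_distribution G by (rule Gd(1))
  have "char F t = char G t" for t
  proof -
    let ?s = "\<lambda>l. \<Sum>k\<le>2 * l. (\<i> * t) ^ k / fact k * complex_of_real (\<mu> k / \<mu> 0)"
    let ?b = "\<lambda>l. 2 * \<bar>t\<bar> ^ (2 * l) / fact (2 * l) * (\<mu> (2 * l) / \<mu> 0)"
    have even_abs: "\<bar>x\<bar> ^ (2 * l) = x ^ (2 * l)" for x :: real and l :: nat by (rule power_even_abs) simp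
    have bF: "cmod (char F t - ?s l) \<le> ?b l" for l
      using F.char_approx1[of "2 * l" t, OF Fd(2)] unfolding even_abs Fd(3) by simp
    have bG: "cmod (char G t - ?s l) \<le> ?b l" for l
      using G.char_approx1[of "2 * l" t, OF Gd(2)] unfolding even_abs Gd(3) by simp
    have triangle: "cmod (x - y) \<le> cmod (x - s) + cmod (y - s)" for x y s :: complex
      using norm_triangle_ineq4[of "x - s" "y - s"] by simp
    have bound: "cmod (char F t - char G t) \<le> 4 / \<mu> 0 * (t ^ (2 * l) / fact (2 * l) * \<mu> (2 * l))" for l
    proof -
      have "2 * a / b * (c / e) + 2 * a / b * (c / e) = 4 / e * (a / b * c)" for a b c e :: real
        by (simp only: mult_2[symmetric]) (simp add: divide_inverse)
      then have "?b l + ?b l = 4 / \<mu> 0 * (t ^ (2 * l) / fact (2 * l) * \<mu> (2 * l))"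
        unfolding even_abs .
      with triangle[of "char F t" "char G t" "?s l"] bF[of l] bG[of l] show ?thesis by linarith
    qed
    have "(\<lambda>l. 4 / \<mu> 0 * (t ^ (2 * l) / fact (2 * l) * \<mu> (2 * l))) \<longlonglongrightarrow> 4 / \<mu> 0 * 0"
      by (intro tendsto_mult tendsto_const growth)
    then have "cmod (char F t - char G t) \<le> 4 / \<mu> 0 * 0"
      by (rule LIMSEQ_le_const) (use bound in blast)
    then show ?thesis by simp
  qed
  then have "F = G"
    by (intro Levy_uniqueness Fd(1) Gd(1) ext)
  have [measurable]: "f \<in> borel_measurable borel" "g \<in> borel_measurable borel"
    by (intro borel_measurable_continuous_onI f g)+
  from \<open>F = G\<close> have "AE x in lborel. ennreal (f x / \<mu> 0) = ennreal (g x / \<mu> 0)"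
    unfolding F_def G_def by (subst (asm) sigma_finite_measure.density_unique_iff[OF sigma_finite_lborel]) auto
  then have "AE x in lborel. f x = g x"
    by eventually_elim (use f(2) g(2) pos in auto)
  then show ?thesis by (rule continuous_AE_eq_imp_eq[OF f(1) g(1)])
qed

lemma even_power_over_fact_le_exp: "y ^ (2 * l) / fact (2 * l) \<le> exp y + exp (- (y::real))"
proof -
  have "(\<lambda>n. \<bar>y\<bar> ^ n /\<^sub>R fact n) sums exp \<bar>y\<bar>" by (rule exp_converges)
  then have "(\<Sum>n\<in>{2 * l}. \<bar>y\<bar> ^ n /\<^sub>R fact n) \<le> exp \<bar>y\<bar>"
    by (intro sum_le_suminf[of "\<lambda>n. \<bar>y\<bar> ^ n /\<^sub>R fact n", THEN order_trans]) (auto simp: sums_iff)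
  then have "\<bar>y\<bar> ^ (2 * l) / fact (2 * l) \<le> exp \<bar>y\<bar>"
    by (simp add: divide_inverse mult.commute)
  then have "y ^ (2 * l) / fact (2 * l) \<le> exp \<bar>y\<bar>"
    by (simp only: power_even_abs even_mult_iff even_numeral simp_thms)
  also have "\<dots> \<le> exp y + exp (- y)"
    by (cases "0 \<le> y") (simp_all add: abs_if)
  finally show ?thesis .
qed

text \<open>
Completing the square, the integrand is a polynomial times a shifted Gaussian.
\<close>
lemma exp_times_gue_density_integrable:
  "integrable lborel (\<lambda>x. exp (t * x) * gue_density m x)"
proof -
  define W where "W = pderiv (monic_hermite (Suc m)) * monic_hermite m - monic_hermite (Suc m) * pderiv (monic_hermite m)"
  have "integrable lborel (\<lambda>x. std_normal_density x * poly (pcompose W [:t, 1:]) x)"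
    by (rule std_normal_integrable_poly)
  from lborel_integrable_real_affine[OF this, of 1 "- t"]
  have "integrable lborel (\<lambda>x. exp (t\<^sup>2 / 2) / fact m * (std_normal_density (x - t) * poly W x))"
    by (intro integrable_mult_right) (simp add: poly_pcompose algebra_simps)
  moreover have "exp (t\<^sup>2 / 2) / fact m * (std_normal_density (x - t) * poly W x) = exp (t * x) * gue_density m x" for x
  proof -
    have "exp (t\<^sup>2 / 2) * std_normal_density (x - t) = exp (t * x) * std_normal_density x"
      unfolding std_normal_density_def
      by (simp add: exp_add[symmetric] mult.left_commute power2_eq_square)
         (simp add: field_simps flip: exp_add)
    moreover have "poly W x = hermite_wronskian m x"
      by (simp add: W_def hermite_wronskian_eq_derivatives)
    ultimately show ?thesis by (simp add: gue_density_def)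
  qed
  ultimately show ?thesis by simp
qed

text \<open>
Dominated convergence: the terms \<open>(t x)\<^sup>2\<^sup>l / (2 l)!\<close> tend to \<open>0\<close> pointwise and are bounded by
\<open>e\<^sup>t\<^sup>x + e\<^sup>-\<^sup>t\<^sup>x\<close>.
\<close>
lemma gue_density_moment_growth:
  "(\<lambda>l. t ^ (2 * l) / fact (2 * l) * (LINT x|lborel. x ^ (2 * l) * gue_density m x)) \<longlonglongrightarrow> 0"
proof -
  have meas [measurable]: "gue_density m \<in> borel_measurable borel"
    by (rule borel_measurable_continuous_onI[OF continuous_gue_density])
  have "(\<lambda>l. LINT x|lborel. (t * x) ^ (2 * l) / fact (2 * l) * gue_density m x)
      \<longlonglongrightarrow> integral\<^sup>L lborel (\<lambda>x :: real. 0 :: real)"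
  proof (rule integral_dominated_convergence[where
        s = "\<lambda>l x. (t * x) ^ (2 * l) / fact (2 * l) * gue_density m x" and f = "\<lambda>_. 0"
        and w = "\<lambda>x. (exp (t * x) + exp (- (t * x))) * gue_density m x"])
    show "integrable lborel (\<lambda>x. (exp (t * x) + exp (- (t * x))) * gue_density m x)"
      using Bochner_Integration.integrable_add[OF exp_times_gue_density_integrable[of t m]
          exp_times_gue_density_integrable[of "- t" m]]
      by (simp only: distrib_right mult_minus_left)
    show "AE x in lborel. norm ((t * x) ^ (2 * l) / fact (2 * l) * gue_density m x)
        \<le> (exp (t * x) + exp (- (t * x))) * gue_density m x" for l
    proof (rule AE_I2)
      fix x
      have "0 \<le> (t * x) ^ (2 * l) / fact (2 * l) * gue_density m x"
        by (intro mult_nonneg_nonneg divide_nonneg_nonneg zero_le_even_power less_imp_le[OF gue_density_pos]) auto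
      then have "norm ((t * x) ^ (2 * l) / fact (2 * l) * gue_density m x) = (t * x) ^ (2 * l) / fact (2 * l) * gue_density m x"
        unfolding real_norm_def by (rule abs_of_nonneg)
      also have "\<dots> \<le> (exp (t * x) + exp (- (t * x))) * gue_density m x"
        by (intro mult_right_mono even_power_over_fact_le_exp) (use gue_density_pos[of m x] in simp)
      finally show "norm ((t * x) ^ (2 * l) / fact (2 * l) * gue_density m x)
        \<le> (exp (t * x) + exp (- (t * x))) * gue_density m x" .
    qed
    show "AE x in lborel. (\<lambda>l. (t * x) ^ (2 * l) / fact (2 * l) * gue_density m x) \<longlonglongrightarrow> 0"
    proof (rule AE_I2)
      fix x
      have "(\<lambda>n. (t * x) ^ n /\<^sub>R fact n) \<longlonglongrightarrow> 0"
        by (rule summable_LIMSEQ_zero[OF summable_exp_generic])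
      then have "(\<lambda>l. (t * x) ^ (2 * l) /\<^sub>R fact (2 * l)) \<longlonglongrightarrow> 0"
        by (rule filterlim_compose) (rule filterlim_subseq, simp add: strict_mono_def)
      then show "(\<lambda>l. (t * x) ^ (2 * l) / fact (2 * l) * gue_density m x) \<longlonglongrightarrow> 0"
        by (intro tendsto_mult_left_zero) (simp add: divide_inverse mult.commute)
    qed
    show "(\<lambda>x. (t * x) ^ (2 * l) / fact (2 * l) * gue_density m x) \<in> borel_measurable lborel" for l
      by measurable
  qed (rule borel_measurable_const)
  moreover have "(LINT x|lborel. (t * x) ^ (2 * l) / fact (2 * l) * gue_density m x)
      = t ^ (2 * l) / fact (2 * l) * (LINT x|lborel. x ^ (2 * l) * gue_density m x)" for l
  proof -
    have "(\<lambda>x. (t * x) ^ (2 * l) / fact (2 * l) * gue_density m x)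
        = (\<lambda>x. t ^ (2 * l) / fact (2 * l) * (x ^ (2 * l) * gue_density m x))"
      by (auto simp: power_mult_distrib)
    then show ?thesis by simp
  qed
  ultimately show ?thesis by simp
qed

section \<open>The one-point function of the GUE\<close>

lemma gauss_space_measurable_entry:
  assumes "j < d"
  shows "(\<lambda>z. z j) \<in> borel_measurable (gauss_space d)"
proof -
  have "(\<lambda>z. z j) \<in> measurable (gauss_space d) (density lborel (\<lambda>x. ennreal (std_normal_density x)))"
    unfolding gauss_space_def by (rule measurable_component_singleton) (use assms in simp)
  then show ?thesis by (simp add: measurable_def)
qed

lemma (in gue_basis) M_measurable: "M \<in> measurable (gauss_space d) (hermitian_borel n)"
  unfolding hermitian_borel_def
proof (rule measurable_vimage_algebra2)
  show "M \<in> space (gauss_space d) \<rightarrow> hermitian_mats n"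
    using M_hermitian by simp
  show "(\<lambda>z. \<lambda>rs\<in>{..<n} \<times> {..<n}. M z $$ rs)
      \<in> measurable (gauss_space d) (\<Pi>\<^sub>M rs\<in>{..<n} \<times> {..<n}. (borel :: complex measure))"
  proof (rule measurable_restrict)
    fix rs assume "rs \<in> {..<n} \<times> {..<n}"
    then obtain a b where rs: "rs = (a, b)" "a < n" "b < n" by auto
    have "(\<lambda>z. complex_of_real (z j)) \<in> borel_measurable (gauss_space d)" if "j < d" for j
      by (rule measurable_compose[OF gauss_space_measurable_entry[OF that]]) measurable
    then have "(\<lambda>z. \<Sum>j<d. complex_of_real (z j) * E j $$ (a, b)) \<in> borel_measurable (gauss_space d)"
      by (intro borel_measurable_sum borel_measurable_times borel_measurable_const) simp
    then show "(\<lambda>z. M z $$ rs) \<in> borel_measurable (gauss_space d)"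
      using rs by (simp add: M_index)
  qed
qed

lemma space_hermitian_borel: "space (hermitian_borel n) = hermitian_mats n"
  by (simp add: hermitian_borel_def)

lemma hermitian_borel_entry_measurable:
  assumes "a < n" "b < n"
  shows "(\<lambda>A. A $$ (a, b)) \<in> borel_measurable (hermitian_borel n)"
proof -
  let ?f = "\<lambda>A. \<lambda>rs\<in>{..<n} \<times> {..<n}. (A :: complex mat) $$ rs"
  have "?f \<in> measurable (hermitian_borel n) (\<Pi>\<^sub>M rs\<in>{..<n} \<times> {..<n}. (borel :: complex measure))"
    unfolding hermitian_borel_def by (rule measurable_vimage_algebra1) (auto simp: space_PiM)
  moreover have "(\<lambda>g. g (a, b)) \<in> measurable (\<Pi>\<^sub>M rs\<in>{..<n} \<times> {..<n}. (borel :: complex measure)) borel"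
    by (rule measurable_component_singleton) (use assms in simp)
  ultimately have "(\<lambda>A. ?f A (a, b)) \<in> borel_measurable (hermitian_borel n)"
    by (rule measurable_compose)
  then show ?thesis using assms by simp
qed

lemma hermitian_borel_power_measurable:
  assumes "a < n" "b < n"
  shows "(\<lambda>A. (A ^\<^sub>m i) $$ (a, b)) \<in> borel_measurable (hermitian_borel n)"
  using assms
proof (induction i arbitrary: b)
  case 0
  have "(\<lambda>A. (A ^\<^sub>m 0) $$ (a, b)) \<in> borel_measurable (hermitian_borel n)
      \<longleftrightarrow> (\<lambda>A. if a = b then 1 else 0 :: complex) \<in> borel_measurable (hermitian_borel n)"
    by (rule measurable_cong) (use 0 in \<open>auto simp: space_hermitian_borel hermitian_mats_def\<close>)
  then show ?case by simp
next
  case (Suc i)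
  have "(\<lambda>A. (A ^\<^sub>m Suc i) $$ (a, b)) \<in> borel_measurable (hermitian_borel n)
      \<longleftrightarrow> (\<lambda>A. \<Sum>c<n. (A ^\<^sub>m i) $$ (a, c) * A $$ (c, b)) \<in> borel_measurable (hermitian_borel n)"
  proof (rule measurable_cong)
    fix A assume "A \<in> space (hermitian_borel n)"
    then have A: "A \<in> carrier_mat n n" by (simp add: space_hermitian_borel hermitian_mats_def)
    with pow_carrier_mat[OF A, of i] Suc.prems
    show "(A ^\<^sub>m Suc i) $$ (a, b) = (\<Sum>c<n. (A ^\<^sub>m i) $$ (a, c) * A $$ (c, b))"
      by (auto simp: scalar_prod_def atLeast0LessThan intro!: sum.cong)
  qed
  moreover have "(\<lambda>A. \<Sum>c<n. (A ^\<^sub>m i) $$ (a, c) * A $$ (c, b)) \<in> borel_measurable (hermitian_borel n)"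
    by (intro borel_measurable_sum borel_measurable_times Suc.IH hermitian_borel_entry_measurable)
       (use Suc.prems in auto)
  ultimately show ?case by blast
qed

lemma mat_tr_poly_of_mat:
  assumes "A \<in> carrier_mat n n"
  shows "mat_tr (poly_of_mat q A)
    = (\<Sum>i\<le>degree q. complex_of_real (coeff q i) * (\<Sum>a<n. (A ^\<^sub>m i) $$ (a, a)))"
proof -
  have "mat_tr (poly_of_mat q A) = (\<Sum>a<n. \<Sum>i\<le>degree q. complex_of_real (coeff q i) * (A ^\<^sub>m i) $$ (a, a))"
    using assms by (simp add: mat_tr_def poly_of_mat_def)
  also have "\<dots> = (\<Sum>i\<le>degree q. \<Sum>a<n. complex_of_real (coeff q i) * (A ^\<^sub>m i) $$ (a, a))"
    by (rule sum.swap)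
  finally show ?thesis by (simp add: sum_distrib_left)
qed

lemma hermitian_borel_trace_measurable:
  "(\<lambda>A. mat_tr (poly_of_mat q A)) \<in> borel_measurable (hermitian_borel n)"
proof -
  have "(\<lambda>A. mat_tr (poly_of_mat q A)) \<in> borel_measurable (hermitian_borel n)
    \<longleftrightarrow> (\<lambda>A. \<Sum>i\<le>degree q. complex_of_real (coeff q i) * (\<Sum>a<n. (A ^\<^sub>m i) $$ (a, a))) \<in> borel_measurable (hermitian_borel n)"
    by (rule measurable_cong) (simp add: mat_tr_poly_of_mat space_hermitian_borel hermitian_mats_def)
  moreover have "(\<lambda>A. \<Sum>i\<le>degree q. complex_of_real (coeff q i) * (\<Sum>a<n. (A ^\<^sub>m i) $$ (a, a))) \<in> borel_measurable (hermitian_borel n)"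
    by (intro borel_measurable_sum borel_measurable_times borel_measurable_const hermitian_borel_power_measurable) auto
  ultimately show ?thesis by blast
qed

lemma gue_trace_expectation:
  assumes "gue_random_matrix (Suc m) P X"
  shows "integrable P (\<lambda>\<omega>. mat_tr (poly_of_mat q (X \<omega>)))"
    and "(LINT \<omega>|P. mat_tr (poly_of_mat q (X \<omega>)))
      = complex_of_real (\<Sum>i\<le>degree q. coeff q i * gue_moment m i)"
proof -
  from assms obtain d E where meas: "X \<in> measurable P (hermitian_borel (Suc m))"
    and basis: "hermitian_orthonormal_basis (Suc m) d E"
    and law: "distr P (hermitian_borel (Suc m)) X = gaussian_lincomb_law (Suc m) d E"
    unfolding gue_random_matrix_def by blast
  interpret gue_basis "Suc m" d E by unfold_locales (rule basis)
  let ?T = "\<lambda>A. mat_tr (poly_of_mat q A)"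
  have law': "distr P (hermitian_borel (Suc m)) X = distr (gauss_space d) (hermitian_borel (Suc m)) M"
    unfolding law gaussian_lincomb_law_def gauss_space_def ..
  have T: "?T (M z) = (\<Sum>i\<le>degree q. complex_of_real (coeff q i) * power_trace i z)" for z
    by (simp add: mat_tr_poly_of_mat[OF M_carrier] power_trace_def mpow_def)
  have int: "integrable (gauss_space d) (power_trace i)" for i
    by (rule mean_power_trace(2)) (rule refl)
  have int_T: "integrable (gauss_space d) (\<lambda>z. ?T (M z))"
    unfolding T by (intro Bochner_Integration.integrable_sum integrable_mult_right int)
  have "integrable (distr P (hermitian_borel (Suc m)) X) ?T"
    unfolding law' using int_T
    by (subst integrable_distr_eq[OF M_measurable hermitian_borel_trace_measurable])
  then show "integrable P (\<lambda>\<omega>. ?T (X \<omega>))"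
    by (subst (asm) integrable_distr_eq[OF meas hermitian_borel_trace_measurable])
  have "(LINT \<omega>|P. ?T (X \<omega>)) = integral\<^sup>L (distr P (hermitian_borel (Suc m)) X) ?T"
    by (rule integral_distr[OF meas hermitian_borel_trace_measurable, symmetric])
  also have "\<dots> = mean (\<lambda>z. ?T (M z))"
    unfolding law' by (rule integral_distr[OF M_measurable hermitian_borel_trace_measurable])
  also have "\<dots> = (\<Sum>i\<le>degree q. complex_of_real (coeff q i) * mean (power_trace i))"
    unfolding T by (subst Bochner_Integration.integral_sum) (use int in auto)
  also have "\<dots> = complex_of_real (\<Sum>i\<le>degree q. coeff q i * gue_moment m i)"
    by (simp add: mean_power_trace(1)[OF refl])
  finally show "(LINT \<omega>|P. ?T (X \<omega>)) = complex_of_real (\<Sum>i\<le>degree q. coeff q i * gue_moment m i)" .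
qed

lemma gue_density_poly_integral:
  "has_bochner_integral lborel (\<lambda>x. poly q x * gue_density m x) (\<Sum>i\<le>degree q. coeff q i * gue_moment m i)"
proof -
  have "has_bochner_integral lborel (\<lambda>x. \<Sum>i\<le>degree q. coeff q i * (x ^ i * gue_density m x))
      (\<Sum>i\<le>degree q. coeff q i * gue_moment m i)"
    by (intro has_bochner_integral_sum has_bochner_integral_mult_right gue_density_moment)
  then show ?thesis by (simp add: poly_altdef sum_distrib_right mult.assoc)
qed

lemma is_one_point_function_gue_density:
  assumes "gue_random_matrix (Suc m) P X"
  shows "is_one_point_function P X (gue_density m)"
  unfolding is_one_point_function_def
  using gue_trace_expectation[OF assms] gue_density_poly_integral[of _ m]
    continuous_gue_density gue_density_pos[of m]
  by (auto simp: has_bochner_integral_iff intro: less_imp_le)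

lemma is_one_point_function_moment:
  assumes "gue_random_matrix (Suc m) P X" "is_one_point_function P X R"
  shows "has_bochner_integral lborel (\<lambda>x. x ^ k * R x) (gue_moment m k)"
proof -
  let ?q = "Polynomial.monom (1 :: real) k"
  have int: "integrable lborel (\<lambda>x. poly ?q x * R x)"
    and eq: "complex_of_real (LINT x|lborel. poly ?q x * R x) = (LINT \<omega>|P. mat_tr (poly_of_mat ?q (X \<omega>)))"
    using assms(2) unfolding is_one_point_function_def by blast+
  have "(\<Sum>i\<le>degree ?q. coeff ?q i * gue_moment m i) = gue_moment m k"
    by (simp add: degree_monom_eq if_distrib[of "\<lambda>x. x * _"] cong: if_cong)
  then have "complex_of_real (LINT x|lborel. x ^ k * R x) = complex_of_real (gue_moment m k)"
    using eq unfolding gue_trace_expectation(2)[OF assms(1)] by (simp add: poly_monom)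
  then show ?thesis
    using int by (simp add: has_bochner_integral_iff poly_monom)
qed

lemma one_point_function_eq_gue_density:
  assumes "gue_random_matrix (Suc m) P X"
  shows "one_point_function P X = gue_density m"
  unfolding one_point_function_def
proof (rule the_equality)
  show "is_one_point_function P X (gue_density m)"
    by (rule is_one_point_function_gue_density[OF assms])
  fix R assume R: "is_one_point_function P X R"
  show "R = gue_density m"
  proof (rule density_determined_by_moments)
    show "continuous_on UNIV R" "\<And>x. 0 \<le> R x"
      using R unfolding is_one_point_function_def by blast+
    show "has_bochner_integral lborel (\<lambda>x. x ^ k * R x) (gue_moment m k)" for k
      by (rule is_one_point_function_moment[OF assms R])
    show "gue_moment m 0 > 0"
      by (simp add: gue_moment_def hook_mean_def hook_coeff_def)
    show "(\<lambda>l. t ^ (2 * l) / fact (2 * l) * gue_moment m (2 * l)) \<longlonglongrightarrow> 0" for t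
      using gue_density_moment_growth[of t m] gue_density_moment[of _ m]
      by (simp add: has_bochner_integral_iff)
  qed (auto intro: continuous_gue_density gue_density_moment less_imp_le gue_density_pos)
qed

section \<open>Values of the density and the theorem\<close>

lemma hermite_at_0_even: "hermite_at_0 (2 * k) = (-1) ^ k * fact (2 * k) / (2 ^ k * fact k)"
proof (induction k)
  case (Suc k)
  have "hermite_at_0 (2 * Suc k) = - real (2 * k + 1) * hermite_at_0 (2 * k)"
    using hermite_at_0_Suc_Suc[of "2 * k"] by simp
  also have "\<dots> = (-1) ^ Suc k * (2 * real (Suc k) * (real (2 * k + 1) * fact (2 * k))) / (2 * real (Suc k) * (2 ^ k * fact k))"
    unfolding Suc by (simp del: of_nat_Suc)
  also have "2 * real (Suc k) * (real (2 * k + 1) * fact (2 * k)) = fact (2 * Suc k)"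
    by (simp add: algebra_simps)
  also have "2 * real (Suc k) * (2 ^ k * fact k) = 2 ^ Suc k * fact (Suc k)"
    by (simp add: algebra_simps)
  finally show ?case .
qed simp

lemma gue_density_at_0_even: "gue_density (2 * k) 0 = central_density k"
proof -
  have "hermite_at_0 (Suc (2 * k)) = 0"
    using monic_hermite_parity[of "Suc (2 * k)" 0] by simp
  then have "gue_density (2 * k) 0 = std_normal_density 0 * (real (2 * k + 1) * (fact (2 * k) / (2 ^ k * fact k))\<^sup>2) / fact (2 * k)"
    unfolding gue_density_def hermite_wronskian_def hermite_at_0_even
    by (simp add: power_divide power_mult_distrib flip: power_mult)
  also have "\<dots> = std_normal_density 0 * (real (2 * k + 1) * fact (2 * k) / ((2 ^ k)\<^sup>2 * (fact k)\<^sup>2))"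
    by (simp add: power2_eq_square)
  also have "\<dots> = central_density k"
    unfolding central_density_def by (simp add: std_normal_density_def power_mult algebra_simps power2_eq_square power_mult_distrib[symmetric])
  finally show ?thesis .
qed

lemma hermite_p_zero_iff: "hermite_p n x = 0 \<longleftrightarrow> poly (monic_hermite n) x = 0"
  by (simp add: hermite_p_eq)

lemma gue_density_at_hermite_zero:
  assumes "poly (monic_hermite (Suc m)) x = 0"
  shows "gue_density m x = real (Suc m) / sqrt (2 * pi) * (hermite_p m x)\<^sup>2 * exp (- (x\<^sup>2 / 2))"
  using assms unfolding gue_density_def hermite_wronskian_def hermite_p_eq std_normal_density_def
  by (simp add: power_divide)

lemma cSUP_eq_attained:
  fixes f :: "real \<Rightarrow> real"
  assumes "\<And>x. f x \<le> f a"
  shows "bdd_above (range f)" "(SUP x. f x) = f a"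
proof -
  show "bdd_above (range f)" using assms by (intro bdd_aboveI[of _ "f a"]) auto
  show "(SUP x. f x) = f a"
    using assms by (intro cSup_eq_maximum) auto
qed

theorem theorem3p4:
  shows "\<exists>\<epsilon> :: nat \<Rightarrow> real.
    \<epsilon> \<in> O[inf sequentially (principal {n. odd n})](\<lambda>n. 1 / real n ^ 3) \<and>
    (\<forall>n (P :: 'a measure) M. n \<ge> 1 \<and> gue_random_matrix n P M \<longrightarrow>
      (let R = one_point_function P M in
        (\<forall>k. n = 2 * k + 1 \<longrightarrow>
           bdd_above (range R) \<and>
           (SUP x. R x) = R 0 \<and>
           R 0 = 1 / sqrt (2 * pi) * (fact (2 * k + 1) / (2 ^ (2 * k) * (fact k)\<^sup>2)) \<and>
           1 / sqrt (2 * pi) * (fact (2 * k + 1) / (2 ^ (2 * k) * (fact k)\<^sup>2))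
             = 1 / pi * sqrt (real n) * exp (1 / (4 * real n) + \<epsilon> n)) \<and>
        (even n \<longrightarrow>
           (\<exists>x\<^sub>n. is_smallest_positive_zero (hermite_p n) x\<^sub>n \<and>
              bdd_above (range R) \<and>
              (SUP x. R x) = R x\<^sub>n \<and> R (- x\<^sub>n) = R x\<^sub>n \<and>
              R x\<^sub>n = real n / sqrt (2 * pi) * (hermite_p (n - 1) x\<^sub>n)\<^sup>2 * exp (- (x\<^sub>n\<^sup>2 / 2)) \<and>
              (\<forall>x. x \<noteq> x\<^sub>n \<and> x \<noteq> - x\<^sub>n \<longrightarrow> R x < R x\<^sub>n)))))"
proof (intro exI[of _ "\<lambda>n. stirling_error (n div 2)"] conjI stirling_error_bigo allI impI)
  fix n and P :: "'a measure" and M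
  assume "n \<ge> 1 \<and> gue_random_matrix n P M"
  then obtain m where m: "n = Suc m" and gue: "gue_random_matrix (Suc m) P M"
    by (metis One_nat_def Suc_le_D)
  have R: "one_point_function P M = gue_density m"
    by (rule one_point_function_eq_gue_density[OF gue])
  have odd_case: "bdd_above (range (gue_density m)) \<and> (SUP x. gue_density m x) = gue_density m 0
      \<and> gue_density m 0 = central_density k
      \<and> central_density k = 1 / pi * sqrt (real n) * exp (1 / (4 * real n) + stirling_error (n div 2))"
    if k: "n = 2 * k + 1" for k
  proof -
    have mk: "m = 2 * k" "n div 2 = k" using k m by simp_all
    have "gue_density m x \<le> gue_density m 0" for x
      by (rule gue_density_le_at_0) (simp add: mk)
    note max = cSUP_eq_attained[of "gue_density m" 0, OF this]
    show ?thesis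
      using max gue_density_at_0_even[of k] central_density_eq_exp[of k] unfolding mk(2) k mk(1) by simp
  qed
  have even_case: "\<exists>x\<^sub>n. is_smallest_positive_zero (hermite_p n) x\<^sub>n \<and>
              bdd_above (range (gue_density m)) \<and>
              (SUP x. gue_density m x) = gue_density m x\<^sub>n \<and> gue_density m (- x\<^sub>n) = gue_density m x\<^sub>n \<and>
              gue_density m x\<^sub>n = real n / sqrt (2 * pi) * (hermite_p (n - 1) x\<^sub>n)\<^sup>2 * exp (- (x\<^sub>n\<^sup>2 / 2)) \<and>
              (\<forall>x. x \<noteq> x\<^sub>n \<and> x \<noteq> - x\<^sub>n \<longrightarrow> gue_density m x < gue_density m x\<^sub>n)"
    if "even n"
  proof -
    have "odd m" using that m by simp
    then obtain z where z: "is_smallest_positive_zero (poly (monic_hermite (Suc m))) z"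
      using hermite_smallest_positive_zero by blast
    then have zero: "poly (monic_hermite (Suc m)) z = 0"
      unfolding is_smallest_positive_zero_def by blast
    have strict: "gue_density m x < gue_density m z" if "x \<noteq> z \<and> x \<noteq> - z" for x
      using gue_density_less_at_smallest_zero[OF \<open>odd m\<close> z] that by blast
    have "gue_density m x \<le> gue_density m z" for x
      using strict[of x] by (cases "x = z \<or> x = - z") (auto simp: less_imp_le)
    note max = cSUP_eq_attained[of "gue_density m" z, OF this]
    have "is_smallest_positive_zero (hermite_p n) z"
      using z unfolding is_smallest_positive_zero_def m hermite_p_zero_iff .
    with max strict gue_density_at_hermite_zero[OF zero] show ?thesis
      by (intro exI[of _ z]) (simp add: m)
  qed
  show "let R = one_point_function P M in
        (\<forall>k. n = 2 * k + 1 \<longrightarrow>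
           bdd_above (range R) \<and>
           (SUP x. R x) = R 0 \<and>
           R 0 = 1 / sqrt (2 * pi) * (fact (2 * k + 1) / (2 ^ (2 * k) * (fact k)\<^sup>2)) \<and>
           1 / sqrt (2 * pi) * (fact (2 * k + 1) / (2 ^ (2 * k) * (fact k)\<^sup>2))
             = 1 / pi * sqrt (real n) * exp (1 / (4 * real n) + stirling_error (n div 2))) \<and>
        (even n \<longrightarrow>
           (\<exists>x\<^sub>n. is_smallest_positive_zero (hermite_p n) x\<^sub>n \<and>
              bdd_above (range R) \<and>
              (SUP x. R x) = R x\<^sub>n \<and> R (- x\<^sub>n) = R x\<^sub>n \<and>
              R x\<^sub>n = real n / sqrt (2 * pi) * (hermite_p (n - 1) x\<^sub>n)\<^sup>2 * exp (- (x\<^sub>n\<^sup>2 / 2)) \<and>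
              (\<forall>x. x \<noteq> x\<^sub>n \<and> x \<noteq> - x\<^sub>n \<longrightarrow> R x < R x\<^sub>n)))"
    unfolding Let_def R
    using odd_case[unfolded central_density_def] even_case by blast
qed

end
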